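(* Let $\theta$ be an inner function and let $\phi\in L^\infty$. The big truncated Toeplitz operator $T_\phi^\theta:K_\theta\to(K_\theta)^\perp$ is (i) zero if and only if $\phi\in\overline{\theta H^\infty}\cap\breve\theta H^\infty$; (ii) of finite rank if and only if $\phi\in\overline{\theta(H^\infty+\mathcal{R})}\cap\breve\theta(H^\infty+\mathcal{R})$.
   Context: $\mathbb{D}$ is the open unit disk and $\mathbb{T}$ the unit circle. $H^2$ is the Hardy space, viewed as a closed subspace of $L^2=L^2(\mathbb{T})$; $L^\infty=L^\infty(\mathbb{T})$; $H^\infty=L^\infty\cap H^2$. $\mathcal{R}$ is the set of rational functions $p(z)/q(z)$ such that all zeros of $q$ lie inside $\mathbb{D}$. For a set $E$ of functions, $\overline{E}$ denotes the set of complex conjugates of elements of $E$. $\breve f(\xi)=f(\bar\xi)$, and the flip operator $\mathcal{J}:L^2\to L^2$ is $(\mathcal{J}f)(\xi)=\bar\xi f(\bar\xi)$, $\xi\in\mathbb{T}$. For an inner function $\theta$, $K_\theta=H^2\ominus\theta H^2$ is the model space, $P_\theta:L^2\to K_\theta$ the orthogonal projection, and $(K_\theta)^\perp$ the orthogonal complement of $K_\theta$ in $L^2$. The big truncated Toeplitz operator is $T_\phi^\theta:K_\theta\to(K_\theta)^\perp$, $T_\phi^\theta(f)=(I-P_\theta)\mathcal{J}(\phi f)$, for $\phi\in L^\infty$.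
   Formalization: The "only if" in (i) is claimed only for nonconstant θ and in (ii) only for infinite-dimensional K_θ; otherwise T is always zero, resp. of finite rank, and the claim fails (θ=1, φ=z; θ=z, φ the indicator of a half circle). Both "if" parts hold for all inner θ. *)

theory Defs
  imports "HOL-Analysis.Analysis" "HOL-Library.Function_Algebras" "HOL-Library.Set_Algebras"
begin

text \<open>
  Elements of \<open>L\<^sup>2\<close> and \<open>L\<^sup>\<infinity>\<close> are represented by functions of type \<open>complex \<Rightarrow> complex\<close>; the
  values off the unit circle are irrelevant, since \<open>space circle = sphere 0 1\<close>. Sums and products
  of functions are pointwise (\<^theory>\<open>HOL-Library.Function_Algebras\<close>), and equality of elements of
  \<open>L\<^sup>2\<close> or \<open>L\<^sup>\<infinity>\<close> is equality almost everywhere on the circle.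
\<close>

text \<open>Normalized arc length on the unit circle.\<close>

definition circle :: "complex measure" where
  "circle = distr (uniform_measure lborel {0..2 * pi}) (restrict_space borel (sphere 0 1)) cis"

lemma measurable_cis_sphere:
  "cis \<in> uniform_measure lborel {0..2 * pi} \<rightarrow>\<^sub>M restrict_space borel (sphere 0 1)"
proof (rule measurable_restrict_space2)
  have "cis \<in> borel_measurable borel"
    by (intro borel_measurable_continuous_onI continuous_intros)
  then show "cis \<in> borel_measurable (uniform_measure lborel {0..2 * pi})"
    by simp
qed auto

lemma space_circle: "space circle = sphere 0 1"
  by (simp add: circle_def space_restrict_space)

lemma emeasure_circle: "emeasure circle (sphere 0 1) = 1"
proof -
  have "emeasure circle (sphere 0 1) =
      emeasure (uniform_measure lborel {0..2 * pi}) (cis -` sphere 0 1 \<inter> UNIV)"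
    unfolding circle_def
    by (subst emeasure_distr[OF measurable_cis_sphere]) (auto simp: sets_restrict_space)
  also have "cis -` sphere 0 1 \<inter> UNIV = UNIV"
    by auto
  finally show ?thesis
    by (simp add: ennreal_eq_0_iff divide_ennreal)
qed

definition L2 :: "(complex \<Rightarrow> complex) set" where
  "L2 = {f \<in> borel_measurable circle. integrable circle (\<lambda>\<xi>. (norm (f \<xi>))\<^sup>2)}"

definition Linf :: "(complex \<Rightarrow> complex) set" where
  "Linf = {f \<in> borel_measurable circle. \<exists>C. AE \<xi> in circle. norm (f \<xi>) \<le> C}"

definition l2_inner :: "(complex \<Rightarrow> complex) \<Rightarrow> (complex \<Rightarrow> complex) \<Rightarrow> complex" where
  "l2_inner f g = (LINT \<xi>|circle. f \<xi> * cnj (g \<xi>))"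

text \<open>
  The Hardy space as a closed subspace of \<open>L\<^sup>2\<close> (boundary functions): the Fourier coefficients
  with negative index vanish.
\<close>

definition H2 :: "(complex \<Rightarrow> complex) set" where
  "H2 = {f \<in> L2. \<forall>n::int. n < 0 \<longrightarrow> l2_inner f (\<lambda>\<xi>. \<xi> powi n) = 0}"

definition Hinf :: "(complex \<Rightarrow> complex) set" where
  "Hinf = Linf \<inter> H2"

definition inner_function :: "(complex \<Rightarrow> complex) \<Rightarrow> bool" where
  "inner_function \<theta> \<longleftrightarrow> \<theta> \<in> Hinf \<and> (AE \<xi> in circle. norm (\<theta> \<xi>) = 1)"

definition ae_constant :: "(complex \<Rightarrow> complex) \<Rightarrow> bool" where
  "ae_constant f \<longleftrightarrow> (\<exists>c. AE \<xi> in circle. f \<xi> = c)"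

text \<open>
  The condition on \<open>q\<close> excludes \<open>q = 0\<close>; the poles lie inside the open disk, so none is on the
  circle.
\<close>

definition rational_disk_poles :: "(complex \<Rightarrow> complex) set" where
  "rational_disk_poles =
     {(\<lambda>z. poly p z / poly q z) | p q. \<forall>z. poly q z = 0 \<longrightarrow> norm z < 1}"

definition breve :: "(complex \<Rightarrow> complex) \<Rightarrow> complex \<Rightarrow> complex" where
  "breve f = (\<lambda>\<xi>. f (cnj \<xi>))"

definition flip :: "(complex \<Rightarrow> complex) \<Rightarrow> complex \<Rightarrow> complex" where
  "flip f = (\<lambda>\<xi>. cnj \<xi> * f (cnj \<xi>))"

definition cnj_set :: "(complex \<Rightarrow> complex) set \<Rightarrow> (complex \<Rightarrow> complex) set" where
  "cnj_set E = (\<lambda>f \<xi>. cnj (f \<xi>)) ` E"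

text \<open>
  The functions whose class modulo null functions has a representative in \<open>E\<close>.
\<close>

definition ae_class :: "(complex \<Rightarrow> complex) set \<Rightarrow> (complex \<Rightarrow> complex) set" where
  "ae_class E = {f \<in> borel_measurable circle. \<exists>g\<in>E. AE \<xi> in circle. f \<xi> = g \<xi>}"

definition l2_orth :: "(complex \<Rightarrow> complex) set \<Rightarrow> (complex \<Rightarrow> complex) set" where
  "l2_orth S = {f \<in> L2. \<forall>g\<in>S. l2_inner f g = 0}"

text \<open>
  Orthogonal projection of \<open>f \<in> L2\<close> onto a closed subspace \<open>M\<close>. The chosen function is unique
  only up to a null set.
\<close>

definition l2_proj :: "(complex \<Rightarrow> complex) set \<Rightarrow> (complex \<Rightarrow> complex) \<Rightarrow> complex \<Rightarrow> complex" where
  "l2_proj M f = (SOME g. g \<in> M \<and> f - g \<in> l2_orth M)"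

definition model_space :: "(complex \<Rightarrow> complex) \<Rightarrow> (complex \<Rightarrow> complex) set" where
  "model_space \<theta> = H2 \<inter> l2_orth (\<theta> *o H2)"

text \<open>
  The big truncated Toeplitz operator, to be applied to elements of \<open>model_space \<theta>\<close>.
\<close>

definition big_tto ::
  "(complex \<Rightarrow> complex) \<Rightarrow> (complex \<Rightarrow> complex) \<Rightarrow> (complex \<Rightarrow> complex) \<Rightarrow> complex \<Rightarrow> complex" where
  "big_tto \<theta> \<phi> f = flip (\<phi> * f) - l2_proj (model_space \<theta>) (flip (\<phi> * f))"

text \<open>
  The span of \<open>S\<close> in \<open>L\<^sup>2\<close>, modulo null functions, is finite-dimensional.
\<close>

definition l2_finite_dim :: "(complex \<Rightarrow> complex) set \<Rightarrow> bool" where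
  "l2_finite_dim S \<longleftrightarrow>
     (\<exists>B. finite B \<and> B \<subseteq> L2 \<and>
        (\<forall>f\<in>S. \<exists>c. AE \<xi> in circle. f \<xi> = (\<Sum>b\<in>B. c b * b \<xi>)))"

definition big_tto_zero :: "(complex \<Rightarrow> complex) \<Rightarrow> (complex \<Rightarrow> complex) \<Rightarrow> bool" where
  "big_tto_zero \<theta> \<phi> \<longleftrightarrow> (\<forall>f\<in>model_space \<theta>. AE \<xi> in circle. big_tto \<theta> \<phi> f \<xi> = 0)"

definition big_tto_finite_rank :: "(complex \<Rightarrow> complex) \<Rightarrow> (complex \<Rightarrow> complex) \<Rightarrow> bool" where
  "big_tto_finite_rank \<theta> \<phi> \<longleftrightarrow> l2_finite_dim (big_tto \<theta> \<phi> ` model_space \<theta>)"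

end

(*
  Write K for the model space of theta, psi = cnj (breve theta) * phi and eta = cnj (theta * phi).
  The conditions on phi say that psi and eta lie in Hinf (respectively in Hinf + R). Since K is
  the set of f in H2 with cnj theta * f orthogonal to H2, the kernel of the operator consists of
  the f in K with psi * f in H2 and eta * C f in H2, where C f = theta * cnj (xi * f) is the
  conjugation of K.

  (i) The function k0 = 1 - cnj (theta(0)) * theta lies in K. If u * k0 is in H2 then so is u,
  because |theta(0)| < 1.

  (ii) If the rank is finite and K has infinite dimension, there is a nonzero f in K with psi * f in H2, and some
  nontrivial combination g of backward shifts of f also satisfies psi * g in H2. Up to a power of
  xi, g equals P * f - Q with polynomials P and Q, so that Q * psi is in H2; Q is not zero when
  only shifts beyond the first nonzero coefficient of f are combined. The zeros of Q outside the
  open disk can be divided out, and the component of psi orthogonal to H2 becomes a rational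
  function with the remaining zeros of Q as its poles. The same argument applies to eta.
  Conversely, for p/q in R and f in H2 the component of p * f / q orthogonal to H2 is s/q for a
  polynomial s of degree less than that of q.
*)
theory Submission
  imports Defs
begin

section \<open>Normalized arc length on the circle\<close>

text \<open>This rests on two facts: an \<open>L2\<close> function is determined a.e. by its
  coefficients, and \<open>L2\<close> splits into \<open>H2\<close> and its complement
  \<open>H2m\<close>. An f in K is in the kernel when flip (phi * f) is in K. Since flip exchanges
  \<open>H2\<close> and \<open>H2m\<close>, this puts a condition phi * f in \<open>H2m\<close> next
  to psi * f in \<open>H2\<close>. The conjugation C gives the first condition the shape of the
  second, so each part needs a single argument about a multiplier u with u * f in \<open>H2\<close>,
  used for psi and for eta. In (ii), K admits no multiplication by polynomials; backward shifts are
  the substitute. Infinite dimension serves to make f nonzero. The combination g of the shifts may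
  itself vanish: only Q matters, and Q * u = P * u * f - (power of xi) * u * g lies in
  \<open>H2\<close> in any case. If theta is constant, K is zero; if K is finite-dimensional, every
  phi gives finite rank. This is why the "only if" halves exclude these cases.\<close>

lemma sets_circle: "sets circle = sets (restrict_space borel (sphere 0 1))"
  by (simp add: circle_def)

lemma prob_space_circle: "emeasure circle (space circle) = 1"
  using emeasure_circle by (simp add: space_circle)

interpretation circle: finite_measure circle
  by standard (simp add: prob_space_circle)

lemma measure_circle: "measure circle (space circle) = 1"
  by (simp add: measure_def prob_space_circle)

lemma norm_eq_1_circle: "\<xi> \<in> space circle \<Longrightarrow> norm \<xi> = 1"
  by (simp add: space_circle)

lemma cnj_eq_inverse: "norm \<xi> = 1 \<Longrightarrow> cnj \<xi> = inverse \<xi>" for \<xi> :: complex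
  by (simp add: inverse_eq_divide complex_div_cnj[of 1])

lemma borel_measurable_circle: "f \<in> borel_measurable borel \<Longrightarrow> f \<in> borel_measurable circle"
  unfolding measurable_cong_sets[OF sets_circle refl] by (rule measurable_restrict_space1)

lemma measurable_id_circle [measurable]: "(\<lambda>\<xi>. \<xi>) \<in> borel_measurable circle"
  by (rule borel_measurable_circle) simp

lemma measurable_cnj [measurable]: "cnj \<in> borel_measurable borel"
  by (intro borel_measurable_continuous_onI continuous_intros)

lemma measurable_powi_circle [measurable]: "(\<lambda>\<xi>. \<xi> powi n) \<in> borel_measurable circle"
  unfolding power_int_def by (rule borel_measurable_circle) measurable

lemma measurable_cnj_circle [measurable]: "cnj \<in> measurable circle circle"
  unfolding measurable_cong_sets[OF sets_circle sets_circle]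
  by (rule measurable_restrict_space3) auto

text \<open>Conjugation on the circle is the reflection of the parameter interval;
  \<open>(-1) * t\<close> is spelled as in \<open>lborel_real_affine\<close>.\<close>

lemma cnj_cis_reflect: "cnj (cis t) = cis (2 * pi + (-1) * t)"
  by (simp add: cis_cnj complex_eq_iff)

lemma lborel_reflect: "distr lborel borel (\<lambda>t. c + (-1) * t) = (lborel :: real measure)"
  using lborel_real_affine[of "-1" c] by (simp add: density_1)

text \<open>The reflection of the parameter preserves Lebesgue measure and maps
  \<open>{0..2 * pi}\<close> onto itself. The transport of integrals, integrability and null sets
  along \<open>breve\<close> and \<open>flip\<close> rests on this.\<close>

lemma distr_circle_cnj: "distr circle circle cnj = circle"
proof (rule measure_eqI)
  fix A assume "A \<in> sets (distr circle circle cnj)"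
  then have A: "A \<in> sets circle" by simp
  define U :: "real measure" where "U = uniform_measure lborel {0..2 * pi}"
  have cis: "cis \<in> U \<rightarrow>\<^sub>M circle"
    unfolding U_def measurable_cong_sets[OF refl sets_circle] by (rule measurable_cis_sphere)
  have ca: "emeasure circle B = emeasure U (cis -` B)" if "B \<in> sets circle" for B
    using that emeasure_distr[OF measurable_cis_sphere, of B]
    by (simp add: circle_def U_def)
  have cisb: "cis -` B \<in> sets lborel" if "B \<in> sets circle" for B
    using measurable_sets[OF cis that] by (simp add: U_def)
  have "emeasure (distr circle circle cnj) A = emeasure circle (cnj -` A \<inter> space circle)"
    by (rule emeasure_distr) (use A in auto)
  also have "\<dots> = emeasure U (cis -` (cnj -` A \<inter> space circle))"
    by (rule ca) (use measurable_sets[OF measurable_cnj_circle A] in simp)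
  also have "cis -` (cnj -` A \<inter> space circle) = (\<lambda>t. 2 * pi + (-1) * t) -` (cis -` A)"
    by (auto simp: space_circle cnj_cis_reflect)
  also have "emeasure U \<dots> = emeasure lborel ({0..2 * pi} \<inter> ((\<lambda>t. 2 * pi + (-1) * t) -` (cis -` A))) / emeasure lborel {0..2 * pi}"
    unfolding U_def
    by (rule emeasure_uniform_measure)
       (use measurable_sets[of "\<lambda>t::real. 2 * pi + (-1) * t" lborel borel "cis -` A"] cisb[OF A] in \<open>simp_all\<close>)
  also have "{0..2 * pi} \<inter> ((\<lambda>t. 2 * pi + (-1) * t) -` (cis -` A)) = (\<lambda>t. 2 * pi + (-1) * t) -` ({0..2 * pi} \<inter> cis -` A) \<inter> space lborel"
    by auto
  also have "emeasure lborel \<dots> = emeasure (distr lborel borel (\<lambda>t. 2 * pi + (-1) * t)) ({0..2 * pi} \<inter> cis -` A)"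
    by (rule emeasure_distr[symmetric]) (use cisb[OF A] in auto)
  also have "\<dots> = emeasure lborel ({0..2 * pi} \<inter> cis -` A)"
    by (simp only: lborel_reflect)
  also have "\<dots> / emeasure lborel {0..2 * pi} = emeasure U (cis -` A)"
    unfolding U_def by (rule emeasure_uniform_measure[symmetric]) (use cisb[OF A] in auto)
  also have "\<dots> = emeasure circle A"
    by (rule ca[symmetric]) fact
  finally show "emeasure (distr circle circle cnj) A = emeasure circle A" .
qed simp

lemma integral_circle_cnj:
  fixes f :: "complex \<Rightarrow> complex"
  assumes "f \<in> borel_measurable circle"
  shows "(LINT \<xi>|circle. f (cnj \<xi>)) = (LINT \<xi>|circle. f \<xi>)"
  using integral_distr[OF measurable_cnj_circle assms] by (simp add: distr_circle_cnj)

lemma integrable_circle_cnj: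
  fixes f :: "complex \<Rightarrow> 'a :: {banach, second_countable_topology}"
  assumes "integrable circle f"
  shows "integrable circle (\<lambda>\<xi>. f (cnj \<xi>))"
  using integrable_distr[OF measurable_cnj_circle, of f] assms by (simp add: distr_circle_cnj)

lemma AE_circle_cnj:
  assumes "AE \<xi> in circle. P \<xi>"
  shows "AE \<xi> in circle. P (cnj \<xi>)"
  using AE_distrD[OF measurable_cnj_circle, of P] assms unfolding distr_circle_cnj by simp

text \<open>For n nonzero the integrand, written in the parameter t, has the periodic primitive
  \<open>cis (n * t) / (\<i> * n)\<close>.\<close>

lemma integral_powi_circle: "(LINT \<xi>|circle. \<xi> powi n) = (if n = 0 then 1 else 0)"
proof (cases "n = 0")
  case True
  then show ?thesis by (simp add: measure_circle)
next
  case False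
  have "(LINT \<xi>|circle. \<xi> powi n) = (LINT t|uniform_measure lborel {0..2 * pi}. cis t powi n)"
    unfolding circle_def
    by (rule integral_distr[OF measurable_cis_sphere])
       (use measurable_powi_circle in \<open>simp add: measurable_cong_sets[OF sets_circle refl]\<close>)
  also have "\<dots> = (LINT t|lborel. (indicator {0..2 * pi} t / (2 * pi)) *\<^sub>R cis (of_int n * t))"
  proof -
    have "uniform_measure lborel {0..2 * pi} = density lborel (\<lambda>t. ennreal (indicator {0..2 * pi} t / (2 * pi)))"
      unfolding uniform_measure_def
      by (intro arg_cong[where f = "density lborel"])
         (auto simp: fun_eq_iff indicator_def divide_ennreal ennreal_1[symmetric] simp del: ennreal_1)
    then show ?thesis
      by (simp, subst integral_density) (auto simp: cis_power_int intro!: borel_measurable_continuous_onI continuous_intros)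
  qed
  also have "\<dots> = (1 / (2 * pi)) *\<^sub>R (LINT t|lborel. indicator {0..2 * pi} t *\<^sub>R cis (of_int n * t))"
    by (subst integral_scaleR_right[symmetric]) (simp add: mult.commute)
  also have "(LINT t|lborel. indicator {0..2 * pi} t *\<^sub>R cis (of_int n * t)) =
      cis (of_int n * (2 * pi)) / (\<i> * of_int n) - cis (of_int n * 0) / (\<i> * of_int n)"
  proof (rule integral_FTC_Icc)
    fix t :: real
    show "((\<lambda>t. cis (of_int n * t) / (\<i> * of_int n)) has_vector_derivative cis (of_int n * t)) (at t within {0..2 * pi})"
    proof -
      have "((\<lambda>z. exp (\<i> * of_int n * z) / (\<i> * of_int n)) has_field_derivative
          exp (\<i> * of_int n * of_real t)) (at (of_real t))"
        using False by (auto intro!: derivative_eq_intros)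
      from has_vector_derivative_real_field[OF this]
      show ?thesis by (simp add: cis_conv_exp mult.assoc)
    qed
  qed (auto intro!: continuous_intros)
  also have "\<dots> = 0"
  proof -
    have "cis (of_int n * (2 * pi)) = cis (2 * pi) powi n" by (simp only: cis_power_int)
    then show ?thesis by simp
  qed
  finally show ?thesis using False by simp
qed

section \<open>The space of square integrable functions\<close>

lemma L2I: "f \<in> borel_measurable circle \<Longrightarrow> integrable circle (\<lambda>\<xi>. (norm (f \<xi>))\<^sup>2) \<Longrightarrow> f \<in> L2"
  by (simp add: L2_def)

lemma L2_measurable: "f \<in> L2 \<Longrightarrow> f \<in> borel_measurable circle"
  by (simp add: L2_def)

lemma L2_integrable_norm: "f \<in> L2 \<Longrightarrow> integrable circle (\<lambda>\<xi>. (norm (f \<xi>))\<^sup>2)"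
  by (simp add: L2_def)

lemma Linf_measurable: "f \<in> Linf \<Longrightarrow> f \<in> borel_measurable circle"
  by (simp add: Linf_def)

lemma norm_add_square_le: "(norm (a + b))\<^sup>2 \<le> 2 * (norm a)\<^sup>2 + 2 * (norm b)\<^sup>2" for a b :: complex
proof -
  have "(norm (a + b))\<^sup>2 \<le> (norm a + norm b)\<^sup>2"
    by (simp add: norm_triangle_ineq power_mono)
  then show ?thesis
    using sum_squares_bound[of "norm a" "norm b"] by (simp add: power2_sum)
qed

lemma norm_mult_le_squares: "norm (a * b) \<le> (norm a)\<^sup>2 + (norm b)\<^sup>2" for a b :: complex
  using sum_squares_bound[of "norm a" "norm b"] mult_nonneg_nonneg[OF norm_ge_zero norm_ge_zero, of a b]
  unfolding norm_mult by linarith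

lemma L2_add:
  assumes "f \<in> L2" "g \<in> L2"
  shows "(\<lambda>\<xi>. f \<xi> + g \<xi>) \<in> L2"
proof (rule L2I)
  note [measurable] = assms[THEN L2_measurable]
  show "(\<lambda>\<xi>. f \<xi> + g \<xi>) \<in> borel_measurable circle" by measurable
  have "integrable circle (\<lambda>\<xi>. 2 * (norm (f \<xi>))\<^sup>2 + 2 * (norm (g \<xi>))\<^sup>2)"
    using assms[THEN L2_integrable_norm] by auto
  then show "integrable circle (\<lambda>\<xi>. (norm (f \<xi> + g \<xi>))\<^sup>2)"
    by (rule Bochner_Integration.integrable_bound) (auto intro!: AE_I2 norm_add_square_le order_trans[OF norm_add_square_le])
qed

lemma L2_mult_Linf:
  assumes "u \<in> Linf" "f \<in> L2"
  shows "(\<lambda>\<xi>. u \<xi> * f \<xi>) \<in> L2"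
proof (rule L2I)
  note [measurable] = assms(1)[THEN Linf_measurable] assms(2)[THEN L2_measurable]
  show "(\<lambda>\<xi>. u \<xi> * f \<xi>) \<in> borel_measurable circle" by measurable
  obtain C where C: "AE \<xi> in circle. norm (u \<xi>) \<le> C" using assms(1) by (auto simp: Linf_def)
  have "integrable circle (\<lambda>\<xi>. C\<^sup>2 * (norm (f \<xi>))\<^sup>2)"
    using assms(2)[THEN L2_integrable_norm] by auto
  then show "integrable circle (\<lambda>\<xi>. (norm (u \<xi> * f \<xi>))\<^sup>2)"
  proof (rule Bochner_Integration.integrable_bound)
    show "AE \<xi> in circle. norm ((norm (u \<xi> * f \<xi>))\<^sup>2) \<le> norm (C\<^sup>2 * (norm (f \<xi>))\<^sup>2)"
      using C by eventually_elim (auto simp: norm_mult power_mult_distrib intro!: mult_right_mono power_mono)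
  qed measurable
qed

lemma Linf_const [simp]: "(\<lambda>\<xi>. c) \<in> Linf"
  by (auto simp: Linf_def)

lemma Linf_add: "u \<in> Linf \<Longrightarrow> v \<in> Linf \<Longrightarrow> (\<lambda>\<xi>. u \<xi> + v \<xi>) \<in> Linf"
proof -
  assume a: "u \<in> Linf" "v \<in> Linf"
  note [measurable] = a[THEN Linf_measurable]
  obtain C D where "AE \<xi> in circle. norm (u \<xi>) \<le> C" "AE \<xi> in circle. norm (v \<xi>) \<le> D"
    using a by (auto simp: Linf_def)
  then have "AE \<xi> in circle. norm (u \<xi> + v \<xi>) \<le> C + D"
    by eventually_elim (rule norm_triangle_mono)
  then show ?thesis by (auto simp: Linf_def)
qed

lemma Linf_mult: "u \<in> Linf \<Longrightarrow> v \<in> Linf \<Longrightarrow> (\<lambda>\<xi>. u \<xi> * v \<xi>) \<in> Linf"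
proof -
  assume a: "u \<in> Linf" "v \<in> Linf"
  note [measurable] = a[THEN Linf_measurable]
  obtain C D where "AE \<xi> in circle. norm (u \<xi>) \<le> C" "AE \<xi> in circle. norm (v \<xi>) \<le> D"
    using a by (auto simp: Linf_def)
  then have "AE \<xi> in circle. norm (u \<xi> * v \<xi>) \<le> C * D"
    by eventually_elim (rule norm_mult_ineq[THEN order_trans], intro mult_mono, auto intro: order_trans[OF norm_ge_zero])
  then show ?thesis by (auto simp: Linf_def)
qed

lemma Linf_diff: "u \<in> Linf \<Longrightarrow> v \<in> Linf \<Longrightarrow> (\<lambda>\<xi>. u \<xi> - v \<xi>) \<in> Linf"
  using Linf_add[of u "\<lambda>\<xi>. (-1) * v \<xi>"] Linf_mult[of "\<lambda>\<xi>. -1" v] by simp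

lemma Linf_cnj: "u \<in> Linf \<Longrightarrow> (\<lambda>\<xi>. cnj (u \<xi>)) \<in> Linf"
  using measurable_compose[OF _ measurable_cnj, of u circle] by (auto simp: Linf_def)

lemma Linf_compose_cnj: "u \<in> Linf \<Longrightarrow> (\<lambda>\<xi>. u (cnj \<xi>)) \<in> Linf"
  using measurable_compose[OF measurable_cnj_circle, of u] by (auto simp: Linf_def dest: AE_circle_cnj)

lemma Linf_powi [simp]: "(\<lambda>\<xi>. \<xi> powi n) \<in> Linf"
  by (auto simp: Linf_def norm_power_int norm_eq_1_circle intro!: exI[of _ 1] AE_I2)

lemma Linf_L2: "u \<in> Linf \<Longrightarrow> u \<in> L2"
proof -
  have "(\<lambda>\<xi>. 1) \<in> L2" by (rule L2I) auto
  then show "u \<in> Linf \<Longrightarrow> u \<in> L2" using L2_mult_Linf[of u "\<lambda>\<xi>. 1"] by simp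
qed

lemma L2_cmult: "f \<in> L2 \<Longrightarrow> (\<lambda>\<xi>. c * f \<xi>) \<in> L2"
  by (rule L2_mult_Linf) simp_all

lemma L2_diff: "f \<in> L2 \<Longrightarrow> g \<in> L2 \<Longrightarrow> (\<lambda>\<xi>. f \<xi> - g \<xi>) \<in> L2"
  using L2_add[of f "\<lambda>\<xi>. (-1) * g \<xi>"] L2_cmult[of g "-1"] by simp

lemma L2_zero [simp]: "(\<lambda>\<xi>. 0) \<in> L2"
  by (rule Linf_L2) simp

lemma L2_sum: "(\<And>i. i \<in> I \<Longrightarrow> f i \<in> L2) \<Longrightarrow> (\<lambda>\<xi>. \<Sum>i\<in>I. f i \<xi>) \<in> L2"
  by (induction I rule: infinite_finite_induct) (auto intro: L2_add)

lemma L2_powi [simp]: "(\<lambda>\<xi>. \<xi> powi n) \<in> L2"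
  by (rule Linf_L2) simp

lemma L2_cnj: "f \<in> L2 \<Longrightarrow> (\<lambda>\<xi>. cnj (f \<xi>)) \<in> L2"
  using measurable_compose[OF _ measurable_cnj, of f circle] by (auto simp: L2_def)

lemma L2_compose_cnj: "f \<in> L2 \<Longrightarrow> (\<lambda>\<xi>. f (cnj \<xi>)) \<in> L2"
  using measurable_compose[OF measurable_cnj_circle, of f]
    integrable_circle_cnj[of "\<lambda>\<xi>. (norm (f \<xi>))\<^sup>2"] by (auto simp: L2_def)

lemma L2_cong_AE:
  assumes "f \<in> L2" "g \<in> borel_measurable circle" "AE \<xi> in circle. f \<xi> = g \<xi>"
  shows "g \<in> L2"
proof (rule L2I)
  note [measurable] = assms(2) L2_measurable[OF assms(1)]
  show "integrable circle (\<lambda>\<xi>. (norm (g \<xi>))\<^sup>2)"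
    by (rule integrable_cong_AE_imp[OF L2_integrable_norm[OF assms(1)]]) (use assms(3) in auto)
qed fact

lemma integrable_L2_mult_cnj:
  assumes "f \<in> L2" "g \<in> L2"
  shows "integrable circle (\<lambda>\<xi>. f \<xi> * cnj (g \<xi>))"
proof -
  note [measurable] = assms[THEN L2_measurable]
  have "integrable circle (\<lambda>\<xi>. (norm (f \<xi>))\<^sup>2 + (norm (g \<xi>))\<^sup>2)"
    using assms[THEN L2_integrable_norm] by auto
  then show ?thesis
  proof (rule Bochner_Integration.integrable_bound)
    show "AE \<xi> in circle. norm (f \<xi> * cnj (g \<xi>)) \<le> norm ((norm (f \<xi>))\<^sup>2 + (norm (g \<xi>))\<^sup>2)"
      using norm_mult_le_squares[of "f _" "cnj (g _)"] by (auto intro!: AE_I2)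
  qed measurable
qed

lemma integrable_L2: "f \<in> L2 \<Longrightarrow> integrable circle f"
  using integrable_L2_mult_cnj[of f "\<lambda>\<xi>. 1"] Linf_L2[OF Linf_const[of 1]] by simp

lemma l2_inner_add: "f \<in> L2 \<Longrightarrow> g \<in> L2 \<Longrightarrow> h \<in> L2 \<Longrightarrow>
    l2_inner (\<lambda>\<xi>. f \<xi> + g \<xi>) h = l2_inner f h + l2_inner g h"
  by (simp add: l2_inner_def distrib_right integrable_L2_mult_cnj)

lemma l2_inner_diff: "f \<in> L2 \<Longrightarrow> g \<in> L2 \<Longrightarrow> h \<in> L2 \<Longrightarrow>
    l2_inner (\<lambda>\<xi>. f \<xi> - g \<xi>) h = l2_inner f h - l2_inner g h"
  by (simp add: l2_inner_def left_diff_distrib integrable_L2_mult_cnj)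

lemma l2_inner_cmult: "l2_inner (\<lambda>\<xi>. c * f \<xi>) h = c * l2_inner f h"
  by (simp add: l2_inner_def mult.assoc)

lemma l2_inner_zero [simp]: "l2_inner (\<lambda>\<xi>. 0) h = 0"
  by (simp add: l2_inner_def)

lemma l2_inner_sum: "(\<And>i. i \<in> I \<Longrightarrow> f i \<in> L2) \<Longrightarrow> h \<in> L2 \<Longrightarrow>
    l2_inner (\<lambda>\<xi>. \<Sum>i\<in>I. f i \<xi>) h = (\<Sum>i\<in>I. l2_inner (f i) h)"
  by (induction I rule: infinite_finite_induct) (auto simp: l2_inner_add L2_sum)

lemma l2_inner_commute: "l2_inner f g = cnj (l2_inner g f)"
proof -
  have "l2_inner f g = (LINT \<xi>|circle. cnj (g \<xi> * cnj (f \<xi>)))"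
    by (simp add: l2_inner_def mult.commute)
  also have "\<dots> = cnj (LINT \<xi>|circle. g \<xi> * cnj (f \<xi>))" by (simp only: Bochner_Integration.integral_cnj)
  finally show ?thesis by (simp only: l2_inner_def)
qed

lemma l2_inner_eq_0_commute: "l2_inner f g = 0 \<longleftrightarrow> l2_inner g f = 0"
  by (subst l2_inner_commute) simp

lemma l2_inner_cong_AE:
  assumes "f \<in> borel_measurable circle" "f' \<in> borel_measurable circle" "h \<in> borel_measurable circle"
    "AE \<xi> in circle. f \<xi> = f' \<xi>"
  shows "l2_inner f h = l2_inner f' h"
proof -
  note [measurable] = assms(1-3)
  show ?thesis
    unfolding l2_inner_def by (rule integral_cong_AE) (use assms(4) in auto)
qed

lemma l2_inner_self: "l2_inner f f = of_real (LINT \<xi>|circle. (norm (f \<xi>))\<^sup>2)"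
  unfolding l2_inner_def complex_norm_square[symmetric] by (rule integral_complex_of_real)

lemma l2_inner_self_eq_0:
  assumes "f \<in> L2"
  shows "l2_inner f f = 0 \<longleftrightarrow> (AE \<xi> in circle. f \<xi> = 0)"
proof -
  have "l2_inner f f = 0 \<longleftrightarrow> (LINT \<xi>|circle. (norm (f \<xi>))\<^sup>2) = 0"
    by (simp add: l2_inner_self)
  also have "\<dots> \<longleftrightarrow> (AE \<xi> in circle. (norm (f \<xi>))\<^sup>2 = 0)"
    by (rule integral_nonneg_eq_0_iff_AE) (use assms in \<open>auto simp: L2_integrable_norm\<close>)
  finally show ?thesis by simp
qed

lemma l2_orth_L2: "f \<in> l2_orth S \<Longrightarrow> f \<in> L2"
  by (simp add: l2_orth_def)

lemma l2_orth_add: "S \<subseteq> L2 \<Longrightarrow> f \<in> l2_orth S \<Longrightarrow> g \<in> l2_orth S \<Longrightarrow> (\<lambda>\<xi>. f \<xi> + g \<xi>) \<in> l2_orth S"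
  by (auto simp: l2_orth_def L2_add l2_inner_add subset_iff)

lemma l2_orth_cmult: "f \<in> l2_orth S \<Longrightarrow> (\<lambda>\<xi>. c * f \<xi>) \<in> l2_orth S"
  by (auto simp: l2_orth_def L2_cmult l2_inner_cmult)

lemma l2_orth_diff: "S \<subseteq> L2 \<Longrightarrow> f \<in> l2_orth S \<Longrightarrow> g \<in> l2_orth S \<Longrightarrow> (\<lambda>\<xi>. f \<xi> - g \<xi>) \<in> l2_orth S"
  using l2_orth_add[of S f "\<lambda>\<xi>. (-1) * g \<xi>"] l2_orth_cmult[of g S "-1"] by simp

lemma l2_orth_zero [simp]: "(\<lambda>\<xi>. 0) \<in> l2_orth S"
  by (simp add: l2_orth_def)

lemma l2_orth_cong_AE:
  assumes "S \<subseteq> L2" "f \<in> l2_orth S" "g \<in> borel_measurable circle" "AE \<xi> in circle. f \<xi> = g \<xi>"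
  shows "g \<in> l2_orth S"
proof -
  have "g \<in> L2" using assms by (auto intro: L2_cong_AE l2_orth_L2)
  moreover have "l2_inner g h = l2_inner f h" if "h \<in> S" for h
    by (rule l2_inner_cong_AE[symmetric])
       (use assms that in \<open>auto intro: L2_measurable l2_orth_L2\<close>)
  ultimately show ?thesis using assms(2) by (auto simp: l2_orth_def)
qed

section \<open>Orthogonal projections\<close>

text \<open>The squared norm. No square roots are taken: Cauchy-Schwarz is replaced by inequalities
  with a free weight.\<close>

definition l2_sq :: "(complex \<Rightarrow> complex) \<Rightarrow> real" where
  "l2_sq f = (LINT \<xi>|circle. (norm (f \<xi>))\<^sup>2)"

lemma l2_sq_nonneg: "0 \<le> l2_sq f"
  by (simp add: l2_sq_def)

lemma nn_integral_l2_sq: "f \<in> L2 \<Longrightarrow> (\<integral>\<^sup>+\<xi>. ennreal ((norm (f \<xi>))\<^sup>2) \<partial>circle) = ennreal (l2_sq f)"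
  unfolding l2_sq_def by (rule nn_integral_eq_integral) (auto simp: L2_integrable_norm)

text \<open>Riesz-Fischer for sequences with a geometric rate: the increments are then summable in
  mean, so the sequence itself, not just a subsequence, converges a.e., and Fatou hands the rate on
  to the limit.\<close>

lemma L2_complete:
  fixes g :: "nat \<Rightarrow> complex \<Rightarrow> complex"
  assumes g: "\<And>n. g n \<in> L2"
    and cauchy: "\<And>m n. n \<le> m \<Longrightarrow> l2_sq (\<lambda>\<xi>. g m \<xi> - g n \<xi>) \<le> C * (1 / 4) ^ n"
  shows "\<exists>h\<in>L2. \<forall>n. l2_sq (\<lambda>\<xi>. h \<xi> - g n \<xi>) \<le> C * (1 / 4) ^ n"
proof -
  note [measurable] = g[THEN L2_measurable]
  have C: "0 \<le> C" using order_trans[OF l2_sq_nonneg cauchy[of 0 0]] by simp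
  define d where "d = (\<lambda>n \<xi>. g (Suc n) \<xi> - g n \<xi>)"
  have d: "d n \<in> L2" for n unfolding d_def by (intro L2_diff g)
  note [measurable] = d[THEN L2_measurable]
  have nd: "(\<integral>\<^sup>+\<xi>. ennreal (norm (d n \<xi>)) \<partial>circle) \<le> ennreal ((1 + C) * (1 / 2) ^ n)" for n
  proof -
    have "(\<integral>\<^sup>+\<xi>. ennreal (norm (d n \<xi>)) \<partial>circle)
        \<le> (\<integral>\<^sup>+\<xi>. (ennreal ((1 / 2) ^ n) + ennreal (2 ^ n) * ennreal ((norm (d n \<xi>))\<^sup>2)) \<partial>circle)"
    proof (rule nn_integral_mono)
      fix \<xi>
      \<comment> \<open>Arithmetic-geometric mean with weight \<open>2 ^ n\<close>: the squared norm
        of \<open>d n\<close> is of order \<open>(1 / 4) ^ n\<close>, so both terms of the bound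
        become of order \<open>(1 / 2) ^ n\<close>.\<close>
      have "0 \<le> (1 - 2 ^ n * norm (d n \<xi>))\<^sup>2" by simp
      then have "2 * (2 ^ n * norm (d n \<xi>)) \<le> 1 + (2 ^ n)\<^sup>2 * (norm (d n \<xi>))\<^sup>2"
        by (simp add: power2_eq_square algebra_simps)
      moreover have "0 \<le> 2 ^ n * norm (d n \<xi>)" by simp
      ultimately have "2 ^ n * norm (d n \<xi>) \<le> 1 + (2 ^ n)\<^sup>2 * (norm (d n \<xi>))\<^sup>2" by linarith
      then have "norm (d n \<xi>) \<le> (1 / 2) ^ n + 2 ^ n * (norm (d n \<xi>))\<^sup>2"
        by (simp add: field_simps power2_eq_square)
      then show "ennreal (norm (d n \<xi>)) \<le> ennreal ((1 / 2) ^ n) + ennreal (2 ^ n) * ennreal ((norm (d n \<xi>))\<^sup>2)"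
        by (simp add: ennreal_mult[symmetric] ennreal_plus[symmetric] ennreal_leI del: ennreal_plus)
    qed
    also have "\<dots> = ennreal ((1 / 2) ^ n) + ennreal (2 ^ n) * ennreal (l2_sq (d n))"
      by (simp add: nn_integral_add nn_integral_cmult nn_integral_l2_sq[OF d] prob_space_circle)
    also have "\<dots> \<le> ennreal ((1 / 2) ^ n) + ennreal (2 ^ n) * ennreal (C * (1 / 4) ^ n)"
      using cauchy[of n "Suc n"] by (intro add_left_mono mult_left_mono ennreal_leI) (auto simp: d_def)
    also have "\<dots> = ennreal ((1 / 2) ^ n + 2 ^ n * (C * (1 / 4) ^ n))"
      using C by (simp add: ennreal_mult[symmetric] ennreal_plus[symmetric] del: ennreal_plus)
    also have "(1 / 2) ^ n + 2 ^ n * (C * (1 / 4) ^ n) = (1 + C) * (1 / 2 :: real) ^ n"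
    proof -
      have "(4 :: real) ^ n = 2 ^ n * 2 ^ n" by (simp flip: power_mult_distrib)
      then show ?thesis by (simp add: field_simps)
    qed
    finally show ?thesis .
  qed
  have "(\<integral>\<^sup>+\<xi>. (\<Sum>n. ennreal (norm (d n \<xi>))) \<partial>circle) = (\<Sum>n. \<integral>\<^sup>+\<xi>. ennreal (norm (d n \<xi>)) \<partial>circle)"
    by (rule nn_integral_suminf) simp
  also have "\<dots> \<le> (\<Sum>n. ennreal ((1 + C) * (1 / 2) ^ n))"
    by (intro suminf_le nd) auto
  also have "\<dots> < \<infinity>"
  proof -
    have "(\<Sum>n. ennreal ((1 + C) * (1 / 2) ^ n)) \<noteq> top"
      using C by (intro ennreal_suminf_neq_top summable_mult summable_geometric) auto
    then show ?thesis by (simp add: top.not_eq_extremum)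
  qed
  finally have "AE \<xi> in circle. (\<Sum>n. ennreal (norm (d n \<xi>))) \<noteq> \<infinity>"
    by (intro nn_integral_PInf_AE) auto
  then have conv: "AE \<xi> in circle. (\<lambda>n. g n \<xi>) \<longlonglongrightarrow> lim (\<lambda>n. g n \<xi>)"
  proof eventually_elim
    case (elim \<xi>)
    then have "summable (\<lambda>n. norm (d n \<xi>))"
      unfolding infinity_ennreal_def by (rule summable_suminf_not_top[OF norm_ge_zero])
    then have "summable (\<lambda>n. d n \<xi>)" by (rule summable_norm_cancel)
    then have "convergent (\<lambda>n. \<Sum>i<n. d i \<xi>)" by (simp add: summable_iff_convergent)
    then have "convergent (\<lambda>n. g 0 \<xi> + (\<Sum>i<n. d i \<xi>))"
      by (simp add: convergent_add_const_iff)
    moreover have "g 0 \<xi> + (\<Sum>i<n. d i \<xi>) = g n \<xi>" for n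
      using sum_lessThan_telescope[of "\<lambda>n. g n \<xi>" n] by (simp add: d_def)
    ultimately show ?case by (simp add: convergent_LIMSEQ_iff)
  qed
  \<comment> \<open>\<open>lim\<close> has a value even where the sequence diverges, which happens
    on a null set only; so \<open>h\<close> is total and still measurable.\<close>
  define h where "h = (\<lambda>\<xi>. lim (\<lambda>n. g n \<xi>))"
  have [measurable]: "h \<in> borel_measurable circle"
    unfolding h_def by (rule borel_measurable_lim_metric) simp
  \<comment> \<open>Fatou's lemma as m tends to infinity, with n fixed.\<close>
  have hn: "(\<integral>\<^sup>+\<xi>. ennreal ((norm (h \<xi> - g n \<xi>))\<^sup>2) \<partial>circle) \<le> ennreal (C * (1 / 4) ^ n)" for n
  proof -
    have "(\<integral>\<^sup>+\<xi>. ennreal ((norm (h \<xi> - g n \<xi>))\<^sup>2) \<partial>circle) =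
        (\<integral>\<^sup>+\<xi>. liminf (\<lambda>m. ennreal ((norm (g m \<xi> - g n \<xi>))\<^sup>2)) \<partial>circle)"
    proof (rule nn_integral_cong_AE)
      show "AE \<xi> in circle. ennreal ((norm (h \<xi> - g n \<xi>))\<^sup>2) = liminf (\<lambda>m. ennreal ((norm (g m \<xi> - g n \<xi>))\<^sup>2))"
        using conv
      proof eventually_elim
        case (elim \<xi>)
        then have "(\<lambda>m. ennreal ((norm (g m \<xi> - g n \<xi>))\<^sup>2)) \<longlonglongrightarrow> ennreal ((norm (h \<xi> - g n \<xi>))\<^sup>2)"
          unfolding h_def by (intro tendsto_intros)
        then show ?case by (intro lim_imp_Liminf[symmetric]) auto
      qed
    qed
    also have "\<dots> \<le> liminf (\<lambda>m. \<integral>\<^sup>+\<xi>. ennreal ((norm (g m \<xi> - g n \<xi>))\<^sup>2) \<partial>circle)"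
      by (rule nn_integral_liminf) simp
    also have "\<dots> \<le> liminf (\<lambda>m. ennreal (C * (1 / 4) ^ n))"
    proof (rule Liminf_mono)
      show "\<forall>\<^sub>F m in sequentially. (\<integral>\<^sup>+\<xi>. ennreal ((norm (g m \<xi> - g n \<xi>))\<^sup>2) \<partial>circle) \<le> ennreal (C * (1 / 4) ^ n)"
        using eventually_ge_at_top[of n]
        by eventually_elim (simp add: nn_integral_l2_sq[OF L2_diff[OF g g]] cauchy ennreal_leI)
    qed
    also have "\<dots> = ennreal (C * (1 / 4) ^ n)" by (simp add: Liminf_const)
    finally show ?thesis .
  qed
  have dL2: "(\<lambda>\<xi>. h \<xi> - g n \<xi>) \<in> L2" for n
  proof (rule L2I)
    show "integrable circle (\<lambda>\<xi>. (norm (h \<xi> - g n \<xi>))\<^sup>2)"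
      by (rule integrableI_bounded) (use hn[of n] in \<open>auto simp: le_less_trans\<close>)
  qed measurable
  have "h \<in> L2" using L2_add[OF dL2[of 0] g[of 0]] by simp
  moreover have "l2_sq (\<lambda>\<xi>. h \<xi> - g n \<xi>) \<le> C * (1 / 4) ^ n" for n
    using hn[of n] C by (simp add: nn_integral_l2_sq[OF dL2] ennreal_le_iff)
  ultimately show ?thesis by blast
qed

lemma l2_sq_add: "f \<in> L2 \<Longrightarrow> g \<in> L2 \<Longrightarrow>
    l2_sq (\<lambda>\<xi>. f \<xi> + c * g \<xi>) = l2_sq f + 2 * Re (cnj c * l2_inner f g) + (norm c)\<^sup>2 * l2_sq g"
proof -
  assume a: "f \<in> L2" "g \<in> L2"
  have i: "integrable circle (\<lambda>\<xi>. Re (cnj c * (f \<xi> * cnj (g \<xi>))))"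
    using integrable_L2_mult_cnj[OF a] by (intro integrable_Re integrable_mult_right)
  have "(norm (x + c * y))\<^sup>2 = (norm x)\<^sup>2 + 2 * Re (cnj c * (x * cnj y)) + (norm c)\<^sup>2 * (norm y)\<^sup>2" for x y
    unfolding cmod_power2 by (simp add: power2_eq_square algebra_simps)
  then have "l2_sq (\<lambda>\<xi>. f \<xi> + c * g \<xi>) =
      (LINT \<xi>|circle. (norm (f \<xi>))\<^sup>2 + 2 * Re (cnj c * (f \<xi> * cnj (g \<xi>))) + (norm c)\<^sup>2 * (norm (g \<xi>))\<^sup>2)"
    by (simp add: l2_sq_def)
  also have "\<dots> = l2_sq f + 2 * (LINT \<xi>|circle. Re (cnj c * (f \<xi> * cnj (g \<xi>)))) + (norm c)\<^sup>2 * l2_sq g"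
    using a[THEN L2_integrable_norm] i by (simp add: l2_sq_def del: times_complex.sel)
  also have "(LINT \<xi>|circle. Re (cnj c * (f \<xi> * cnj (g \<xi>)))) = Re (cnj c * l2_inner f g)"
  proof -
    have "(LINT \<xi>|circle. Re (cnj c * (f \<xi> * cnj (g \<xi>)))) = Re (LINT \<xi>|circle. cnj c * (f \<xi> * cnj (g \<xi>)))"
      by (rule integral_Re) (intro integrable_mult_right integrable_L2_mult_cnj a)
    then show ?thesis by (simp only: l2_inner_def integral_mult_right_zero)
  qed
  finally show ?thesis .
qed

text \<open>A substitute for Cauchy-Schwarz that is linear in the squared norms; the weight
  \<open>t\<close> will be a power of 2 or of 1/2 that balances the two terms.\<close>

lemma l2_inner_bound:
  assumes "f \<in> L2" "g \<in> L2" "t > 0"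
  shows "norm (l2_inner f g) \<le> t * l2_sq f + l2_sq g / t"
proof -
  note [measurable] = assms(1,2)[THEN L2_measurable]
  have i: "integrable circle (\<lambda>\<xi>. t * (norm (f \<xi>))\<^sup>2 + (norm (g \<xi>))\<^sup>2 / t)"
    using assms(1,2)[THEN L2_integrable_norm] by auto
  have "norm (l2_inner f g) \<le> (LINT \<xi>|circle. t * (norm (f \<xi>))\<^sup>2 + (norm (g \<xi>))\<^sup>2 / t)"
    unfolding l2_inner_def
  proof (rule Bochner_Integration.integral_norm_bound_integral[OF integrable_L2_mult_cnj[OF assms(1,2)] i])
    fix \<xi>
    have "0 \<le> (t * norm (f \<xi>) - norm (g \<xi>))\<^sup>2" by simp
    then have "2 * (t * norm (f \<xi>) * norm (g \<xi>)) \<le> t\<^sup>2 * (norm (f \<xi>))\<^sup>2 + (norm (g \<xi>))\<^sup>2"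
      by (simp add: power2_eq_square algebra_simps)
    moreover have "0 \<le> t * norm (f \<xi>) * norm (g \<xi>)" using assms(3) by simp
    ultimately have "t * (norm (f \<xi>) * norm (g \<xi>)) \<le> t\<^sup>2 * (norm (f \<xi>))\<^sup>2 + (norm (g \<xi>))\<^sup>2"
      by (simp add: mult.assoc)
    also have "\<dots> = t * (t * (norm (f \<xi>))\<^sup>2 + (norm (g \<xi>))\<^sup>2 / t)"
      using assms(3) by (simp add: field_simps power2_eq_square)
    finally have "t * (norm (f \<xi>) * norm (g \<xi>)) \<le> t * (t * (norm (f \<xi>))\<^sup>2 + (norm (g \<xi>))\<^sup>2 / t)" .
    then show "norm (f \<xi> * cnj (g \<xi>)) \<le> t * (norm (f \<xi>))\<^sup>2 + (norm (g \<xi>))\<^sup>2 / t"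
      using assms(3) by (simp only: norm_mult complex_mod_cnj mult_le_cancel_left_pos)
  qed
  also have "\<dots> = t * l2_sq f + l2_sq g / t"
    using assms(1,2)[THEN L2_integrable_norm] by (simp add: l2_sq_def)
  finally show ?thesis .
qed

text \<open>Continuity of the inner product, made quantitative: with weight \<open>2 ^ n\<close> the
  inner product of h - g n with s is of order \<open>(1 / 2) ^ n\<close>.\<close>

lemma l2_orth_closed:
  assumes "S \<subseteq> L2" "\<And>n. g n \<in> l2_orth S" "h \<in> L2"
    and lim: "\<And>n. l2_sq (\<lambda>\<xi>. h \<xi> - g n \<xi>) \<le> C * (1 / 4) ^ n"
  shows "h \<in> l2_orth S"
proof -
  have "l2_inner h s = 0" if s: "s \<in> S" for s
  proof -
    have sL: "s \<in> L2" using s assms(1) by auto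
    have "norm (l2_inner h s) \<le> (C + l2_sq s) * (1 / 2) ^ n" for n
    proof -
      have "l2_inner h s = l2_inner (\<lambda>\<xi>. h \<xi> - g n \<xi>) s"
        using assms(2)[of n] s sL by (subst l2_inner_diff) (auto simp: l2_orth_def assms(3))
      then have "norm (l2_inner h s) \<le> 2 ^ n * l2_sq (\<lambda>\<xi>. h \<xi> - g n \<xi>) + l2_sq s / 2 ^ n"
        using l2_inner_bound[OF L2_diff[OF assms(3) l2_orth_L2[OF assms(2)]] sL, of "2 ^ n"]
        by simp
      also have "\<dots> \<le> 2 ^ n * (C * (1 / 4) ^ n) + l2_sq s / 2 ^ n"
        by (intro add_right_mono mult_left_mono lim) auto
      also have "\<dots> = (C + l2_sq s) * (1 / 2) ^ n"
      proof -
        have "(4 :: real) ^ n = 2 ^ n * 2 ^ n" by (simp flip: power_mult_distrib)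
        then show ?thesis by (simp add: field_simps)
      qed
      finally show ?thesis .
    qed
    moreover have "(\<lambda>n. (C + l2_sq s) * (1 / 2) ^ n) \<longlonglongrightarrow> 0"
      by (intro tendsto_mult_right_zero LIMSEQ_realpow_zero) auto
    ultimately have "norm (l2_inner h s) \<le> 0"
      by (intro LIMSEQ_le_const) auto
    then show ?thesis by simp
  qed
  then show ?thesis using assms(3) by (auto simp: l2_orth_def)
qed


text \<open>Variational argument: if f - g had inner product a with some h of the subspace, moving g
  slightly in the direction of a * h would decrease the distance.\<close>

lemma l2_orth_minimizer_orth:
  assumes "S \<subseteq> L2" "f \<in> L2" "g \<in> l2_orth S"
    and min: "\<And>h. h \<in> l2_orth S \<Longrightarrow> l2_sq (\<lambda>\<xi>. f \<xi> - g \<xi>) \<le> l2_sq (\<lambda>\<xi>. f \<xi> - h \<xi>)"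
  shows "(\<lambda>\<xi>. f \<xi> - g \<xi>) \<in> l2_orth (l2_orth S)"
proof -
  have gL: "g \<in> L2" using assms(3) by (rule l2_orth_L2)
  have "l2_inner (\<lambda>\<xi>. f \<xi> - g \<xi>) h = 0" if h: "h \<in> l2_orth S" for h
  proof (rule ccontr)
    define a where "a = l2_inner (\<lambda>\<xi>. f \<xi> - g \<xi>) h"
    assume "l2_inner (\<lambda>\<xi>. f \<xi> - g \<xi>) h \<noteq> 0"
    then have a: "(norm a)\<^sup>2 > 0" by (simp add: a_def)
    \<comment> \<open>With this e the quadratic term, e |a|^2 times \<open>e * l2_sq h\<close>,
      stays below the linear gain 2 e |a|^2; the summand 1 avoids division by zero.\<close>
    define e where "e = 1 / (1 + l2_sq h)"
    have e: "0 < e" "e * l2_sq h < 1" using l2_sq_nonneg[of h] by (auto simp: e_def)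
    define c where "c = - of_real e * a"
    have "l2_sq (\<lambda>\<xi>. f \<xi> - g \<xi>) \<le> l2_sq (\<lambda>\<xi>. f \<xi> - (g \<xi> + (- c) * h \<xi>))"
      using h assms(1,3) by (intro min l2_orth_add l2_orth_cmult)
    also have "\<dots> = l2_sq (\<lambda>\<xi>. (f \<xi> - g \<xi>) + c * h \<xi>)" by (simp add: algebra_simps)
    also have "\<dots> = l2_sq (\<lambda>\<xi>. f \<xi> - g \<xi>) + 2 * Re (cnj c * a) + (norm c)\<^sup>2 * l2_sq h"
      unfolding a_def by (rule l2_sq_add) (use h assms gL in \<open>auto intro: L2_diff l2_orth_L2\<close>)
    also have "Re (cnj c * a) = - e * (norm a)\<^sup>2"
      unfolding c_def cmod_power2 by (simp add: power2_eq_square algebra_simps)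
    also have "(norm c)\<^sup>2 = e\<^sup>2 * (norm a)\<^sup>2"
      using e by (simp add: c_def norm_mult power_mult_distrib)
    finally have "2 * (e * (norm a)\<^sup>2) \<le> (e * (norm a)\<^sup>2) * (e * l2_sq h)"
      by (simp add: power2_eq_square algebra_simps)
    moreover have "(e * (norm a)\<^sup>2) * (e * l2_sq h) \<le> (e * (norm a)\<^sup>2) * 1"
      using e a by (intro mult_left_mono) auto
    moreover have "e * (norm a)\<^sup>2 > 0" using e a by simp
    ultimately show False by linarith
  qed
  then show ?thesis using assms gL by (auto simp: l2_orth_def[of "l2_orth S"] L2_diff)
qed

text \<open>The parallelogram law for f - u and f - v. If both distances are close to the infimum,
  then u and v are close to each other, because their midpoint is a competitor.\<close>

lemma l2_sq_parallelogram:
  assumes "f \<in> L2" "u \<in> L2" "v \<in> L2"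
  shows "l2_sq (\<lambda>\<xi>. u \<xi> - v \<xi>) = 2 * l2_sq (\<lambda>\<xi>. f \<xi> - u \<xi>) + 2 * l2_sq (\<lambda>\<xi>. f \<xi> - v \<xi>)
    - 4 * l2_sq (\<lambda>\<xi>. f \<xi> - (1 / 2) * (u \<xi> + v \<xi>))"
proof -
  have p: "(norm (y - z))\<^sup>2 = 2 * (norm (x - y))\<^sup>2 + 2 * (norm (x - z))\<^sup>2 - 4 * (norm (x - (1 / 2) * (y + z)))\<^sup>2"
    for x y z :: complex
    unfolding cmod_power2 by (simp add: power2_eq_square field_simps)
  have i: "(\<lambda>\<xi>. f \<xi> - u \<xi>) \<in> L2" "(\<lambda>\<xi>. f \<xi> - v \<xi>) \<in> L2" "(\<lambda>\<xi>. f \<xi> - (1 / 2) * (u \<xi> + v \<xi>)) \<in> L2"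
    using assms by (auto intro!: L2_diff L2_add L2_cmult simp del: times_divide_eq_left)
  have "l2_sq (\<lambda>\<xi>. u \<xi> - v \<xi>) = (LINT \<xi>|circle. 2 * (norm (f \<xi> - u \<xi>))\<^sup>2 + 2 * (norm (f \<xi> - v \<xi>))\<^sup>2
      - 4 * (norm (f \<xi> - (1 / 2) * (u \<xi> + v \<xi>)))\<^sup>2)"
    unfolding l2_sq_def by (rule Bochner_Integration.integral_cong[OF refl p])
  then show ?thesis
    using i[THEN L2_integrable_norm] by (simp add: l2_sq_def)
qed

text \<open>The subspace has the form \<open>l2_orth S\<close> because such a space is always
  closed; \<open>H2\<close> is of this form, with S the negative powers.\<close>

lemma l2_projection_exists:
  assumes S: "S \<subseteq> L2" and f: "f \<in> L2"
  shows "\<exists>g\<in>l2_orth S. (\<lambda>\<xi>. f \<xi> - g \<xi>) \<in> l2_orth (l2_orth S)"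
proof -
  define \<delta> where "\<delta> = (INF h\<in>l2_orth S. l2_sq (\<lambda>\<xi>. f \<xi> - h \<xi>))"
  have ne: "l2_orth S \<noteq> {}" using l2_orth_zero by blast
  have bdd: "bdd_below ((\<lambda>h. l2_sq (\<lambda>\<xi>. f \<xi> - h \<xi>)) ` l2_orth S)"
    by (rule bdd_belowI2[of _ 0]) (rule l2_sq_nonneg)
  have low: "\<delta> \<le> l2_sq (\<lambda>\<xi>. f \<xi> - h \<xi>)" if "h \<in> l2_orth S" for h
    unfolding \<delta>_def by (rule cINF_lower[OF bdd that])
  have "\<exists>h\<in>l2_orth S. l2_sq (\<lambda>\<xi>. f \<xi> - h \<xi>) < \<delta> + (1 / 4) ^ n" for n
    using cINF_less_iff[OF ne bdd, of "\<delta> + (1 / 4) ^ n"] by (simp add: \<delta>_def)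
  then obtain g where g: "\<And>n. g n \<in> l2_orth S" "\<And>n. l2_sq (\<lambda>\<xi>. f \<xi> - g n \<xi>) < \<delta> + (1 / 4) ^ n"
    by metis
  have gL: "g n \<in> L2" for n using g(1) by (rule l2_orth_L2)
  \<comment> \<open>The parallelogram law gives the bound
    \<open>2 * (1 / 4) ^ m + 2 * (1 / 4) ^ n\<close>, as the terms with \<delta> cancel.\<close>
  have cauchy: "l2_sq (\<lambda>\<xi>. g m \<xi> - g n \<xi>) \<le> 4 * (1 / 4) ^ n" if "n \<le> m" for m n
  proof -
    have "\<delta> \<le> l2_sq (\<lambda>\<xi>. f \<xi> - (1 / 2) * (g m \<xi> + g n \<xi>))"
      by (intro low l2_orth_cmult l2_orth_add S g)
    moreover have "(1 / 4 :: real) ^ m \<le> (1 / 4) ^ n" using that by (intro power_decreasing) auto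
    ultimately show ?thesis
      using l2_sq_parallelogram[OF f gL gL, of m n] g(2)[of m] g(2)[of n] by linarith
  qed
  obtain h where h: "h \<in> L2" "\<And>n. l2_sq (\<lambda>\<xi>. h \<xi> - g n \<xi>) \<le> 4 * (1 / 4) ^ n"
    using L2_complete[OF gL cauchy] by blast
  have hM: "h \<in> l2_orth S" using S g(1) h by (rule l2_orth_closed)
  have "l2_sq (\<lambda>\<xi>. f \<xi> - h \<xi>) \<le> \<delta>"
  proof (rule LIMSEQ_le_const)
    \<comment> \<open>Any constant from \<open>15 + 2 * \<bar>\<delta>\<bar>\<close> on bounds the
      factor \<open>e + 2 * \<delta> + 2 * (e * e) + 8 + 4 * e\<close> that arises below with e
      between 0 and 1.\<close>
    define D where "D = 2 * \<bar>\<delta>\<bar> + 100"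
    have "l2_sq (\<lambda>\<xi>. f \<xi> - h \<xi>) \<le> \<delta> + D * (1 / 2) ^ n" for n
    proof -
      define e :: real where "e = (1 / 2) ^ n"
      have e: "0 < e" "e \<le> 1" "(1 / 4) ^ n = e * e"
        by (auto simp: e_def power_le_one simp flip: power_mult_distrib)
      define u v where "u = (\<lambda>\<xi>. f \<xi> - g n \<xi>)" and "v = (\<lambda>\<xi>. h \<xi> - g n \<xi>)"
      have L: "u \<in> L2" "v \<in> L2" unfolding u_def v_def using f h(1) gL by (auto intro: L2_diff)
      have "l2_sq (\<lambda>\<xi>. f \<xi> - h \<xi>) = l2_sq (\<lambda>\<xi>. u \<xi> + (-1) * v \<xi>)"
        by (simp add: u_def v_def)
      also have "\<dots> = l2_sq u - 2 * Re (l2_inner u v) + l2_sq v"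
        by (subst l2_sq_add[OF L]) simp
      also have "\<dots> \<le> l2_sq u + 2 * (e * l2_sq u + l2_sq v / e) + l2_sq v"
        using l2_inner_bound[OF L e(1)] abs_le_D2[OF abs_Re_le_cmod[of "l2_inner u v"]] by argo
      also have "\<dots> \<le> (\<delta> + e * e) + 2 * (e * (\<delta> + e * e) + (4 * (e * e)) / e) + 4 * (e * e)"
        using g(2)[of n] h(2)[of n] e unfolding u_def[symmetric] v_def[symmetric]
        by (intro add_mono mult_left_mono divide_right_mono) auto
      also have "\<dots> = \<delta> + e * (e + 2 * \<delta> + 2 * (e * e) + 8 + 4 * e)"
        using e by (simp add: field_simps)
      also have "\<dots> \<le> \<delta> + e * D"
        using e mult_le_one[of e e] by (intro add_left_mono mult_left_mono) (auto simp: D_def abs_if)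
      finally show ?thesis by (simp add: e_def mult.commute)
    qed
    then show "\<exists>N. \<forall>n\<ge>N. l2_sq (\<lambda>\<xi>. f \<xi> - h \<xi>) \<le> \<delta> + D * (1 / 2) ^ n" by blast
    have "(\<lambda>n. \<delta> + D * (1 / 2) ^ n) \<longlonglongrightarrow> \<delta> + D * 0"
      by (intro tendsto_intros LIMSEQ_realpow_zero) auto
    then show "(\<lambda>n. \<delta> + D * (1 / 2) ^ n) \<longlonglongrightarrow> \<delta>" by simp
  qed
  then have "(\<lambda>\<xi>. f \<xi> - h \<xi>) \<in> l2_orth (l2_orth S)"
    using low by (intro l2_orth_minimizer_orth[OF S f hM]) (meson order_trans)
  with hM show ?thesis by blast
qed

section \<open>Fourier coefficients\<close>

definition fc :: "(complex \<Rightarrow> complex) \<Rightarrow> int \<Rightarrow> complex" where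
  "fc f n = l2_inner f (\<lambda>\<xi>. \<xi> powi n)"

lemma cnj_powi: "norm \<xi> = 1 \<Longrightarrow> cnj (\<xi> powi n) = \<xi> powi (- n)" for \<xi> :: complex
  by (simp add: complex_cnj_power_int cnj_eq_inverse power_int_minus power_int_inverse)

lemma l2_inner_cong:
  "(\<And>\<xi>. norm \<xi> = 1 \<Longrightarrow> f \<xi> * cnj (g \<xi>) = f' \<xi> * cnj (g' \<xi>)) \<Longrightarrow> l2_inner f g = l2_inner f' g'"
  unfolding l2_inner_def by (rule Bochner_Integration.integral_cong) (auto simp: norm_eq_1_circle)

lemma l2_inner_mult_left: "l2_inner (\<lambda>\<xi>. u \<xi> * f \<xi>) g = l2_inner f (\<lambda>\<xi>. cnj (u \<xi>) * g \<xi>)"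
  by (simp add: l2_inner_def mult_ac)

lemma fc_add: "f \<in> L2 \<Longrightarrow> g \<in> L2 \<Longrightarrow> fc (\<lambda>\<xi>. f \<xi> + g \<xi>) n = fc f n + fc g n"
  by (simp add: fc_def l2_inner_add)

lemma fc_diff: "f \<in> L2 \<Longrightarrow> g \<in> L2 \<Longrightarrow> fc (\<lambda>\<xi>. f \<xi> - g \<xi>) n = fc f n - fc g n"
  by (simp add: fc_def l2_inner_diff)

lemma fc_cmult: "fc (\<lambda>\<xi>. c * f \<xi>) n = c * fc f n"
  by (simp add: fc_def l2_inner_cmult)

lemma fc_sum: "(\<And>i. i \<in> I \<Longrightarrow> f i \<in> L2) \<Longrightarrow> fc (\<lambda>\<xi>. \<Sum>i\<in>I. f i \<xi>) n = (\<Sum>i\<in>I. fc (f i) n)"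
  by (simp add: fc_def l2_inner_sum)

lemma fc_cong_AE:
  "f \<in> borel_measurable circle \<Longrightarrow> g \<in> borel_measurable circle \<Longrightarrow> AE \<xi> in circle. f \<xi> = g \<xi> \<Longrightarrow> fc f n = fc g n"
  unfolding fc_def by (rule l2_inner_cong_AE) auto

lemma fc_powi_mult: "fc (\<lambda>\<xi>. \<xi> powi k * f \<xi>) n = fc f (n - k)"
  unfolding fc_def
proof (rule l2_inner_cong)
  fix \<xi> :: complex assume "norm \<xi> = 1"
  moreover from this have "\<xi> \<noteq> 0" by auto
  ultimately show "\<xi> powi k * f \<xi> * cnj (\<xi> powi n) = f \<xi> * cnj (\<xi> powi (n - k))"
    by (simp add: cnj_powi power_int_diff power_int_minus field_simps del: complex_cnj_power_int)
qed

lemma fc_cnj_mult: "fc (\<lambda>\<xi>. cnj \<xi> * f \<xi>) n = fc f (n + 1)"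
proof -
  have "fc (\<lambda>\<xi>. cnj \<xi> * f \<xi>) n = fc (\<lambda>\<xi>. \<xi> powi (-1) * f \<xi>) n"
    unfolding fc_def by (rule l2_inner_cong) (simp add: cnj_eq_inverse power_int_minus)
  then show ?thesis using fc_powi_mult[of "-1" f n] by simp
qed

lemma fc_id_mult: "fc (\<lambda>\<xi>. \<xi> * f \<xi>) n = fc f (n - 1)"
  using fc_powi_mult[of 1 f n] by simp

lemma fc_power_mult: "fc (\<lambda>\<xi>. \<xi> ^ k * f \<xi>) n = fc f (n - int k)"
  using fc_powi_mult[of "int k" f n] by simp

lemma fc_cnj: "fc (\<lambda>\<xi>. cnj (f \<xi>)) n = cnj (fc f (- n))"
proof -
  have "fc (\<lambda>\<xi>. cnj (f \<xi>)) n = cnj (l2_inner (\<lambda>\<xi>. \<xi> powi n) (\<lambda>\<xi>. cnj (f \<xi>)))"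
    unfolding fc_def by (rule l2_inner_commute)
  also have "l2_inner (\<lambda>\<xi>. \<xi> powi n) (\<lambda>\<xi>. cnj (f \<xi>)) = fc f (- n)"
    unfolding fc_def by (rule l2_inner_cong) (simp add: cnj_powi del: complex_cnj_power_int)
  finally show ?thesis .
qed

lemma fc_compose_cnj:
  assumes "f \<in> L2"
  shows "fc (\<lambda>\<xi>. f (cnj \<xi>)) n = fc f (- n)"
proof -
  have [measurable]: "f \<in> borel_measurable circle" using assms by (rule L2_measurable)
  have "fc f (- n) = (LINT \<xi>|circle. f \<xi> * cnj (\<xi> powi (- n)))" by (simp only: fc_def l2_inner_def)
  also have "\<dots> = (LINT \<xi>|circle. f (cnj \<xi>) * cnj (cnj \<xi> powi (- n)))"
    by (rule integral_circle_cnj[symmetric]) measurable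
  also have "\<dots> = fc (\<lambda>\<xi>. f (cnj \<xi>)) n"
    unfolding fc_def l2_inner_def
    by (rule Bochner_Integration.integral_cong)
       (auto dest: norm_eq_1_circle simp: cnj_powi complex_cnj_power_int[symmetric] simp del: complex_cnj_power_int)
  finally show ?thesis by simp
qed

lemma fc_powi: "fc (\<lambda>\<xi>. \<xi> powi k) n = (if n = k then 1 else 0)"
proof -
  have "fc (\<lambda>\<xi>. \<xi> powi k) n = fc (\<lambda>\<xi>. \<xi> powi k * 1) n" by simp
  also have "\<dots> = fc (\<lambda>\<xi>. 1) (n - k)" by (rule fc_powi_mult)
  also have "\<dots> = (LINT \<xi>|circle. \<xi> powi (k - n))"
    unfolding fc_def l2_inner_def
    by (rule Bochner_Integration.integral_cong) (auto dest!: norm_eq_1_circle simp: cnj_powi simp del: complex_cnj_power_int)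
  finally show ?thesis by (simp add: integral_powi_circle)
qed

lemma fc_power: "fc (\<lambda>\<xi>. \<xi> ^ k) n = (if n = int k then 1 else 0)"
  using fc_powi[of "int k" n] by simp

lemma fc_const: "fc (\<lambda>\<xi>. c) n = (if n = 0 then c else 0)"
  using fc_cmult[of c "\<lambda>\<xi>. 1" n] fc_power[of 0 n] by simp

text \<open>A real-linear functional is a combination of \<xi> and its conjugate, and multiplication
  by these only shifts coefficients. Products work because f is arbitrary in the induction: the
  hypothesis for p is applied to q * f.\<close>

lemma fc_zero_real_polynomial:
  assumes "real_polynomial_function p" "f \<in> L2" "\<And>n. fc f n = 0"
  shows "(\<lambda>\<xi>. of_real (p \<xi>) * f \<xi>) \<in> L2 \<and> (\<forall>n. fc (\<lambda>\<xi>. of_real (p \<xi>) * f \<xi>) n = 0)"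
  using assms
proof (induction p arbitrary: f)
  case (linear p)
  interpret bounded_linear p by fact
  define \<alpha> \<beta> where "\<alpha> = p 1" and "\<beta> = p \<i>"
  \<comment> \<open>Chosen so that \<open>p \<xi>\<close> is twice the real part of
    \<open>a * \<xi>\<close>.\<close>
  define a where "a = Complex (\<alpha> / 2) (- \<beta> / 2)"
  have "p \<xi> = Re \<xi> * \<alpha> + Im \<xi> * \<beta>" for \<xi>
  proof -
    have "\<xi> = Re \<xi> *\<^sub>R 1 + Im \<xi> *\<^sub>R \<i>" by (simp add: complex_eq_iff)
    then have "p \<xi> = p (Re \<xi> *\<^sub>R 1 + Im \<xi> *\<^sub>R \<i>)" by (rule arg_cong)
    then show ?thesis by (simp only: add scaleR real_scaleR_def \<alpha>_def \<beta>_def)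
  qed
  then have p: "of_real (p \<xi>) = a * \<xi> + cnj a * cnj \<xi>" for \<xi>
    by (simp add: a_def complex_eq_iff algebra_simps)
  have "(\<lambda>\<xi>. \<xi> powi 1) \<in> Linf" by (rule Linf_powi)
  then have id: "(\<lambda>\<xi>. \<xi>) \<in> Linf" by simp
  then have L: "(\<lambda>\<xi>. \<xi> * f \<xi>) \<in> L2" "(\<lambda>\<xi>. cnj \<xi> * f \<xi>) \<in> L2"
    using linear.prems(1) by (auto intro: L2_mult_Linf Linf_cnj)
  have "(\<lambda>\<xi>. of_real (p \<xi>) * f \<xi>) = (\<lambda>\<xi>. a * (\<xi> * f \<xi>) + cnj a * (cnj \<xi> * f \<xi>))"
    by (simp add: p algebra_simps)
  then show ?case
    using L linear.prems(2)
    by (simp add: L2_add L2_cmult fc_add fc_cmult fc_id_mult fc_cnj_mult)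
next
  case (const c)
  then show ?case by (simp add: L2_cmult fc_cmult)
next
  case (add p q)
  then show ?case by (simp add: distrib_right L2_add fc_add)
next
  case (mult p q)
  from mult.IH(2)[OF mult.prems] mult.IH(1)[of "\<lambda>\<xi>. of_real (q \<xi>) * f \<xi>"]
  show ?case by (simp add: mult.assoc)
qed

text \<open>The integral of f against a polynomial is a Fourier coefficient, hence 0. By
  Stone-Weierstrass polynomials approximate g uniformly on the circle, and f is integrable.\<close>

lemma fc_zero_continuous:
  fixes g :: "complex \<Rightarrow> real"
  assumes "f \<in> L2" "\<And>n. fc f n = 0" "continuous_on UNIV g"
  shows "(LINT \<xi>|circle. of_real (g \<xi>) * f \<xi>) = 0"
proof -
  note [measurable] = L2_measurable[OF assms(1)]
  define I where "I = (LINT \<xi>|circle. norm (f \<xi>))"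
  have "I \<ge> 0" by (simp add: I_def)
  have "norm (LINT \<xi>|circle. of_real (g \<xi>) * f \<xi>) \<le> e" if e: "e > 0" for e
  proof -
    \<comment> \<open>I + 1 and not I, since I may be zero.\<close>
    have "e / (I + 1) > 0" using \<open>I \<ge> 0\<close> e by simp
    then obtain p where p: "real_polynomial_function p" "\<And>\<xi>. \<xi> \<in> sphere 0 1 \<Longrightarrow> \<bar>g \<xi> - p \<xi>\<bar> < e / (I + 1)"
      using Stone_Weierstrass_real_polynomial_function[of "sphere 0 1" g "e / (I + 1)"]
        continuous_on_subset[OF assms(3)] by (metis compact_sphere subset_UNIV)
    have pf: "(\<lambda>\<xi>. of_real (p \<xi>) * f \<xi>) \<in> L2" "fc (\<lambda>\<xi>. of_real (p \<xi>) * f \<xi>) 0 = 0"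
      using fc_zero_real_polynomial[OF p(1) assms(1,2)] by auto
    have gm: "(\<lambda>\<xi>. complex_of_real (g \<xi>)) \<in> borel_measurable borel"
      using assms(3) by (intro borel_measurable_continuous_onI continuous_intros)
    have "bounded (g ` sphere 0 1)"
      by (intro compact_imp_bounded compact_continuous_image continuous_on_subset[OF assms(3)]) auto
    then obtain B where "\<forall>x\<in>g ` sphere 0 1. norm x \<le> B" unfolding bounded_iff by blast
    then have "\<And>\<xi>. \<xi> \<in> sphere 0 1 \<Longrightarrow> norm (g \<xi>) \<le> B" by blast
    then have "(\<lambda>\<xi>. of_real (g \<xi>)) \<in> Linf"
      using borel_measurable_circle[OF gm] by (auto simp: Linf_def space_circle intro!: exI[of _ B] AE_I2)
    then have gf: "(\<lambda>\<xi>. of_real (g \<xi>) * f \<xi>) \<in> L2" using assms(1) by (rule L2_mult_Linf)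
    have "(LINT \<xi>|circle. of_real (g \<xi>) * f \<xi>) = (LINT \<xi>|circle. of_real (g \<xi>) * f \<xi> - of_real (p \<xi>) * f \<xi>)"
      using pf gf by (simp add: integrable_L2 fc_def l2_inner_def)
    also have "norm \<dots> \<le> (LINT \<xi>|circle. e / (I + 1) * norm (f \<xi>))"
    proof (rule Bochner_Integration.integral_norm_bound_integral)
      fix \<xi> assume "\<xi> \<in> space circle"
      then have "\<bar>g \<xi> - p \<xi>\<bar> * norm (f \<xi>) \<le> e / (I + 1) * norm (f \<xi>)"
        using p(2)[of \<xi>] by (intro mult_right_mono) (auto simp: space_circle)
      moreover have "norm (of_real (g \<xi>) * f \<xi> - of_real (p \<xi>) * f \<xi>) = \<bar>g \<xi> - p \<xi>\<bar> * norm (f \<xi>)"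
        unfolding left_diff_distrib[symmetric] of_real_diff[symmetric] norm_mult norm_of_real by simp
      ultimately show "norm (of_real (g \<xi>) * f \<xi> - of_real (p \<xi>) * f \<xi>) \<le> e / (I + 1) * norm (f \<xi>)"
        by simp
    qed (use pf gf assms(1) in \<open>auto intro!: integrable_L2 L2_diff integrable_norm integrable_mult_right\<close>)
    also have "\<dots> = e / (I + 1) * I" by (simp add: I_def)
    also have "\<dots> \<le> e" using \<open>I \<ge> 0\<close> e by (simp add: field_simps)
    finally show ?thesis .
  qed
  then have "norm (LINT \<xi>|circle. of_real (g \<xi>) * f \<xi>) \<le> 0" by (rule field_le_epsilon[of _ 0, simplified])
  then show ?thesis by simp
qed

text \<open>The indicator is the limit of continuous functions falling linearly from 1 on F to 0 at
  distance 1/n; dominated convergence applies.\<close>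

lemma fc_zero_closed:
  assumes "f \<in> L2" "\<And>n. fc f n = 0" "closed F"
  shows "(LINT \<xi>|circle. indicator F \<xi> *\<^sub>R f \<xi>) = 0"
proof (cases "F = {}")
  \<comment> \<open>The empty set is separated because \<open>infdist\<close> to it is 0 by
    convention, and the approximating functions would all be 1.\<close>
  case False
  note [measurable] = L2_measurable[OF assms(1)]
  define g where "g = (\<lambda>n \<xi>. max 0 (1 - real n * infdist \<xi> F))"
  have gc: "continuous_on UNIV (g n)" for n
    unfolding g_def by (intro continuous_intros)
  have [measurable]: "(\<lambda>\<xi>. g n \<xi>) \<in> borel_measurable circle" for n
    unfolding measurable_cong_sets[OF sets_circle refl]
    by (intro measurable_restrict_space1 borel_measurable_continuous_onI gc)
  have [measurable]: "(\<lambda>\<xi>. indicator F \<xi> :: real) \<in> borel_measurable circle"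
    unfolding measurable_cong_sets[OF sets_circle refl]
    by (intro measurable_restrict_space1 borel_measurable_indicator borel_closed assms(3))
  have "(\<lambda>n. LINT \<xi>|circle. of_real (g n \<xi>) * f \<xi>) \<longlonglongrightarrow> (LINT \<xi>|circle. indicator F \<xi> *\<^sub>R f \<xi>)"
  proof (rule integral_dominated_convergence)
    show "integrable circle (\<lambda>\<xi>. norm (f \<xi>))" using assms(1) by (intro integrable_norm integrable_L2)
    show "AE \<xi> in circle. norm (of_real (g n \<xi>) * f \<xi>) \<le> norm (f \<xi>)" for n
      by (intro AE_I2) (auto simp: norm_mult g_def infdist_nonneg intro!: mult_left_le_one_le)
    show "AE \<xi> in circle. (\<lambda>n. of_real (g n \<xi>) * f \<xi>) \<longlonglongrightarrow> indicator F \<xi> *\<^sub>R f \<xi>"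
    proof (rule AE_I2)
      fix \<xi>
      have "(\<lambda>n. g n \<xi>) \<longlonglongrightarrow> indicator F \<xi>"
      proof (cases "\<xi> \<in> F")
        case True
        then show ?thesis by (simp add: g_def)
      next
        case out: False
        then have pos: "infdist \<xi> F > 0" using False assms(3)
          by (simp add: infdist_pos_not_in_closed)
        then obtain N :: nat where N: "1 / infdist \<xi> F < real N" using reals_Archimedean2 by blast
        have "\<forall>\<^sub>F n in sequentially. g n \<xi> = 0"
          using eventually_ge_at_top[of N]
        proof eventually_elim
          case (elim n)
          then have "1 / infdist \<xi> F < real n" using N by simp
          then have "1 < real n * infdist \<xi> F" using pos by (simp add: field_simps)
          then show ?case by (simp add: g_def)
        qed
        then show ?thesis using out by (simp add: tendsto_eventually)
      qed
      then show "(\<lambda>n. of_real (g n \<xi>) * f \<xi>) \<longlonglongrightarrow> indicator F \<xi> *\<^sub>R f \<xi>"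
        unfolding scaleR_conv_of_real by (intro tendsto_intros)
    qed
  qed measurable
  then show ?thesis
    using fc_zero_continuous[OF assms(1,2) gc] by (simp add: LIMSEQ_const_iff)
qed simp

text \<open>Closed sets are an intersection-stable generator of the Borel sets, so Dynkin's argument
  extends the vanishing of integrals from closed sets to all measurable sets; then f and 0 are
  densities of the same measure.\<close>

lemma fc_eq_zero_imp_AE_zero:
  assumes "f \<in> L2" "\<And>n. fc f n = 0"
  shows "AE \<xi> in circle. f \<xi> = 0"
proof -
  note [measurable] = L2_measurable[OF assms(1)]
  have int: "integrable circle f" using assms(1) by (rule integrable_L2)
  have setsI: "A \<inter> sphere 0 1 \<in> sets circle" if "A \<in> sets borel" for A
    using that by (auto simp: sets_circle sets_restrict_space)
  have seti: "set_integrable circle A f" if "A \<in> sets circle" for A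
    unfolding set_integrable_def using that int by (rule integrable_mult_indicator)
  \<comment> \<open>The induction runs over Borel sets of the plane, while the measurable sets of
    \<open>circle\<close> are subsets of the sphere; the intersection mediates.\<close>
  have restr: "set_lebesgue_integral circle (A \<inter> sphere 0 1) f = (LINT \<xi>|circle. indicator A \<xi> *\<^sub>R f \<xi>)" for A
    unfolding set_lebesgue_integral_def
    by (rule Bochner_Integration.integral_cong) (auto simp: space_circle indicator_def)
  have stable: "Int_stable {F :: complex set. closed F}" by (auto simp: Int_stable_def)
  have pow: "{F. closed F} \<subseteq> Pow (UNIV :: complex set)" by auto
  have sig: "A \<in> sigma_sets UNIV {F. closed F} \<longleftrightarrow> A \<in> sets borel" for A :: "complex set"
    by (simp add: borel_eq_closed)
  have "set_lebesgue_integral circle (A \<inter> sphere 0 1) f = 0" if "A \<in> sigma_sets UNIV {F. closed F}" for A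
    using stable pow that
  proof (induction A rule: sigma_sets_induct_disjoint)
    case (basic A)
    then show ?case unfolding restr using fc_zero_closed[OF assms] by simp
  next
    case (compl A)
    then have A: "A \<inter> sphere 0 1 \<in> sets circle" by (intro setsI) (simp add: sig)
    have "set_lebesgue_integral circle ((UNIV - A) \<inter> sphere 0 1) f
        = (LINT \<xi>|circle. f \<xi> - indicator (A \<inter> sphere 0 1) \<xi> *\<^sub>R f \<xi>)"
      unfolding set_lebesgue_integral_def
      by (rule Bochner_Integration.integral_cong) (auto simp: space_circle indicator_def)
    also have "\<dots> = integral\<^sup>L circle f - set_lebesgue_integral circle (A \<inter> sphere 0 1) f"
      unfolding set_lebesgue_integral_def
      by (rule Bochner_Integration.integral_diff[OF int integrable_mult_indicator[OF A int]])
    also have "integral\<^sup>L circle f = fc f 0" by (simp add: fc_def l2_inner_def)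
    finally show ?case using compl assms(2) by simp
  next
    case (union A)
    have A: "A i \<inter> sphere 0 1 \<in> sets circle" for i
      using union(2) sig by (intro setsI) blast
    have "(\<Union>i. A i) \<inter> sphere 0 1 = (\<Union>i. A i \<inter> sphere 0 1)" by auto
    moreover have "set_lebesgue_integral circle (\<Union>i. A i \<inter> sphere 0 1) f =
        (\<Sum>i. set_lebesgue_integral circle (A i \<inter> sphere 0 1) f)"
      by (rule lebesgue_integral_countable_add)
         (use A union(1) in \<open>auto intro!: seti sets.countable_UN simp: disjoint_family_on_def simp del: UN_simps\<close>)
    ultimately show ?case using union(3) by simp
  qed (simp add: set_lebesgue_integral_def)
  then have z: "set_lebesgue_integral circle A f = 0" if "A \<in> sets circle" for A
    using that by (auto simp: sets_circle sets_restrict_space sig Int_commute)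
  show ?thesis
    by (rule circle.density_unique_banach[OF int, of "\<lambda>\<xi>. 0"]) (simp_all add: z[unfolded set_lebesgue_integral_def] set_lebesgue_integral_def)
qed

section \<open>The Hardy space\<close>

lemma mult_cnj_cancel:
  fixes \<xi> :: complex
  assumes "norm \<xi> = 1"
  shows "\<xi> * cnj \<xi> = 1" "cnj \<xi> * \<xi> = 1" "\<xi> * (cnj \<xi> * z) = z" "cnj \<xi> * (\<xi> * z) = z"
proof -
  show 1: "\<xi> * cnj \<xi> = 1" using complex_norm_square[of \<xi>] assms by simp
  then show 2: "cnj \<xi> * \<xi> = 1" by (simp add: mult.commute)
  show "\<xi> * (cnj \<xi> * z) = z" using 1 by (simp add: mult.assoc[symmetric])
  show "cnj \<xi> * (\<xi> * z) = z" using 2 by (simp add: mult.assoc[symmetric])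
qed

text \<open>The orthogonal complement of the Hardy space in \<open>L\<^sup>2\<close>.\<close>

definition H2m :: "(complex \<Rightarrow> complex) set" where
  "H2m = {f \<in> L2. \<forall>n\<ge>0. fc f n = 0}"

lemma H2_iff: "f \<in> H2 \<longleftrightarrow> f \<in> L2 \<and> (\<forall>n<0. fc f n = 0)"
  by (auto simp: H2_def fc_def)

lemma H2_L2: "f \<in> H2 \<Longrightarrow> f \<in> L2"
  by (simp add: H2_def)

lemma H2m_L2: "f \<in> H2m \<Longrightarrow> f \<in> L2"
  by (simp add: H2m_def)

lemma H2_fc: "f \<in> H2 \<Longrightarrow> n < 0 \<Longrightarrow> fc f n = 0"
  by (simp add: H2_iff)

lemma H2m_fc: "f \<in> H2m \<Longrightarrow> n \<ge> 0 \<Longrightarrow> fc f n = 0"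
  by (simp add: H2m_def)

lemma H2I: "f \<in> L2 \<Longrightarrow> (\<And>n. n < 0 \<Longrightarrow> fc f n = 0) \<Longrightarrow> f \<in> H2"
  by (simp add: H2_iff)

lemma H2mI: "f \<in> L2 \<Longrightarrow> (\<And>n. n \<ge> 0 \<Longrightarrow> fc f n = 0) \<Longrightarrow> f \<in> H2m"
  by (simp add: H2m_def)

lemma H2_add: "f \<in> H2 \<Longrightarrow> g \<in> H2 \<Longrightarrow> (\<lambda>\<xi>. f \<xi> + g \<xi>) \<in> H2"
  by (auto simp: H2_iff L2_add fc_add)

lemma H2_diff: "f \<in> H2 \<Longrightarrow> g \<in> H2 \<Longrightarrow> (\<lambda>\<xi>. f \<xi> - g \<xi>) \<in> H2"
  by (auto simp: H2_iff L2_diff fc_diff)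

lemma H2_cmult: "f \<in> H2 \<Longrightarrow> (\<lambda>\<xi>. c * f \<xi>) \<in> H2"
  by (auto simp: H2_iff L2_cmult fc_cmult)

lemma H2_const [simp]: "(\<lambda>\<xi>. c) \<in> H2"
  by (auto simp: H2_iff fc_const intro: Linf_L2)

lemma H2_sum: "(\<And>i. i \<in> I \<Longrightarrow> f i \<in> H2) \<Longrightarrow> (\<lambda>\<xi>. \<Sum>i\<in>I. f i \<xi>) \<in> H2"
  by (induction I rule: infinite_finite_induct) (auto intro: H2_add)

lemma H2_cong_AE:
  "f \<in> H2 \<Longrightarrow> g \<in> borel_measurable circle \<Longrightarrow> AE \<xi> in circle. f \<xi> = g \<xi> \<Longrightarrow> g \<in> H2"
  using fc_cong_AE[of f g] by (auto simp: H2_iff L2_measurable intro: L2_cong_AE)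

lemma H2m_add: "f \<in> H2m \<Longrightarrow> g \<in> H2m \<Longrightarrow> (\<lambda>\<xi>. f \<xi> + g \<xi>) \<in> H2m"
  by (auto simp: H2m_def L2_add fc_add)

lemma H2m_diff: "f \<in> H2m \<Longrightarrow> g \<in> H2m \<Longrightarrow> (\<lambda>\<xi>. f \<xi> - g \<xi>) \<in> H2m"
  by (auto simp: H2m_def L2_diff fc_diff)

lemma H2m_cmult: "f \<in> H2m \<Longrightarrow> (\<lambda>\<xi>. c * f \<xi>) \<in> H2m"
  by (auto simp: H2m_def L2_cmult fc_cmult)

lemma H2m_zero [simp]: "(\<lambda>\<xi>. 0) \<in> H2m"
  by (auto simp: H2m_def fc_const)

lemma H2m_sum: "(\<And>i. i \<in> I \<Longrightarrow> f i \<in> H2m) \<Longrightarrow> (\<lambda>\<xi>. \<Sum>i\<in>I. f i \<xi>) \<in> H2m"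
  by (induction I rule: infinite_finite_induct) (auto intro: H2m_add)

lemma H2m_cong_AE:
  "f \<in> H2m \<Longrightarrow> g \<in> borel_measurable circle \<Longrightarrow> AE \<xi> in circle. f \<xi> = g \<xi> \<Longrightarrow> g \<in> H2m"
  using fc_cong_AE[of f g] by (auto simp: H2m_def L2_measurable intro: L2_cong_AE)

lemma H2_powi: "n \<ge> 0 \<Longrightarrow> (\<lambda>\<xi>. \<xi> powi n) \<in> H2"
  by (auto simp: H2_iff fc_powi)

lemma H2_H2m_zero:
  assumes "f \<in> H2" "f \<in> H2m"
  shows "AE \<xi> in circle. f \<xi> = 0"
proof (rule fc_eq_zero_imp_AE_zero[OF H2_L2[OF assms(1)]])
  show "fc f n = 0" for n
    using assms by (cases "n < 0") (auto intro: H2_fc H2m_fc)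
qed

text \<open>\<open>H2\<close> is the orthogonal complement of the negative powers. Both memberships
  of the remainder are recorded because the equality of \<open>l2_orth H2\<close> and
  \<open>H2m\<close> is derived from this lemma.\<close>

lemma H2_projection:
  assumes "f \<in> L2"
  shows "\<exists>g\<in>H2. (\<lambda>\<xi>. f \<xi> - g \<xi>) \<in> l2_orth H2 \<inter> H2m"
proof -
  define S :: "(complex \<Rightarrow> complex) set" where "S = {(\<lambda>\<xi>. \<xi> powi n) | n. n < 0}"
  have S: "S \<subseteq> L2" by (auto simp: S_def)
  have H2: "H2 = l2_orth S" by (auto simp: H2_def S_def l2_orth_def)
  have "l2_orth H2 \<subseteq> H2m" by (auto simp: H2m_def l2_orth_def fc_def intro: H2_powi)
  then show ?thesis using l2_projection_exists[OF S assms] unfolding H2 by blast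
qed

text \<open>The inclusion that needs work passes from orthogonality to the powers to orthogonality
  to all of \<open>H2\<close>: the \<open>H2\<close> part of an f in \<open>H2m\<close> lies in both
  spaces and vanishes a.e., so f agrees with its projection remainder.\<close>

lemma l2_orth_H2: "l2_orth H2 = H2m"
proof
  show "l2_orth H2 \<subseteq> H2m" by (auto simp: H2m_def l2_orth_def fc_def intro: H2_powi)
  show "H2m \<subseteq> l2_orth H2"
  proof
    fix f assume f: "f \<in> H2m"
    obtain g where g: "g \<in> H2" "(\<lambda>\<xi>. f \<xi> - g \<xi>) \<in> l2_orth H2" "(\<lambda>\<xi>. f \<xi> - g \<xi>) \<in> H2m"
      using H2_projection[OF H2m_L2[OF f]] by blast
    have "(\<lambda>\<xi>. f \<xi> - (f \<xi> - g \<xi>)) \<in> H2m" using f g(3) by (rule H2m_diff)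
    then have "AE \<xi> in circle. g \<xi> = 0" by (intro H2_H2m_zero g) simp
    then have "AE \<xi> in circle. f \<xi> - g \<xi> = f \<xi>" by eventually_elim simp
    then show "f \<in> l2_orth H2"
      by (intro l2_orth_cong_AE[OF _ g(2)]) (auto intro: H2_L2 L2_measurable[OF H2m_L2[OF f]])
  qed
qed

lemma H2_decomposition:
  assumes "f \<in> L2"
  obtains g h where "g \<in> H2" "h \<in> H2m" "\<And>\<xi>. f \<xi> = g \<xi> + h \<xi>"
proof -
  obtain g where "g \<in> H2" "(\<lambda>\<xi>. f \<xi> - g \<xi>) \<in> H2m" using H2_projection[OF assms] by blast
  then show ?thesis using that[of g "\<lambda>\<xi>. f \<xi> - g \<xi>"] by simp
qed

lemma l2_inner_H2m_H2: "f \<in> H2m \<Longrightarrow> g \<in> H2 \<Longrightarrow> l2_inner f g = 0"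
  using l2_orth_H2 by (auto simp: l2_orth_def)

lemma l2_inner_H2_H2m: "f \<in> H2 \<Longrightarrow> g \<in> H2m \<Longrightarrow> l2_inner f g = 0"
  using l2_inner_H2m_H2[of g f] by (simp add: l2_inner_eq_0_commute)

lemma Hinf_Linf: "u \<in> Hinf \<Longrightarrow> u \<in> Linf" and Hinf_H2: "u \<in> Hinf \<Longrightarrow> u \<in> H2"
  by (auto simp: Hinf_def)

lemma HinfI: "u \<in> Linf \<Longrightarrow> u \<in> H2 \<Longrightarrow> u \<in> Hinf"
  by (simp add: Hinf_def)

text \<open>Instead of multiplying Fourier series: a negative coefficient of u * f is the inner
  product of f with the conjugate of u times a negative power, and that second factor lies in
  \<open>H2m\<close>.\<close>

lemma H2_mult_Hinf:
  assumes "u \<in> Hinf" "f \<in> H2"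
  shows "(\<lambda>\<xi>. u \<xi> * f \<xi>) \<in> H2"
proof -
  have u: "u \<in> Linf" "u \<in> H2" using assms(1) by (auto simp: Hinf_def)
  have "fc (\<lambda>\<xi>. u \<xi> * f \<xi>) n = 0" if "n < 0" for n
  proof -
    have "(\<lambda>\<xi>. \<xi> powi n * cnj (u \<xi>)) \<in> H2m"
      using that u(2) by (intro H2mI L2_mult_Linf[OF Linf_powi L2_cnj[OF H2_L2]]) (simp_all add: fc_powi_mult fc_cnj H2_fc)
    then have "(\<lambda>\<xi>. cnj (u \<xi>) * \<xi> powi n) \<in> H2m" by (simp add: mult.commute)
    then show ?thesis
      unfolding fc_def l2_inner_mult_left by (rule l2_inner_H2_H2m[OF assms(2)])
  qed
  then show ?thesis using assms u by (auto intro: H2I L2_mult_Linf[OF _ H2_L2])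
qed

text \<open>The adjoint form of \<open>H2_mult_Hinf\<close>.\<close>

lemma H2m_mult_cnj_Hinf:
  assumes "u \<in> Hinf" "f \<in> H2m"
  shows "(\<lambda>\<xi>. cnj (u \<xi>) * f \<xi>) \<in> H2m"
proof -
  have u: "u \<in> Linf" "u \<in> H2" using assms(1) by (auto simp: Hinf_def)
  have "fc (\<lambda>\<xi>. cnj (u \<xi>) * f \<xi>) n = 0" if "n \<ge> 0" for n
    unfolding fc_def l2_inner_mult_left complex_cnj_cnj
    by (rule l2_inner_H2m_H2[OF assms(2) H2_mult_Hinf[OF assms(1) H2_powi[OF that]]])
  then show ?thesis using assms u by (auto intro: H2mI L2_mult_Linf[OF Linf_cnj H2m_L2])
qed

lemma Hinf_mult: "u \<in> Hinf \<Longrightarrow> v \<in> Hinf \<Longrightarrow> (\<lambda>\<xi>. u \<xi> * v \<xi>) \<in> Hinf"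
  by (rule HinfI) (simp_all add: Linf_mult H2_mult_Hinf Hinf_Linf Hinf_H2)

lemma Hinf_add: "u \<in> Hinf \<Longrightarrow> v \<in> Hinf \<Longrightarrow> (\<lambda>\<xi>. u \<xi> + v \<xi>) \<in> Hinf"
  by (rule HinfI) (simp_all add: Linf_add H2_add Hinf_Linf Hinf_H2)

lemma Hinf_const [simp]: "(\<lambda>\<xi>. c) \<in> Hinf"
  by (rule HinfI) auto

lemma Hinf_id [simp]: "(\<lambda>\<xi>. \<xi>) \<in> Hinf"
  using Linf_powi[of 1] H2_powi[of 1] by (simp add: Hinf_def)

lemma Hinf_power [simp]: "(\<lambda>\<xi>. \<xi> ^ n) \<in> Hinf"
  using Linf_powi[of "int n"] H2_powi[of "int n"] by (simp add: Hinf_def)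

lemma Hinf_poly [simp]: "(\<lambda>\<xi>. poly p \<xi>) \<in> Hinf"
  by (induction p) (auto intro!: Hinf_add Hinf_mult)

lemma Linf_poly [simp]: "(\<lambda>\<xi>. poly p \<xi>) \<in> Linf"
  by (rule Hinf_Linf) simp

text \<open>Passing from f to the conjugate of \<xi> * f exchanges the indices n and - n - 1, as
  \<open>flip\<close> does, but antilinearly.\<close>

lemma H2m_iff_cnj: "f \<in> H2m \<longleftrightarrow> f \<in> borel_measurable circle \<and> (\<lambda>\<xi>. cnj \<xi> * cnj (f \<xi>)) \<in> H2"
proof
  assume f: "f \<in> H2m"
  then have "(\<lambda>\<xi>. cnj \<xi> * cnj (f \<xi>)) \<in> L2"
    by (intro L2_mult_Linf L2_cnj H2m_L2 Linf_cnj Hinf_Linf) auto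
  then show "f \<in> borel_measurable circle \<and> (\<lambda>\<xi>. cnj \<xi> * cnj (f \<xi>)) \<in> H2"
    using f by (auto simp: fc_cnj_mult fc_cnj H2m_fc intro: H2I L2_measurable[OF H2m_L2])
next
  assume f: "f \<in> borel_measurable circle \<and> (\<lambda>\<xi>. cnj \<xi> * cnj (f \<xi>)) \<in> H2"
  have "(\<lambda>\<xi>. cnj \<xi> * cnj (cnj \<xi> * cnj (f \<xi>))) \<in> L2"
    using f by (intro L2_mult_Linf L2_cnj H2_L2 Linf_cnj Hinf_Linf) auto
  then have fL: "f \<in> L2"
    by (rule L2_cong_AE) (use f in \<open>auto intro!: AE_I2 dest!: norm_eq_1_circle simp: mult_cnj_cancel\<close>)
  have "fc f n = 0" if "n \<ge> 0" for n
    using H2_fc[of "\<lambda>\<xi>. cnj \<xi> * cnj (f \<xi>)" "- n - 1"] f that by (simp add: fc_cnj_mult fc_cnj)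
  then show "f \<in> H2m" using fL by (rule H2mI[rotated])
qed

lemma L2_flip: "f \<in> L2 \<Longrightarrow> flip f \<in> L2"
  unfolding flip_def by (intro L2_mult_Linf Linf_cnj Hinf_Linf L2_compose_cnj) auto

lemma fc_flip: "f \<in> L2 \<Longrightarrow> fc (flip f) n = fc f (- n - 1)"
  by (simp add: flip_def fc_cnj_mult fc_compose_cnj)

lemma flip_H2: "f \<in> H2 \<Longrightarrow> flip f \<in> H2m"
  by (rule H2mI) (simp_all add: L2_flip fc_flip H2_L2 H2_fc)

lemma flip_H2m: "f \<in> H2m \<Longrightarrow> flip f \<in> H2"
  by (rule H2I) (simp_all add: L2_flip fc_flip H2m_L2 H2m_fc)

lemma flip_flip: "norm \<xi> = 1 \<Longrightarrow> flip (flip f) \<xi> = f \<xi>"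
  by (simp add: flip_def mult_cnj_cancel)

lemma fc_sum_powers:
  "fc (\<lambda>\<xi>. \<Sum>j<d. a j * \<xi> ^ j) n = (if 0 \<le> n \<and> n < int d then a (nat n) else 0)"
proof -
  have p: "(\<lambda>\<xi>. \<xi> ^ j) \<in> L2" for j by (intro H2_L2 Hinf_H2) simp
  have "fc (\<lambda>\<xi>. \<Sum>j<d. a j * \<xi> ^ j) n = (\<Sum>j<d. if n = int j then a j else 0)"
    by (subst fc_sum) (auto intro!: L2_cmult p sum.cong simp: fc_cmult fc_power)
  also have "\<dots> = (\<Sum>j<d. if j = nat n \<and> 0 \<le> n then a j else 0)"
    by (intro sum.cong) auto
  finally show ?thesis by (auto simp: nat_less_iff)
qed

lemma L2_eq_sum_powers:
  assumes f: "f \<in> L2" and fc: "\<And>n. n < 0 \<or> n \<ge> int d \<Longrightarrow> fc f n = 0"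
  shows "AE \<xi> in circle. f \<xi> = (\<Sum>j<d. fc f (int j) * \<xi> ^ j)"
proof -
  have p: "(\<lambda>\<xi>. \<xi> ^ j) \<in> L2" for j by (intro H2_L2 Hinf_H2) simp
  have s: "(\<lambda>\<xi>. \<Sum>j<d. fc f (int j) * \<xi> ^ j) \<in> L2" by (intro L2_sum L2_cmult p)
  have "AE \<xi> in circle. f \<xi> - (\<Sum>j<d. fc f (int j) * \<xi> ^ j) = 0"
  proof (rule fc_eq_zero_imp_AE_zero)
    show "(\<lambda>\<xi>. f \<xi> - (\<Sum>j<d. fc f (int j) * \<xi> ^ j)) \<in> L2" using f s by (rule L2_diff)
    fix n
    show "fc (\<lambda>\<xi>. f \<xi> - (\<Sum>j<d. fc f (int j) * \<xi> ^ j)) n = 0"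
      using fc[of n] by (auto simp: fc_diff[OF f s] fc_sum_powers)
  qed
  then show ?thesis by simp
qed

section \<open>The model space and the kernel of the operator\<close>

lemma AE_flip_flip: "AE \<xi> in circle. flip (flip G) \<xi> = G \<xi>"
  by (rule AE_I2) (simp add: flip_flip norm_eq_1_circle)

lemma flip_H2_iff: "G \<in> borel_measurable circle \<Longrightarrow> flip G \<in> H2 \<longleftrightarrow> G \<in> H2m"
  using flip_H2[of "flip G"] flip_H2m[of G] H2m_cong_AE[OF _ _ AE_flip_flip] by blast

lemma flip_H2m_iff: "G \<in> borel_measurable circle \<Longrightarrow> flip G \<in> H2m \<longleftrightarrow> G \<in> H2"
  using flip_H2m[of "flip G"] flip_H2[of G] H2_cong_AE[OF _ _ AE_flip_flip] by blast

lemma AE_norm_circle: "AE \<xi> in circle. norm \<xi> = 1"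
  by (rule AE_I2) (rule norm_eq_1_circle)

lemma elt_set_times_image: "a *o B = (\<lambda>b. a * b) ` B"
  by (auto simp: elt_set_times_def)

section \<open>Projection onto the model space and the conjugation of the model space\<close>

locale inner_symbol =
  fixes \<theta> :: "complex \<Rightarrow> complex"
  assumes inner: "inner_function \<theta>"
begin

lemma theta_Hinf: "\<theta> \<in> Hinf"
  using inner by (simp add: inner_function_def)

lemma theta_Linf: "\<theta> \<in> Linf"
  using theta_Hinf by (rule Hinf_Linf)

lemma theta_meas [measurable]: "\<theta> \<in> borel_measurable circle"
  using theta_Linf by (rule Linf_measurable)

lemma AE_theta: "AE \<xi> in circle. norm (\<theta> \<xi>) = 1"
  using inner by (simp add: inner_function_def)

lemma breve_Linf: "breve \<theta> \<in> Linf"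
  unfolding breve_def by (rule Linf_compose_cnj[OF theta_Linf])

lemma AE_breve: "AE \<xi> in circle. norm (breve \<theta> \<xi>) = 1"
  unfolding breve_def by (rule AE_circle_cnj[OF AE_theta])

abbreviation "K \<equiv> model_space \<theta>"

lemma K_iff: "f \<in> K \<longleftrightarrow> f \<in> H2 \<and> (\<lambda>\<xi>. cnj (\<theta> \<xi>) * f \<xi>) \<in> H2m"
proof -
  have "l2_inner f (\<theta> * h) = l2_inner (\<lambda>\<xi>. cnj (\<theta> \<xi>) * f \<xi>) h" for h
    by (simp add: l2_inner_mult_left times_fun_def)
  then have "f \<in> l2_orth (\<theta> *o H2) \<longleftrightarrow> (\<lambda>\<xi>. cnj (\<theta> \<xi>) * f \<xi>) \<in> l2_orth H2" if "f \<in> L2"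
    using that L2_mult_Linf[OF Linf_cnj[OF theta_Linf] that]
    by (auto simp: l2_orth_def elt_set_times_def)
  then show ?thesis by (auto simp: model_space_def l2_orth_H2 H2_L2)
qed

lemma K_H2: "f \<in> K \<Longrightarrow> f \<in> H2"
  by (simp add: K_iff)

lemma K_L2: "f \<in> K \<Longrightarrow> f \<in> L2"
  by (simp add: K_H2 H2_L2)

lemma K_measurable: "f \<in> K \<Longrightarrow> f \<in> borel_measurable circle"
  by (simp add: K_L2 L2_measurable)

lemma K_add: "f \<in> K \<Longrightarrow> g \<in> K \<Longrightarrow> (\<lambda>\<xi>. f \<xi> + g \<xi>) \<in> K"
  by (simp add: K_iff H2_add H2m_add distrib_left)

lemma K_cmult: "f \<in> K \<Longrightarrow> (\<lambda>\<xi>. c * f \<xi>) \<in> K"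
  using H2m_cmult[of "\<lambda>\<xi>. cnj (\<theta> \<xi>) * f \<xi>" c] by (simp add: K_iff H2_cmult mult.left_commute)

lemma K_diff: "f \<in> K \<Longrightarrow> g \<in> K \<Longrightarrow> (\<lambda>\<xi>. f \<xi> - g \<xi>) \<in> K"
  by (simp add: K_iff H2_diff H2m_diff right_diff_distrib)

lemma K_zero: "(\<lambda>\<xi>. 0) \<in> K"
  by (simp add: K_iff)

lemma K_sum: "(\<And>i. i \<in> I \<Longrightarrow> f i \<in> K) \<Longrightarrow> (\<lambda>\<xi>. \<Sum>i\<in>I. f i \<xi>) \<in> K"
  by (induction I rule: infinite_finite_induct) (auto intro: K_add simp: K_zero)

lemma K_cong_AE:
  assumes "f \<in> K" "g \<in> borel_measurable circle" "AE \<xi> in circle. f \<xi> = g \<xi>"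
  shows "g \<in> K"
proof -
  note [measurable] = assms(2)
  have "AE \<xi> in circle. cnj (\<theta> \<xi>) * f \<xi> = cnj (\<theta> \<xi>) * g \<xi>"
    using assms(3) by eventually_elim simp
  moreover have "(\<lambda>\<xi>. cnj (\<theta> \<xi>) * g \<xi>) \<in> borel_measurable circle" by measurable
  ultimately show ?thesis
    using assms H2m_cong_AE[of "\<lambda>\<xi>. cnj (\<theta> \<xi>) * f \<xi>" "\<lambda>\<xi>. cnj (\<theta> \<xi>) * g \<xi>"]
    by (auto simp: K_iff intro: H2_cong_AE)
qed

text \<open>With P the projection onto \<open>H2\<close>, the projection onto K is P F - \<theta> *
  P (cnj \<theta> * F); g and g' are the two values of P. The remainder is a sum of an element of
  \<open>H2m\<close> and one of \<theta> * \<open>H2\<close>, both orthogonal to K.\<close>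

lemma K_decomposition:
  assumes F: "F \<in> L2"
    and g: "g \<in> H2" "h \<in> H2m" "\<And>\<xi>. F \<xi> = g \<xi> + h \<xi>"
    and g': "g' \<in> H2" "h' \<in> H2m" "\<And>\<xi>. cnj (\<theta> \<xi>) * F \<xi> = g' \<xi> + h' \<xi>"
  shows "(\<lambda>\<xi>. g \<xi> - \<theta> \<xi> * g' \<xi>) \<in> K" "(\<lambda>\<xi>. h \<xi> + \<theta> \<xi> * g' \<xi>) \<in> l2_orth K"
proof -
  note [measurable] = g(1)[THEN H2_L2, THEN L2_measurable] g'(1)[THEN H2_L2, THEN L2_measurable]
  have "(\<lambda>\<xi>. h' \<xi> - cnj (\<theta> \<xi>) * h \<xi>) \<in> H2m"
    by (intro H2m_diff g' g H2m_mult_cnj_Hinf theta_Hinf)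
  moreover have "AE \<xi> in circle. h' \<xi> - cnj (\<theta> \<xi>) * h \<xi> = cnj (\<theta> \<xi>) * (g \<xi> - \<theta> \<xi> * g' \<xi>)"
    using AE_theta
  proof eventually_elim
    case (elim \<xi>)
    have "h' \<xi> = cnj (\<theta> \<xi>) * (g \<xi> + h \<xi>) - g' \<xi>" using g'(3)[of \<xi>] g(3)[of \<xi>] by simp
    then show ?case by (simp add: right_diff_distrib distrib_left mult_cnj_cancel[OF elim])
  qed
  moreover have "(\<lambda>\<xi>. cnj (\<theta> \<xi>) * (g \<xi> - \<theta> \<xi> * g' \<xi>)) \<in> borel_measurable circle"
    by measurable
  ultimately have "(\<lambda>\<xi>. cnj (\<theta> \<xi>) * (g \<xi> - \<theta> \<xi> * g' \<xi>)) \<in> H2m"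
    using H2m_cong_AE by blast
  then show "(\<lambda>\<xi>. g \<xi> - \<theta> \<xi> * g' \<xi>) \<in> K"
    by (simp add: K_iff H2_diff g g' H2_mult_Hinf theta_Hinf)
  have tg: "(\<lambda>\<xi>. \<theta> \<xi> * g' \<xi>) \<in> L2" by (intro L2_mult_Linf theta_Linf H2_L2 g')
  have "l2_inner (\<lambda>\<xi>. h \<xi> + \<theta> \<xi> * g' \<xi>) k = 0" if "k \<in> K" for k
    using that g g' tg
    by (simp add: l2_inner_add H2m_L2 K_L2 l2_inner_H2m_H2 K_H2 l2_inner_mult_left l2_inner_H2_H2m K_iff)
  then show "(\<lambda>\<xi>. h \<xi> + \<theta> \<xi> * g' \<xi>) \<in> l2_orth K"
    using tg g by (auto simp: l2_orth_def intro: L2_add H2m_L2)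
qed

lemma l2_proj_K:
  assumes F: "F \<in> L2"
  shows "l2_proj K F \<in> K" "F - l2_proj K F \<in> l2_orth K"
proof -
  obtain g h where g: "g \<in> H2" "h \<in> H2m" "\<And>\<xi>. F \<xi> = g \<xi> + h \<xi>"
    using H2_decomposition[OF F] by blast
  obtain g' h' where g': "g' \<in> H2" "h' \<in> H2m" "\<And>\<xi>. cnj (\<theta> \<xi>) * F \<xi> = g' \<xi> + h' \<xi>"
    using H2_decomposition[OF L2_mult_Linf[OF Linf_cnj[OF theta_Linf] F]] by blast
  have "F - (\<lambda>\<xi>. g \<xi> - \<theta> \<xi> * g' \<xi>) = (\<lambda>\<xi>. h \<xi> + \<theta> \<xi> * g' \<xi>)"
    by (auto simp: g(3))
  with K_decomposition[OF F g g'] have "\<exists>p. p \<in> K \<and> F - p \<in> l2_orth K" by metis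
  then have "l2_proj K F \<in> K \<and> F - l2_proj K F \<in> l2_orth K"
    unfolding l2_proj_def by (rule someI_ex)
  then show "l2_proj K F \<in> K" "F - l2_proj K F \<in> l2_orth K" by auto
qed

lemma l2_proj_K_unique:
  assumes F: "F \<in> L2" and p: "p \<in> K" "(\<lambda>\<xi>. F \<xi> - p \<xi>) \<in> l2_orth K"
  shows "AE \<xi> in circle. l2_proj K F \<xi> = p \<xi>"
proof -
  define d where "d = (\<lambda>\<xi>. l2_proj K F \<xi> - p \<xi>)"
  have "d \<in> K" unfolding d_def by (intro K_diff l2_proj_K F p)
  have "(\<lambda>\<xi>. (F \<xi> - p \<xi>) - (F - l2_proj K F) \<xi>) \<in> l2_orth K"
    by (intro l2_orth_diff p l2_proj_K F) (auto intro: K_L2)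
  then have "d \<in> l2_orth K" by (simp add: d_def)
  then have "l2_inner d d = 0" using \<open>d \<in> K\<close> by (auto simp: l2_orth_def)
  then have "AE \<xi> in circle. d \<xi> = 0" using \<open>d \<in> K\<close> by (simp add: l2_inner_self_eq_0 K_L2)
  then show ?thesis by (simp add: d_def)
qed

definition conj_K :: "(complex \<Rightarrow> complex) \<Rightarrow> complex \<Rightarrow> complex" where
  "conj_K f = (\<lambda>\<xi>. \<theta> \<xi> * (cnj \<xi> * cnj (f \<xi>)))"

lemma AE_conj_K_conj_K: "AE \<xi> in circle. conj_K (conj_K f) \<xi> = f \<xi>"
  using AE_theta AE_norm_circle
  by eventually_elim (simp add: conj_K_def mult_cnj_cancel mult.left_commute)

text \<open>\<open>conj_K f\<close> is the conjugate of \<xi> * (cnj \<theta> * f), and cnj \<theta>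
  * \<open>conj_K f\<close> is a.e. the conjugate of \<xi> * f. So the two conditions in
  \<open>K_iff\<close> are exchanged.\<close>

lemma conj_K_K:
  assumes "f \<in> K"
  shows "conj_K f \<in> K"
proof -
  note [measurable] = K_measurable[OF assms]
  have "(\<lambda>\<xi>. cnj \<xi> * cnj (cnj (\<theta> \<xi>) * f \<xi>)) \<in> H2"
    using assms H2m_iff_cnj by (auto simp: K_iff)
  then have 1: "conj_K f \<in> H2" by (simp add: conj_K_def mult.left_commute)
  have "(\<lambda>\<xi>. cnj \<xi> * cnj (cnj (\<theta> \<xi>) * conj_K f \<xi>)) \<in> H2"
  proof (rule H2_cong_AE[OF K_H2[OF assms]])
    show "AE \<xi> in circle. f \<xi> = cnj \<xi> * cnj (cnj (\<theta> \<xi>) * conj_K f \<xi>)"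
      using AE_theta AE_norm_circle
      by eventually_elim (simp add: conj_K_def mult_cnj_cancel)
    show "(\<lambda>\<xi>. cnj \<xi> * cnj (cnj (\<theta> \<xi>) * conj_K f \<xi>)) \<in> borel_measurable circle"
      unfolding conj_K_def by measurable
  qed
  then have "(\<lambda>\<xi>. cnj (\<theta> \<xi>) * conj_K f \<xi>) \<in> H2m"
    unfolding H2m_iff_cnj conj_K_def by simp
  with 1 show ?thesis by (simp add: K_iff)
qed

text \<open>\<open>flip\<close> exchanges \<open>H2\<close> and \<open>H2m\<close> and turns
  multiplication by \<open>\<theta>\<close> into multiplication by \<open>breve \<theta>\<close>;
  both conditions in \<open>K_iff\<close> are pulled back along it.\<close>

lemma flip_K_iff:
  assumes G: "G \<in> borel_measurable circle"
  shows "flip G \<in> K \<longleftrightarrow> G \<in> H2m \<and> (\<lambda>\<xi>. cnj (breve \<theta> \<xi>) * G \<xi>) \<in> H2"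
proof -
  note [measurable] = G Linf_measurable[OF breve_Linf]
  have "(\<lambda>\<xi>. cnj (\<theta> \<xi>) * flip G \<xi>) = flip (\<lambda>\<xi>. cnj (breve \<theta> \<xi>) * G \<xi>)"
    by (simp add: flip_def breve_def mult.left_commute)
  moreover have "flip (\<lambda>\<xi>. cnj (breve \<theta> \<xi>) * G \<xi>) \<in> H2m \<longleftrightarrow> (\<lambda>\<xi>. cnj (breve \<theta> \<xi>) * G \<xi>) \<in> H2"
    by (rule flip_H2m_iff) measurable
  ultimately show ?thesis using flip_H2_iff[OF G] by (simp add: K_iff)
qed

end

section \<open>The kernel of the operator in terms of \<open>\<psi>\<close> and
  \<open>\<eta>\<close>\<close>

locale big_tto_symbol = inner_symbol +
  fixes \<phi> :: "complex \<Rightarrow> complex"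
  assumes phi_Linf: "\<phi> \<in> Linf"
begin

definition \<psi> :: "complex \<Rightarrow> complex" where
  "\<psi> = (\<lambda>\<xi>. cnj (breve \<theta> \<xi>) * \<phi> \<xi>)"

definition \<eta> :: "complex \<Rightarrow> complex" where
  "\<eta> = (\<lambda>\<xi>. cnj (\<phi> \<xi> * \<theta> \<xi>))"

lemma phi_meas [measurable]: "\<phi> \<in> borel_measurable circle"
  using phi_Linf by (rule Linf_measurable)

lemma psi_Linf: "\<psi> \<in> Linf"
  unfolding \<psi>_def by (intro Linf_mult Linf_cnj breve_Linf phi_Linf)

lemma eta_Linf: "\<eta> \<in> Linf"
  unfolding \<eta>_def by (intro Linf_mult Linf_cnj theta_Linf phi_Linf)

lemma phi_mult_L2: "f \<in> L2 \<Longrightarrow> \<phi> * f \<in> L2"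
  using L2_mult_Linf[OF phi_Linf] by (simp add: times_fun_def)

lemma flip_phi_mult_K_iff:
  assumes "f \<in> L2"
  shows "flip (\<phi> * f) \<in> K \<longleftrightarrow> (\<lambda>\<xi>. \<phi> \<xi> * f \<xi>) \<in> H2m \<and> (\<lambda>\<xi>. \<psi> \<xi> * f \<xi>) \<in> H2"
  using flip_K_iff[OF L2_measurable[OF phi_mult_L2[OF assms]]] by (simp add: times_fun_def \<psi>_def mult.assoc)

text \<open>On the circle \<open>\<phi> * conj_K g\<close> is the conjugate of
  \<open>\<xi> * \<eta> * g\<close>, so \<open>H2m_iff_cnj\<close> applies.\<close>

lemma phi_mult_conj_K_iff:
  assumes "g \<in> K"
  shows "(\<lambda>\<xi>. \<phi> \<xi> * conj_K g \<xi>) \<in> H2m \<longleftrightarrow> (\<lambda>\<xi>. \<eta> \<xi> * g \<xi>) \<in> H2"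
proof -
  note [measurable] = K_measurable[OF assms] Linf_measurable[OF eta_Linf]
  have m: "(\<lambda>\<xi>. \<phi> \<xi> * conj_K g \<xi>) \<in> borel_measurable circle" "(\<lambda>\<xi>. \<eta> \<xi> * g \<xi>) \<in> borel_measurable circle"
    unfolding conj_K_def by measurable
  then have m': "(\<lambda>\<xi>. cnj \<xi> * cnj (\<phi> \<xi> * conj_K g \<xi>)) \<in> borel_measurable circle" by measurable
  have eq: "AE \<xi> in circle. cnj \<xi> * cnj (\<phi> \<xi> * conj_K g \<xi>) = \<eta> \<xi> * g \<xi>"
    by (rule AE_I2) (auto dest!: norm_eq_1_circle simp: conj_K_def \<eta>_def mult_cnj_cancel mult_ac)
  then have eq': "AE \<xi> in circle. \<eta> \<xi> * g \<xi> = cnj \<xi> * cnj (\<phi> \<xi> * conj_K g \<xi>)"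
    by eventually_elim simp
  show ?thesis
    unfolding H2m_iff_cnj using H2_cong_AE[OF _ m(2) eq] H2_cong_AE[OF _ m' eq'] m(1) by blast
qed

text \<open>\<open>l2_proj\<close> is a choice, linear only up to null functions. Treating
  combinations directly bypasses linearity: if the images cancel, flip of phi times the combination
  equals a.e. a combination of the chosen projections, which is in K.\<close>

lemma big_tto_sum_kernel:
  assumes f: "\<And>i. i \<in> I \<Longrightarrow> f i \<in> K"
    and z: "AE \<xi> in circle. (\<Sum>i\<in>I. c i * big_tto \<theta> \<phi> (f i) \<xi>) = 0"
  shows "flip (\<phi> * (\<lambda>\<xi>. \<Sum>i\<in>I. c i * f i \<xi>)) \<in> K"
proof (rule K_cong_AE)
  define F where "F i = flip (\<phi> * f i)" for i
  have F: "F i \<in> L2" if "i \<in> I" for i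
    unfolding F_def by (intro L2_flip phi_mult_L2 K_L2 f that)
  show "(\<lambda>\<xi>. \<Sum>i\<in>I. c i * l2_proj K (F i) \<xi>) \<in> K"
    by (intro K_sum K_cmult l2_proj_K F)
  have "AE \<xi> in circle. (\<Sum>i\<in>I. c i * l2_proj K (F i) \<xi>) = (\<Sum>i\<in>I. c i * F i \<xi>)"
    using z by eventually_elim (simp add: big_tto_def F_def right_diff_distrib sum_subtractf)
  moreover have "flip (\<phi> * (\<lambda>\<xi>. \<Sum>i\<in>I. c i * f i \<xi>)) = (\<lambda>\<xi>. \<Sum>i\<in>I. c i * F i \<xi>)"
    by (simp add: F_def flip_def sum_distrib_left mult_ac)
  ultimately show "AE \<xi> in circle. (\<Sum>i\<in>I. c i * l2_proj K (F i) \<xi>) = flip (\<phi> * (\<lambda>\<xi>. \<Sum>i\<in>I. c i * f i \<xi>)) \<xi>"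
    by simp
  show "flip (\<phi> * (\<lambda>\<xi>. \<Sum>i\<in>I. c i * f i \<xi>)) \<in> borel_measurable circle"
    by (intro L2_measurable L2_flip phi_mult_L2 L2_sum L2_cmult K_L2 f)
qed

lemma big_tto_AE_zero_iff:
  assumes "f \<in> K"
  shows "(AE \<xi> in circle. big_tto \<theta> \<phi> f \<xi> = 0) \<longleftrightarrow> flip (\<phi> * f) \<in> K"
proof
  assume "AE \<xi> in circle. big_tto \<theta> \<phi> f \<xi> = 0"
  then show "flip (\<phi> * f) \<in> K"
    using big_tto_sum_kernel[of "{()}" "\<lambda>_. f" "\<lambda>_. 1"] assms by simp
next
  assume F: "flip (\<phi> * f) \<in> K"
  have "AE \<xi> in circle. l2_proj K (flip (\<phi> * f)) \<xi> = flip (\<phi> * f) \<xi>"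
    by (rule l2_proj_K_unique) (use F in \<open>auto intro: K_L2\<close>)
  then show "AE \<xi> in circle. big_tto \<theta> \<phi> f \<xi> = 0"
    by eventually_elim (simp add: big_tto_def)
qed

text \<open>\<open>conj_K\<close> is an involution of K up to null functions; when f ranges over all
  of K, the condition on \<open>conj_K f\<close> may therefore be put on f.\<close>

lemma big_tto_zero_iff:
  "big_tto_zero \<theta> \<phi> \<longleftrightarrow> (\<forall>f\<in>K. (\<lambda>\<xi>. \<eta> \<xi> * f \<xi>) \<in> H2 \<and> (\<lambda>\<xi>. \<psi> \<xi> * f \<xi>) \<in> H2)"
proof -
  have *: "big_tto_zero \<theta> \<phi> \<longleftrightarrow> (\<forall>f\<in>K. (\<lambda>\<xi>. \<phi> \<xi> * f \<xi>) \<in> H2m \<and> (\<lambda>\<xi>. \<psi> \<xi> * f \<xi>) \<in> H2)"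
    by (simp add: big_tto_zero_def big_tto_AE_zero_iff flip_phi_mult_K_iff K_L2)
  have "(\<lambda>\<xi>. \<phi> \<xi> * f \<xi>) \<in> H2m" if "f \<in> K" and all: "\<forall>f\<in>K. (\<lambda>\<xi>. \<eta> \<xi> * f \<xi>) \<in> H2" for f
  proof (rule H2m_cong_AE)
    note [measurable] = K_measurable[OF that(1)]
    show "(\<lambda>\<xi>. \<phi> \<xi> * conj_K (conj_K f) \<xi>) \<in> H2m"
      using phi_mult_conj_K_iff conj_K_K that by blast
    show "AE \<xi> in circle. \<phi> \<xi> * conj_K (conj_K f) \<xi> = \<phi> \<xi> * f \<xi>"
      using AE_conj_K_conj_K[of f] by eventually_elim simp
    show "(\<lambda>\<xi>. \<phi> \<xi> * f \<xi>) \<in> borel_measurable circle" by measurable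
  qed
  then show ?thesis unfolding * using phi_mult_conj_K_iff conj_K_K by blast
qed

text \<open>\<open>\<theta>\<close> is unimodular a.e. and can be moved to the other side. E is
  arbitrary so as to serve both parts of the theorem.\<close>

lemma mem_ae_class_cnj_iff:
  "\<phi> \<in> ae_class (cnj_set (\<theta> *o E)) \<longleftrightarrow> (\<exists>h\<in>E. AE \<xi> in circle. \<eta> \<xi> = h \<xi>)"
proof -
  have "(AE \<xi> in circle. \<phi> \<xi> = cnj (\<theta> \<xi> * h \<xi>)) \<longleftrightarrow> (AE \<xi> in circle. \<eta> \<xi> = h \<xi>)" for h
  proof
    assume "AE \<xi> in circle. \<phi> \<xi> = cnj (\<theta> \<xi> * h \<xi>)"
    then show "AE \<xi> in circle. \<eta> \<xi> = h \<xi>"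
      using AE_theta by eventually_elim (simp add: \<eta>_def mult_cnj_cancel mult_ac)
  next
    assume "AE \<xi> in circle. \<eta> \<xi> = h \<xi>"
    then show "AE \<xi> in circle. \<phi> \<xi> = cnj (\<theta> \<xi> * h \<xi>)"
      using AE_theta
    proof eventually_elim
      case (elim \<xi>)
      show ?case unfolding elim(1)[symmetric] by (simp add: \<eta>_def mult_cnj_cancel[OF elim(2)] mult_ac)
    qed
  qed
  then show ?thesis
    by (simp add: ae_class_def cnj_set_def elt_set_times_image del: complex_cnj_mult)
qed

lemma mem_ae_class_breve_iff:
  "\<phi> \<in> ae_class (breve \<theta> *o E) \<longleftrightarrow> (\<exists>h\<in>E. AE \<xi> in circle. \<psi> \<xi> = h \<xi>)"
proof -
  have "(AE \<xi> in circle. \<phi> \<xi> = breve \<theta> \<xi> * h \<xi>) \<longleftrightarrow> (AE \<xi> in circle. \<psi> \<xi> = h \<xi>)" for h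
  proof
    assume "AE \<xi> in circle. \<phi> \<xi> = breve \<theta> \<xi> * h \<xi>"
    then show "AE \<xi> in circle. \<psi> \<xi> = h \<xi>"
      using AE_breve by eventually_elim (simp add: \<psi>_def mult_cnj_cancel)
  next
    assume "AE \<xi> in circle. \<psi> \<xi> = h \<xi>"
    then show "AE \<xi> in circle. \<phi> \<xi> = breve \<theta> \<xi> * h \<xi>"
      using AE_breve
    proof eventually_elim
      case (elim \<xi>)
      show ?case unfolding elim(1)[symmetric] by (simp add: \<psi>_def mult_cnj_cancel[OF elim(2)])
    qed
  qed
  then show ?thesis
    by (simp add: ae_class_def elt_set_times_image)
qed

end

lemma Linf_AE_Hinf_iff:
  assumes "u \<in> Linf"
  shows "(\<exists>h\<in>Hinf. AE \<xi> in circle. u \<xi> = h \<xi>) \<longleftrightarrow> u \<in> H2"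
proof
  assume "\<exists>h\<in>Hinf. AE \<xi> in circle. u \<xi> = h \<xi>"
  then obtain h where h: "h \<in> Hinf" "AE \<xi> in circle. h \<xi> = u \<xi>" by (auto simp: eq_commute)
  show "u \<in> H2" by (rule H2_cong_AE[OF Hinf_H2[OF h(1)] Linf_measurable[OF assms] h(2)])
next
  assume "u \<in> H2"
  then show "\<exists>h\<in>Hinf. AE \<xi> in circle. u \<xi> = h \<xi>" using assms by (intro bexI[of _ u]) (auto simp: Hinf_def)
qed

section \<open>The reproducing kernel at the origin and part (i)\<close>

context inner_symbol
begin

text \<open>The projection of the constant 1 onto K, that is, the reproducing kernel of K at the
  origin.\<close>

definition k0 :: "complex \<Rightarrow> complex" where
  "k0 = (\<lambda>\<xi>. 1 - cnj (fc \<theta> 0) * \<theta> \<xi>)"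

lemma k0_K: "k0 \<in> K"
proof -
  have tH: "\<theta> \<in> H2" by (rule Hinf_H2[OF theta_Hinf])
  have 1: "k0 \<in> H2" unfolding k0_def by (intro H2_diff H2_cmult tH) simp
  have L: "(\<lambda>\<xi>. cnj (\<theta> \<xi>) - cnj (fc \<theta> 0)) \<in> L2"
    by (intro L2_diff L2_cnj H2_L2 tH) simp
  have "fc (\<lambda>\<xi>. cnj (\<theta> \<xi>) - cnj (fc \<theta> 0)) n = 0" if "n \<ge> 0" for n
    using that tH by (subst fc_diff) (auto simp: fc_cnj fc_const H2_L2 L2_cnj H2_fc)
  then have "(\<lambda>\<xi>. cnj (\<theta> \<xi>) - cnj (fc \<theta> 0)) \<in> H2m" by (intro H2mI L)
  moreover have "AE \<xi> in circle. cnj (\<theta> \<xi>) - cnj (fc \<theta> 0) = cnj (\<theta> \<xi>) * k0 \<xi>"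
    using AE_theta by eventually_elim (simp add: k0_def right_diff_distrib mult_cnj_cancel mult_ac)
  moreover have "(\<lambda>\<xi>. cnj (\<theta> \<xi>) * k0 \<xi>) \<in> borel_measurable circle"
    unfolding k0_def by measurable
  ultimately have "(\<lambda>\<xi>. cnj (\<theta> \<xi>) * k0 \<xi>) \<in> H2m"
    using H2m_cong_AE by blast
  with 1 show ?thesis by (simp add: K_iff)
qed

lemma k0_Hinf: "k0 \<in> Hinf"
proof (rule HinfI[OF _ K_H2[OF k0_K]])
  show "k0 \<in> Linf" unfolding k0_def by (intro Linf_diff Linf_mult Linf_const theta_Linf)
qed

text \<open>In place of the maximum principle: with c = \<open>fc \<theta> 0\<close>, the squared
  distance from \<theta> to the constant c is 1 - |c|^2, so |c| at least 1 makes \<theta> equal to c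
  a.e.\<close>

lemma norm_theta0:
  assumes "\<not> ae_constant \<theta>"
  shows "norm (fc \<theta> 0) < 1"
proof (rule ccontr)
  assume a: "\<not> norm (fc \<theta> 0) < 1"
  define c where "c = fc \<theta> 0"
  have tL: "\<theta> \<in> L2" by (rule Linf_L2[OF theta_Linf])
  have "l2_sq \<theta> = (LINT \<xi>|circle. 1)"
    unfolding l2_sq_def by (rule integral_cong_AE) (use AE_theta in auto)
  then have 1: "l2_sq \<theta> = 1" by (simp add: measure_circle)
  have "l2_sq (\<lambda>\<xi>. \<theta> \<xi> + (- c) * 1) = l2_sq \<theta> + 2 * Re (cnj (- c) * l2_inner \<theta> (\<lambda>\<xi>. 1)) + (norm (- c))\<^sup>2 * l2_sq (\<lambda>\<xi>. 1)"
    by (rule l2_sq_add) (auto simp: tL intro: Linf_L2)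
  also have "l2_inner \<theta> (\<lambda>\<xi>. 1) = c" by (simp add: c_def fc_def)
  also have "l2_sq (\<lambda>\<xi>. 1) = 1" by (simp add: l2_sq_def measure_circle)
  also have "Re (cnj (- c) * c) = - (norm c)\<^sup>2" unfolding cmod_power2 by (simp add: power2_eq_square)
  finally have "l2_sq (\<lambda>\<xi>. \<theta> \<xi> - c) = 1 - (norm c)\<^sup>2" by (simp add: 1)
  moreover have "(norm c)\<^sup>2 \<ge> 1" using a by (simp add: c_def)
  ultimately have "l2_sq (\<lambda>\<xi>. \<theta> \<xi> - c) = 0" using l2_sq_nonneg[of "\<lambda>\<xi>. \<theta> \<xi> - c"] by linarith
  then have "l2_inner (\<lambda>\<xi>. \<theta> \<xi> - c) (\<lambda>\<xi>. \<theta> \<xi> - c) = 0" by (simp add: l2_inner_self l2_sq_def)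
  then have "AE \<xi> in circle. \<theta> \<xi> - c = 0"
    by (subst (asm) l2_inner_self_eq_0[OF L2_diff[OF tL Linf_L2[OF Linf_const]]])
  then show False using assms by (auto simp: ae_constant_def)
qed

text \<open>
  If \<open>u\<^sub>-\<close> is the component of \<open>u\<close> in the complement of \<open>H\<^sup>2\<close>, then \<open>u\<^sub>-\<close> is the projection of
  \<open>cnj \<theta>(0) \<theta> u\<^sub>-\<close>, whose norm is at most \<open>\<bar>\<theta>(0)\<bar>\<close> times that of \<open>u\<^sub>-\<close>.
\<close>

lemma k0_mult_H2_imp_H2:
  assumes "\<not> ae_constant \<theta>" "u \<in> L2" "(\<lambda>\<xi>. u \<xi> * k0 \<xi>) \<in> H2"
  shows "u \<in> H2"
proof -
  define c where "c = cnj (fc \<theta> 0)"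
  have c: "norm c < 1" using norm_theta0[OF assms(1)] by (simp add: c_def)
  obtain g h where g: "g \<in> H2" and h: "h \<in> H2m" and u: "\<And>\<xi>. u \<xi> = g \<xi> + h \<xi>"
    using H2_decomposition[OF assms(2)] by blast
  have hL: "h \<in> L2" by (rule H2m_L2[OF h])
  have th: "(\<lambda>\<xi>. \<theta> \<xi> * h \<xi>) \<in> L2" by (intro L2_mult_Linf theta_Linf hL)
  have "(\<lambda>\<xi>. k0 \<xi> * g \<xi>) \<in> H2"
    by (rule H2_mult_Hinf[OF k0_Hinf g])
  with assms(3) have "(\<lambda>\<xi>. u \<xi> * k0 \<xi> - k0 \<xi> * g \<xi>) \<in> H2" by (rule H2_diff)
  then have "(\<lambda>\<xi>. h \<xi> - c * (\<theta> \<xi> * h \<xi>)) \<in> H2"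
    by (simp add: u k0_def c_def algebra_simps)
  then have "l2_inner (\<lambda>\<xi>. h \<xi> - c * (\<theta> \<xi> * h \<xi>)) h = 0" using h by (rule l2_inner_H2_H2m)
  then have "l2_inner h h = c * l2_inner (\<lambda>\<xi>. \<theta> \<xi> * h \<xi>) h"
    using hL th by (simp add: l2_inner_diff L2_cmult l2_inner_cmult)
  then have "l2_sq h = norm c * norm (l2_inner (\<lambda>\<xi>. \<theta> \<xi> * h \<xi>) h)"
    using l2_sq_nonneg[of h] by (metis abs_of_nonneg l2_inner_self l2_sq_def norm_mult norm_of_real)
  also have "norm (l2_inner (\<lambda>\<xi>. \<theta> \<xi> * h \<xi>) h) \<le> l2_sq h"
  proof -
    have "norm (l2_inner (\<lambda>\<xi>. \<theta> \<xi> * h \<xi>) h) \<le> (LINT \<xi>|circle. norm (\<theta> \<xi> * h \<xi> * cnj (h \<xi>)))"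
      unfolding l2_inner_def by (rule integral_norm_bound)
    also have "\<dots> = l2_sq h"
      unfolding l2_sq_def
    proof (rule integral_cong_AE)
      note [measurable] = L2_measurable[OF hL]
      show "AE \<xi> in circle. norm (\<theta> \<xi> * h \<xi> * cnj (h \<xi>)) = (norm (h \<xi>))\<^sup>2"
        using AE_theta by eventually_elim (simp add: norm_mult power2_eq_square)
    qed (use L2_measurable[OF hL] in measurable)
    finally show ?thesis .
  qed
  finally have "l2_sq h \<le> norm c * l2_sq h" by (simp add: mult_left_mono)
  moreover have "norm c * l2_sq h < 1 * l2_sq h" if "l2_sq h > 0"
    using c that by (rule mult_strict_right_mono)
  ultimately have "l2_sq h = 0" using l2_sq_nonneg[of h] by fastforce
  then have "AE \<xi> in circle. h \<xi> = 0"
    using l2_inner_self_eq_0[OF hL] by (simp add: l2_inner_self l2_sq_def)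
  then have "AE \<xi> in circle. g \<xi> = u \<xi>" by eventually_elim (simp add: u)
  with g show ?thesis by (rule H2_cong_AE[OF _ L2_measurable[OF assms(2)]])
qed

end

context big_tto_symbol
begin

lemma big_tto_zero_if:
  assumes "\<phi> \<in> ae_class (cnj_set (\<theta> *o Hinf)) \<inter> ae_class (breve \<theta> *o Hinf)"
  shows "big_tto_zero \<theta> \<phi>"
proof -
  have "\<eta> \<in> Hinf" "\<psi> \<in> Hinf"
    using assms mem_ae_class_cnj_iff[of Hinf] mem_ae_class_breve_iff[of Hinf]
      Linf_AE_Hinf_iff[OF eta_Linf] Linf_AE_Hinf_iff[OF psi_Linf] eta_Linf psi_Linf
    by (auto simp: Hinf_def)
  then show ?thesis by (auto simp: big_tto_zero_iff intro: H2_mult_Hinf K_H2)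
qed

lemma big_tto_zero_only_if:
  assumes "\<not> ae_constant \<theta>" "big_tto_zero \<theta> \<phi>"
  shows "\<phi> \<in> ae_class (cnj_set (\<theta> *o Hinf)) \<inter> ae_class (breve \<theta> *o Hinf)"
proof -
  have "(\<lambda>\<xi>. \<eta> \<xi> * k0 \<xi>) \<in> H2" "(\<lambda>\<xi>. \<psi> \<xi> * k0 \<xi>) \<in> H2"
    using assms(2) k0_K unfolding big_tto_zero_iff by blast+
  then have "\<eta> \<in> H2" "\<psi> \<in> H2"
    using k0_mult_H2_imp_H2[OF assms(1) Linf_L2] eta_Linf psi_Linf by blast+
  then show ?thesis
    by (simp add: mem_ae_class_cnj_iff mem_ae_class_breve_iff Linf_AE_Hinf_iff eta_Linf psi_Linf)
qed

end

section \<open>Finite rank\<close>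

text \<open>More unknowns than equations. Elimination with a pivot k removes one equation and one
  unknown; the removed unknown t is then solved from that equation.\<close>

lemma exists_nontrivial_relation:
  fixes c :: "'b \<Rightarrow> 'i \<Rightarrow> 'a :: field"
  assumes "finite B" "finite I" "card B < card I"
  shows "\<exists>d. (\<exists>i\<in>I. d i \<noteq> 0) \<and> (\<forall>b\<in>B. (\<Sum>i\<in>I. d i * c b i) = 0)"
  using assms
proof (induction B arbitrary: I c rule: finite_induct)
  case empty
  then show ?case by (intro exI[of _ "\<lambda>_. 1"]) (auto simp: card_gt_0_iff)
next
  case (insert b B)
  show ?case
  proof (cases "\<forall>i\<in>I. c b i = 0")
    case True
    then show ?thesis using insert.IH[of I c] insert.prems insert.hyps by auto
  next
    case False
    then obtain k where k: "k \<in> I" "c b k \<noteq> 0" by blast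
    define J where "J = I - {k}"
    have J: "finite J" "card B < card J" "k \<notin> J" "I = insert k J"
      using insert k by (auto simp: J_def card_Diff_singleton)
    obtain d where d: "\<exists>i\<in>J. d i \<noteq> 0" "\<forall>x\<in>B. (\<Sum>i\<in>J. d i * (c x i - c x k * c b i / c b k)) = 0"
      using insert.IH[OF J(1,2), of "\<lambda>x i. c x i - c x k * c b i / c b k"] by blast
    define t where "t = - (\<Sum>i\<in>J. d i * c b i) / c b k"
    define e where "e = (\<lambda>i. if i = k then t else d i)"
    have e: "(\<Sum>i\<in>I. e i * c x i) = t * c x k + (\<Sum>i\<in>J. d i * c x i)" for x
    proof -
      have "(\<Sum>i\<in>J. e i * c x i) = (\<Sum>i\<in>J. d i * c x i)"
        using J(3) by (intro sum.cong) (auto simp: e_def)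
      then show ?thesis using J by (simp add: e_def)
    qed
    have "(\<Sum>i\<in>I. e i * c b i) = 0" using k(2) by (simp add: e t_def)
    moreover have "(\<Sum>i\<in>I. e i * c x i) = 0" if "x \<in> B" for x
    proof -
      have eq: "(\<Sum>i\<in>J. d i * (c x i - c x k * c b i / c b k)) =
          (\<Sum>i\<in>J. d i * c x i) - (\<Sum>i\<in>J. d i * c b i) * (c x k / c b k)"
        by (simp add: sum_distrib_left sum_divide_distrib sum_subtractf right_diff_distrib mult_ac)
      have "(\<Sum>i\<in>J. d i * c x i) - (\<Sum>i\<in>J. d i * c b i) * (c x k / c b k) = 0"
        using d(2) that unfolding eq[symmetric] by blast
      then show ?thesis by (simp add: e t_def)
    qed
    moreover have "\<exists>i\<in>I. e i \<noteq> 0" using d(1) J by (auto simp: e_def)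
    ultimately show ?thesis by auto
  qed
qed

text \<open>\<open>l2_finite_dim\<close> indexes coefficients by the functions themselves; for a
  family that may have repetitions, the coefficients of equal members have to be added.\<close>

lemma l2_finite_dimI:
  assumes "finite I" "\<And>i. i \<in> I \<Longrightarrow> b i \<in> L2"
    and "\<And>f. f \<in> S \<Longrightarrow> \<exists>c. AE \<xi> in circle. f \<xi> = (\<Sum>i\<in>I. c i * b i \<xi>)"
  shows "l2_finite_dim S"
  unfolding l2_finite_dim_def
proof (intro exI[of _ "b ` I"] conjI ballI)
  show "finite (b ` I)" "b ` I \<subseteq> L2" using assms(1,2) by auto
  fix f assume "f \<in> S"
  then obtain c where c: "AE \<xi> in circle. f \<xi> = (\<Sum>i\<in>I. c i * b i \<xi>)" using assms(3) by blast
  define c' where "c' = (\<lambda>x. \<Sum>i | i \<in> I \<and> b i = x. c i)"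
  have "(\<Sum>i\<in>I. c i * b i \<xi>) = (\<Sum>x\<in>b ` I. c' x * x \<xi>)" for \<xi>
  proof -
    have "(\<Sum>i\<in>I. c i * b i \<xi>) = (\<Sum>x\<in>b ` I. \<Sum>i | i \<in> I \<and> b i = x. c i * b i \<xi>)"
      using assms(1) by (rule sum.image_gen)
    also have "\<dots> = (\<Sum>x\<in>b ` I. c' x * x \<xi>)"
      by (auto simp: c'_def sum_distrib_right intro!: sum.cong)
    finally show ?thesis .
  qed
  then show "\<exists>c. AE \<xi> in circle. f \<xi> = (\<Sum>x\<in>b ` I. c x * x \<xi>)" using c by auto
qed

text \<open>Independence in the triangular form that successive choice delivers: if no further
  element existed, the earlier ones would span S.\<close>

lemma not_l2_finite_dim_independent:
  assumes "\<not> l2_finite_dim S" "S \<subseteq> L2"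
  shows "\<exists>f :: nat \<Rightarrow> complex \<Rightarrow> complex. \<forall>n. f n \<in> S \<and>
    (\<forall>c. \<not> (AE \<xi> in circle. f n \<xi> = (\<Sum>i<n. c i * f i \<xi>)))"
proof (rule dependent_wellorder_choice)
  fix r :: "complex \<Rightarrow> complex" and f g :: "nat \<Rightarrow> complex \<Rightarrow> complex" and n :: nat
  assume "\<And>i. i < n \<Longrightarrow> f i = g i"
  then have "(\<Sum>i<n. c i * f i \<xi>) = (\<Sum>i<n. c i * g i \<xi>)" for c \<xi> by (intro sum.cong) auto
  then show "(r \<in> S \<and> (\<forall>c. \<not> (AE \<xi> in circle. r \<xi> = (\<Sum>i<n. c i * f i \<xi>)))) =
      (r \<in> S \<and> (\<forall>c. \<not> (AE \<xi> in circle. r \<xi> = (\<Sum>i<n. c i * g i \<xi>))))" by simp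
next
  fix n :: nat and f :: "nat \<Rightarrow> complex \<Rightarrow> complex"
  assume "\<And>i. i < n \<Longrightarrow> f i \<in> S \<and> (\<forall>c. \<not> (AE \<xi> in circle. f i \<xi> = (\<Sum>j<i. c j * f j \<xi>)))"
  then have "f i \<in> L2" if "i \<in> {..<n}" for i using that assms(2) by auto
  then show "\<exists>r. r \<in> S \<and> (\<forall>c. \<not> (AE \<xi> in circle. r \<xi> = (\<Sum>i<n. c i * f i \<xi>)))"
    using l2_finite_dimI[of "{..<n}" f S] assms(1) by auto
qed

lemma obtain_last_nonzero:
  fixes d :: "nat \<Rightarrow> 'a :: zero"
  assumes "\<exists>i\<le>r. d i \<noteq> 0"
  obtains k where "k \<le> r" "d k \<noteq> 0" "\<And>i. k < i \<Longrightarrow> i \<le> r \<Longrightarrow> d i = 0"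
proof -
  define A where "A = {i. i \<le> r \<and> d i \<noteq> 0}"
  have A: "finite A" "A \<noteq> {}" using assms by (auto simp: A_def)
  show ?thesis
  proof (rule that[of "Max A"])
    show "Max A \<le> r" "d (Max A) \<noteq> 0" using Max_in[OF A] by (auto simp: A_def)
    show "d i = 0" if "Max A < i" "i \<le> r" for i
    proof (rule ccontr)
      assume "d i \<noteq> 0"
      then have "i \<le> Max A" using that(2) by (intro Max_ge A) (simp add: A_def)
      then show False using that(1) by simp
    qed
  qed
qed

text \<open>Otherwise the member with the last nonzero coefficient would be a combination of its
  predecessors.\<close>

lemma independent_combination_nonzero:
  fixes f :: "nat \<Rightarrow> complex \<Rightarrow> complex"
  assumes f: "\<And>n c. \<not> (AE \<xi> in circle. f n \<xi> = (\<Sum>i<n. c i * f i \<xi>))"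
    and d: "\<exists>i\<le>r. d i \<noteq> 0"
  shows "\<not> (AE \<xi> in circle. (\<Sum>i\<le>r. d i * f i \<xi>) = 0)"
proof
  assume z: "AE \<xi> in circle. (\<Sum>i\<le>r. d i * f i \<xi>) = 0"
  obtain k where k: "k \<le> r" "d k \<noteq> 0" "\<And>i. k < i \<Longrightarrow> i \<le> r \<Longrightarrow> d i = 0"
    using obtain_last_nonzero[OF d] by blast
  have eq: "(\<Sum>i\<le>r. d i * f i \<xi>) = d k * f k \<xi> + (\<Sum>i<k. d i * f i \<xi>)" for \<xi>
  proof -
    have "(\<Sum>i\<le>r. d i * f i \<xi>) = (\<Sum>i\<le>k. d i * f i \<xi>)"
      using k by (intro sum.mono_neutral_right) auto
    then show ?thesis by (simp add: lessThan_Suc_atMost[symmetric] add.commute)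
  qed
  have "AE \<xi> in circle. f k \<xi> = (\<Sum>i<k. (- d i / d k) * f i \<xi>)"
    using z
  proof eventually_elim
    case (elim \<xi>)
    then have "d k * f k \<xi> = - (\<Sum>i<k. d i * f i \<xi>)" by (simp add: eq eq_neg_iff_add_eq_0)
    then have "f k \<xi> = - (\<Sum>i<k. d i * f i \<xi>) / d k" using k(2) by (simp add: field_simps)
    then show ?case by (simp add: sum_divide_distrib sum_negf)
  qed
  with f[of k "\<lambda>i. - d i / d k"] show False by blast
qed

lemma H2m_powi_mult: "f \<in> H2m \<Longrightarrow> n \<le> 0 \<Longrightarrow> (\<lambda>\<xi>. \<xi> powi n * f \<xi>) \<in> H2m"
  by (rule H2mI) (auto simp: fc_powi_mult H2m_fc intro: L2_mult_Linf H2m_L2)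

lemma H2m_powi: "n < 0 \<Longrightarrow> (\<lambda>\<xi>. \<xi> powi n) \<in> H2m"
  by (rule H2mI) (auto simp: fc_powi)

section \<open>Backward shifts and a polynomial multiplier into \<open>H2\<close>\<close>

context inner_symbol
begin

text \<open>The n-th iterate of the backward shift in closed form. The Taylor section that it drops
  is the source of the polynomial Q below.\<close>

definition bshift :: "nat \<Rightarrow> (complex \<Rightarrow> complex) \<Rightarrow> complex \<Rightarrow> complex" where
  "bshift n f = (\<lambda>\<xi>. \<xi> powi (- int n) * (f \<xi> - (\<Sum>j<n. fc f (int j) * \<xi> ^ j)))"

text \<open>Dropping the section keeps the quotient in \<open>H2\<close>. After multiplication by
  \<open>cnj \<theta>\<close> the dropped terms carry exponents j - n < 0, so they lie in
  \<open>H2m\<close>, as does cnj \<theta> * f times a negative power.\<close>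

lemma bshift_K:
  assumes f: "f \<in> K"
  shows "bshift n f \<in> K"
proof -
  note [measurable] = K_measurable[OF f]
  have s: "(\<lambda>\<xi>. \<Sum>j<n. fc f (int j) * \<xi> ^ j) \<in> L2"
    by (intro L2_sum L2_cmult H2_L2 Hinf_H2) simp
  have L: "bshift n f \<in> L2"
    unfolding bshift_def by (intro L2_mult_Linf Linf_powi L2_diff s K_L2 f)
  have "fc (bshift n f) k = 0" if "k < 0" for k
    using that H2_fc[OF K_H2[OF f]]
    unfolding bshift_def fc_powi_mult fc_diff[OF K_L2[OF f] s] fc_sum_powers by simp
  then have 1: "bshift n f \<in> H2" by (intro H2I L)
  have "(\<lambda>\<xi>. \<xi> powi (- int n) * (cnj (\<theta> \<xi>) * f \<xi>)
      - (\<Sum>j<n. fc f (int j) * (cnj (\<theta> \<xi>) * \<xi> powi (int j - int n)))) \<in> H2m"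
    using f by (intro H2m_diff H2m_powi_mult[of "\<lambda>\<xi>. cnj (\<theta> \<xi>) * f \<xi>"] H2m_sum H2m_cmult
      H2m_mult_cnj_Hinf[of \<theta> "\<lambda>\<xi>. \<xi> powi _"] theta_Hinf H2m_powi) (auto simp: K_iff)
  moreover have "AE \<xi> in circle. \<xi> powi (- int n) * (cnj (\<theta> \<xi>) * f \<xi>)
      - (\<Sum>j<n. fc f (int j) * (cnj (\<theta> \<xi>) * \<xi> powi (int j - int n))) = cnj (\<theta> \<xi>) * bshift n f \<xi>"
    using AE_norm_circle
  proof eventually_elim
    case (elim \<xi>)
    then have "\<xi> \<noteq> 0" by auto
    then have "\<xi> powi (int j - int n) = \<xi> powi (- int n) * \<xi> ^ j" for j
      by (simp add: power_int_diff power_int_minus field_simps)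
    then show ?case
      by (simp add: bshift_def right_diff_distrib sum_distrib_left mult_ac)
  qed
  moreover have "(\<lambda>\<xi>. cnj (\<theta> \<xi>) * bshift n f \<xi>) \<in> borel_measurable circle"
    by (intro L2_measurable L2_mult_Linf Linf_cnj theta_Linf L)
  ultimately have "(\<lambda>\<xi>. cnj (\<theta> \<xi>) * bshift n f \<xi>) \<in> H2m"
    using H2m_cong_AE by blast
  with 1 show ?thesis by (simp add: K_iff)
qed

text \<open>The hypothesis \<open>codim\<close> says that the f in K with u * f in \<open>H2\<close>
  have codimension at most r in K. It is used twice: on independent elements, to get a nonzero such
  f, and on backward shifts of that f.\<close>

lemma exists_poly_mult_H2:
  assumes K: "\<not> l2_finite_dim K" and u: "u \<in> Linf"
    and codim: "\<And>f :: nat \<Rightarrow> complex \<Rightarrow> complex. (\<And>i. f i \<in> K) \<Longrightarrow>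
      \<exists>d. (\<exists>i\<le>r. d i \<noteq> 0) \<and> (\<lambda>\<xi>. u \<xi> * (\<Sum>i\<le>r. d i * f i \<xi>)) \<in> H2"
  shows "\<exists>q. q \<noteq> 0 \<and> (\<lambda>\<xi>. poly q \<xi> * u \<xi>) \<in> H2"
proof -
  obtain f0 :: "nat \<Rightarrow> complex \<Rightarrow> complex" where f0: "\<And>n. f0 n \<in> K"
      "\<And>n c. \<not> (AE \<xi> in circle. f0 n \<xi> = (\<Sum>i<n. c i * f0 i \<xi>))"
    using not_l2_finite_dim_independent[OF K] K_L2 by blast
  obtain d0 where d0: "\<exists>i\<le>r. d0 i \<noteq> 0" "(\<lambda>\<xi>. u \<xi> * (\<Sum>i\<le>r. d0 i * f0 i \<xi>)) \<in> H2"
    using codim[of f0] f0(1) by blast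
  define f where "f = (\<lambda>\<xi>. \<Sum>i\<le>r. d0 i * f0 i \<xi>)"
  have f: "f \<in> K" unfolding f_def by (intro K_sum K_cmult f0)
  have uf: "(\<lambda>\<xi>. u \<xi> * f \<xi>) \<in> H2" using d0(2) by (simp add: f_def)
  have "\<not> (AE \<xi> in circle. f \<xi> = 0)"
    unfolding f_def by (rule independent_combination_nonzero[OF f0(2) d0(1)])
  then obtain k where k: "fc f k \<noteq> 0" using fc_eq_zero_imp_AE_zero[OF K_L2[OF f]] by blast
  then have "k \<ge> 0" using H2_fc[OF K_H2[OF f], of k] by force
  with k have ex: "fc f (int (nat k)) \<noteq> 0" by simp
  define m where "m = (LEAST j. fc f (int j) \<noteq> 0)"
  have m: "fc f (int m) \<noteq> 0" unfolding m_def by (rule LeastI[of "\<lambda>j. fc f (int j) \<noteq> 0"]) (rule ex)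
  have below: "fc f (int j) = 0" if "j < m" for j
    using not_less_Least[of j "\<lambda>j. fc f (int j) \<noteq> 0"] that by (auto simp: m_def)
  \<comment> \<open>A shift by m + 1 or more drops the first nonzero coefficient of f, so this
    coefficient occurs in every section.\<close>
  obtain d where d: "\<exists>i\<le>r. d i \<noteq> 0" "(\<lambda>\<xi>. u \<xi> * (\<Sum>i\<le>r. d i * bshift (m + 1 + i) f \<xi>)) \<in> H2"
    using codim[of "\<lambda>i. bshift (m + 1 + i) f"] bshift_K[OF f] by blast
  \<comment> \<open>The factor \<open>\<xi> ^ (m + 1 + r)\<close> clears all negative powers: times
    the shift by m + 1 + i it is \<open>\<xi> ^ (r - i)\<close> times the difference of f and its
    section. P collects the factors of f, and Q the sections.\<close>
  define P where "P = (\<Sum>i\<le>r. monom (d i) (r - i))"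
  define Q where "Q = (\<Sum>i\<le>r. \<Sum>j<m + 1 + i. monom (d i * fc f (int j)) (r - i + j))"
  obtain n where n: "n \<le> r" "d n \<noteq> 0" "\<And>i. n < i \<Longrightarrow> i \<le> r \<Longrightarrow> d i = 0"
    using obtain_last_nonzero[OF d(1)] by blast
  \<comment> \<open>Nothing cancels in this degree: i > n has d i = 0, i = n requires j = m, and i <
    n requires j = m - (n - i) < m, where the coefficient of f vanishes.\<close>
  have "coeff Q (r - n + m) = (\<Sum>i\<le>r. \<Sum>j<m + 1 + i. if r - i + j = r - n + m then d i * fc f (int j) else 0)"
    by (simp only: Q_def coeff_sum coeff_monom)
  also have "\<dots> = (\<Sum>i\<le>r. if i = n then d n * fc f (int m) else 0)"
  proof (rule sum.cong[OF refl])
    fix i assume i: "i \<in> {..r}"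
    consider "i > n" | "i = n" | "i < n" by linarith
    then show "(\<Sum>j<m + 1 + i. if r - i + j = r - n + m then d i * fc f (int j) else 0) =
        (if i = n then d n * fc f (int m) else 0)"
    proof cases
      case 1
      then show ?thesis using n(3)[of i] i by (auto intro!: sum.neutral)
    next
      case 2
      then have "(\<Sum>j<m + 1 + i. if r - i + j = r - n + m then d i * fc f (int j) else 0) =
          (\<Sum>j<m + 1 + i. if j = m then d n * fc f (int m) else 0)"
        by (intro sum.cong) auto
      then show ?thesis using 2 by simp
    next
      case 3
      then have "(\<Sum>j<m + 1 + i. if r - i + j = r - n + m then d i * fc f (int j) else 0) = 0"
        using n(1) i by (intro sum.neutral) (auto intro: below)
      then show ?thesis using 3 by simp
    qed
  qed
  also have "\<dots> = d n * fc f (int m)" using n(1) by simp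
  finally have "Q \<noteq> 0" using n(2) m by auto
  have "(\<lambda>\<xi>. poly P \<xi> * (u \<xi> * f \<xi>) - \<xi> ^ (m + 1 + r) * (u \<xi> * (\<Sum>i\<le>r. d i * bshift (m + 1 + i) f \<xi>))) \<in> H2"
    by (intro H2_diff H2_mult_Hinf Hinf_poly Hinf_power uf d)
  moreover have "(\<lambda>\<xi>. poly Q \<xi> * u \<xi>) \<in> borel_measurable circle"
    using L2_mult_Linf[OF Linf_poly Linf_L2[OF u]] by (rule L2_measurable)
  moreover have "AE \<xi> in circle. poly P \<xi> * (u \<xi> * f \<xi>) - \<xi> ^ (m + 1 + r) * (u \<xi> * (\<Sum>i\<le>r. d i * bshift (m + 1 + i) f \<xi>)) = poly Q \<xi> * u \<xi>"
    using AE_norm_circle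
  proof eventually_elim
    case (elim \<xi>)
    then have "\<xi> \<noteq> 0" by auto
    have "\<xi> ^ (m + 1 + r) * (d i * bshift (m + 1 + i) f \<xi>) =
        d i * \<xi> ^ (r - i) * f \<xi> - (\<Sum>j<m + 1 + i. d i * fc f (int j) * \<xi> ^ (r - i + j))" if "i \<le> r" for i
    proof -
      have "\<xi> ^ (m + 1 + r) = \<xi> ^ (r - i) * \<xi> ^ (m + 1 + i)"
        using that by (simp add: add_ac flip: power_add)
      then have "\<xi> ^ (m + 1 + r) * \<xi> powi (- int (m + 1 + i)) = \<xi> ^ (r - i)"
        by (simp only: power_int_minus power_int_of_nat mult.assoc right_inverse[OF power_not_zero[OF \<open>\<xi> \<noteq> 0\<close>]] mult_1_right)
      moreover have "\<xi> ^ (m + 1 + r) * (d i * bshift (m + 1 + i) f \<xi>) = d i *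
          ((\<xi> ^ (m + 1 + r) * \<xi> powi (- int (m + 1 + i))) * (f \<xi> - (\<Sum>j<m + 1 + i. fc f (int j) * \<xi> ^ j)))"
        unfolding bshift_def by (simp only: mult_ac)
      ultimately have "\<xi> ^ (m + 1 + r) * (d i * bshift (m + 1 + i) f \<xi>) =
          d i * (\<xi> ^ (r - i) * (f \<xi> - (\<Sum>j<m + 1 + i. fc f (int j) * \<xi> ^ j)))"
        by (simp only:)
      then show ?thesis
        by (simp only: right_diff_distrib sum_distrib_left power_add mult_ac)
    qed
    then have "(\<Sum>i\<le>r. \<xi> ^ (m + 1 + r) * (d i * bshift (m + 1 + i) f \<xi>)) =
        (\<Sum>i\<le>r. d i * \<xi> ^ (r - i) * f \<xi> - (\<Sum>j<m + 1 + i. d i * fc f (int j) * \<xi> ^ (r - i + j)))"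
      by (intro sum.cong) auto
    then have "\<xi> ^ (m + 1 + r) * (\<Sum>i\<le>r. d i * bshift (m + 1 + i) f \<xi>) = poly P \<xi> * f \<xi> - poly Q \<xi>"
      by (simp only: sum_distrib_left[symmetric] sum_subtractf sum_distrib_right[symmetric] P_def Q_def poly_sum poly_monom)
    then have "\<xi> ^ (m + 1 + r) * (u \<xi> * (\<Sum>i\<le>r. d i * bshift (m + 1 + i) f \<xi>)) = u \<xi> * (poly P \<xi> * f \<xi> - poly Q \<xi>)"
      by (simp only: mult.left_commute[of "\<xi> ^ (m + 1 + r)" "u \<xi>"])
    then show ?case by (simp only: right_diff_distrib) (simp add: mult_ac)
  qed
  ultimately have "(\<lambda>\<xi>. poly Q \<xi> * u \<xi>) \<in> H2" by (rule H2_cong_AE)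
  with \<open>Q \<noteq> 0\<close> show ?thesis by blast
qed

end

section \<open>Zeros outside the open disk and rational remainders\<close>

text \<open>
  If \<open>h\<close> is the component of \<open>G\<close> in the complement of \<open>H\<^sup>2\<close>, then \<open>(\<xi> - a) h\<close> is a constant \<open>c\<close>;
  comparing the norms of \<open>\<xi> h\<close> and \<open>a h + c\<close> forces \<open>c = 0\<close> because \<open>h\<close> is orthogonal to constants.
\<close>

lemma linear_factor_mult_H2_imp_H2:
  assumes G: "G \<in> L2" and aG: "(\<lambda>\<xi>. (\<xi> - a) * G \<xi>) \<in> H2" and a: "norm a \<ge> 1"
  shows "G \<in> H2"
proof -
  obtain g h where g: "g \<in> H2" and h: "h \<in> H2m" and u: "\<And>\<xi>. G \<xi> = g \<xi> + h \<xi>"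
    using H2_decomposition[OF G] by blast
  have hL: "h \<in> L2" by (rule H2m_L2[OF h])
  have xh: "(\<lambda>\<xi>. \<xi> * h \<xi>) \<in> L2" by (intro L2_mult_Linf Hinf_Linf hL) simp
  define w where "w = (\<lambda>\<xi>. \<xi> * h \<xi> - a * h \<xi>)"
  have "(\<lambda>\<xi>. (\<xi> - a) * G \<xi> - (\<xi> * g \<xi> - a * g \<xi>)) \<in> H2"
    by (intro H2_diff aG H2_mult_Hinf H2_cmult g) simp
  then have w: "w \<in> H2" by (simp add: w_def u algebra_simps)
  have fcw: "fc w n = fc h (n - 1) - a * fc h n" for n
    unfolding w_def by (subst fc_diff) (auto simp: fc_id_mult fc_cmult xh hL L2_cmult)
  define c where "c = fc w 0"
  have "AE \<xi> in circle. w \<xi> = (\<Sum>j<1. fc w (int j) * \<xi> ^ j)"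
  proof (rule L2_eq_sum_powers[OF H2_L2[OF w]])
    show "fc w n = 0" if "n < 0 \<or> n \<ge> int 1" for n
      using that H2_fc[OF w, of n] H2m_fc[OF h] by (auto simp: fcw)
  qed
  then have eq: "AE \<xi> in circle. \<xi> * h \<xi> = c + a * h \<xi>"
    by eventually_elim (simp add: w_def c_def algebra_simps)
  have m: "h \<in> borel_measurable circle" by (rule L2_measurable[OF hL])
  note [measurable] = m
  have "l2_sq h = l2_sq (\<lambda>\<xi>. \<xi> * h \<xi>)"
    unfolding l2_sq_def by (rule Bochner_Integration.integral_cong) (auto simp: norm_mult norm_eq_1_circle)
  also have "\<dots> = l2_sq (\<lambda>\<xi>. c + a * h \<xi>)"
    unfolding l2_sq_def by (rule integral_cong_AE) (use eq in auto)
  also have "\<dots> = l2_sq (\<lambda>\<xi>. c) + 2 * Re (cnj a * l2_inner (\<lambda>\<xi>. c) h) + (norm a)\<^sup>2 * l2_sq h"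
    by (intro l2_sq_add Linf_L2 hL) simp
  also have "l2_inner (\<lambda>\<xi>. c) h = 0" by (rule l2_inner_H2_H2m[OF _ h]) simp
  also have "l2_sq (\<lambda>\<xi>. c) = (norm c)\<^sup>2" by (simp add: l2_sq_def measure_circle)
  finally have "l2_sq h = (norm c)\<^sup>2 + (norm a)\<^sup>2 * l2_sq h" by simp
  moreover have "1 * l2_sq h \<le> (norm a)\<^sup>2 * l2_sq h"
    using a by (intro mult_right_mono l2_sq_nonneg) simp
  ultimately have "(norm c)\<^sup>2 \<le> 0" by linarith
  then have c: "fc w 0 = 0" by (simp add: c_def)
  have "fc h n = 0" if "n \<le> -1" for n
    using that
  proof (induction n rule: int_le_induct)
    case base
    show ?case using c fcw[of 0] H2m_fc[OF h, of 0] by simp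
  next
    case (step i)
    then show ?case using fcw[of i] H2_fc[OF w, of i] by simp
  qed
  then have "h \<in> H2" by (intro H2I hL) auto
  then have "(\<lambda>\<xi>. g \<xi> + h \<xi>) \<in> H2" by (intro H2_add g)
  moreover have "G = (\<lambda>\<xi>. g \<xi> + h \<xi>)" using u by auto
  ultimately show ?thesis by simp
qed

text \<open>Induction on the degree: a zero of norm at least 1 gives a linear factor that
  \<open>linear_factor_mult_H2_imp_H2\<close> removes. Zeros on the circle disappear too, so the
  final polynomial can be divided by there.\<close>

lemma exists_poly_disk_roots_mult_H2:
  assumes "q \<noteq> 0" "u \<in> L2" "(\<lambda>\<xi>. poly q \<xi> * u \<xi>) \<in> H2"
  shows "\<exists>p. (\<forall>z. poly p z = 0 \<longrightarrow> norm z < 1) \<and> (\<lambda>\<xi>. poly p \<xi> * u \<xi>) \<in> H2"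
  using assms(1,3)
proof (induction "degree q" arbitrary: q rule: less_induct)
  case less
  show ?case
  proof (cases "\<forall>z. poly q z = 0 \<longrightarrow> norm z < 1")
    case False
    then obtain a where a: "poly q a = 0" "norm a \<ge> 1" by force
    then obtain p where p: "q = [:- a, 1:] * p" by (auto simp: poly_eq_0_iff_dvd)
    with less.prems(1) have "p \<noteq> 0" by auto
    then have "degree q = Suc (degree p)" unfolding p by (subst degree_mult_eq) auto
    moreover have "(\<lambda>\<xi>. (\<xi> - a) * (poly p \<xi> * u \<xi>)) \<in> H2"
      using less.prems(2) by (simp add: p algebra_simps)
    then have "(\<lambda>\<xi>. poly p \<xi> * u \<xi>) \<in> H2"
      by (rule linear_factor_mult_H2_imp_H2[OF L2_mult_Linf[OF Linf_poly assms(2)] _ a(2)])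
    ultimately show ?thesis using less.hyps[of p] \<open>p \<noteq> 0\<close> by auto
  qed (use less.prems in blast)
qed

lemma fc_poly_mult:
  assumes "f \<in> L2"
  shows "fc (\<lambda>\<xi>. poly q \<xi> * f \<xi>) n = (\<Sum>i\<le>degree q. coeff q i * fc f (n - int i))"
proof -
  have "(\<lambda>\<xi>. poly q \<xi> * f \<xi>) = (\<lambda>\<xi>. \<Sum>i\<le>degree q. coeff q i * (\<xi> ^ i * f \<xi>))"
    by (simp add: poly_altdef sum_distrib_right mult.assoc)
  moreover have "(\<lambda>\<xi>. coeff q i * (\<xi> ^ i * f \<xi>)) \<in> L2" for i
    by (intro L2_cmult L2_mult_Linf Hinf_Linf assms) simp
  ultimately show ?thesis by (simp add: fc_sum fc_cmult fc_power_mult)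
qed

text \<open>Multiplication by q raises frequencies by at most \<open>degree q\<close>, so q * h has
  none from \<open>degree q\<close> on; lying in \<open>H2\<close>, it has no negative ones
  either.\<close>

lemma H2m_poly_mult_H2:
  assumes "h \<in> H2m" "(\<lambda>\<xi>. poly q \<xi> * h \<xi>) \<in> H2"
  shows "\<exists>a. AE \<xi> in circle. poly q \<xi> * h \<xi> = (\<Sum>j<degree q. a j * \<xi> ^ j)"
proof -
  have "fc (\<lambda>\<xi>. poly q \<xi> * h \<xi>) n = 0" if "n < 0 \<or> n \<ge> int (degree q)" for n
    using that
  proof
    assume "n \<ge> int (degree q)"
    then show ?thesis
      using H2m_fc[OF assms(1)] by (simp add: fc_poly_mult[OF H2m_L2[OF assms(1)]])
  qed (rule H2_fc[OF assms(2)])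
  from L2_eq_sum_powers[OF H2_L2[OF assms(2)] this] show ?thesis
    by (intro exI[of _ "\<lambda>j. fc (\<lambda>\<xi>. poly q \<xi> * h \<xi>) (int j)"])
qed

lemma Linf_rational:
  assumes "\<forall>z. poly q z = 0 \<longrightarrow> norm z < 1"
  shows "(\<lambda>\<xi>. poly p \<xi> / poly q \<xi>) \<in> Linf"
proof -
  have ne: "poly q \<xi> \<noteq> 0" if "norm \<xi> = 1" for \<xi> using assms that by force
  have "bounded ((\<lambda>\<xi>. poly p \<xi> / poly q \<xi>) ` sphere 0 1)"
    by (intro compact_imp_bounded compact_continuous_image continuous_intros) (auto simp: ne)
  then obtain B where "\<forall>x\<in>(\<lambda>\<xi>. poly p \<xi> / poly q \<xi>) ` sphere 0 1. norm x \<le> B"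
    unfolding bounded_iff by blast
  then have B: "norm (poly p \<xi> / poly q \<xi>) \<le> B" if "\<xi> \<in> space circle" for \<xi>
    using that by (auto simp: space_circle)
  have "poly s \<in> borel_measurable borel" for s :: "complex poly"
    by (intro borel_measurable_continuous_onI continuous_intros)
  then have [measurable]: "(\<lambda>\<xi>. poly s \<xi>) \<in> borel_measurable circle" for s :: "complex poly"
    by (rule borel_measurable_circle)
  show ?thesis
    unfolding Linf_def by (auto intro!: exI[of _ B] AE_I2 B simp del: norm_divide)
qed

lemma poly_mult_H2_imp_Hinf_plus_rational:
  assumes u: "u \<in> Linf" and q: "q \<noteq> 0" "(\<lambda>\<xi>. poly q \<xi> * u \<xi>) \<in> H2"
  shows "u \<in> Hinf + rational_disk_poles"
proof -
  have uL: "u \<in> L2" using u by (rule Linf_L2)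
  obtain p where p: "\<forall>z. poly p z = 0 \<longrightarrow> norm z < 1" "(\<lambda>\<xi>. poly p \<xi> * u \<xi>) \<in> H2"
    using exists_poly_disk_roots_mult_H2[OF q(1) uL q(2)] by blast
  obtain g h where g: "g \<in> H2" and h: "h \<in> H2m" and gh: "\<And>\<xi>. u \<xi> = g \<xi> + h \<xi>"
    using H2_decomposition[OF uL] by blast
  have "(\<lambda>\<xi>. poly p \<xi> * u \<xi> - poly p \<xi> * g \<xi>) \<in> H2"
    by (intro H2_diff H2_mult_Hinf p g) simp
  then have "(\<lambda>\<xi>. poly p \<xi> * h \<xi>) \<in> H2" by (simp add: gh algebra_simps)
  then obtain a where a: "AE \<xi> in circle. poly p \<xi> * h \<xi> = (\<Sum>j<degree p. a j * \<xi> ^ j)"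
    using H2m_poly_mult_H2[OF h] by blast
  define s where "s = (\<Sum>j<degree p. monom (a j) j)"
  define R where "R = (\<lambda>\<xi>. poly s \<xi> / poly p \<xi>)"
  have R: "R \<in> Linf" unfolding R_def by (rule Linf_rational[OF p(1)])
  have "AE \<xi> in circle. g \<xi> = u \<xi> - R \<xi>"
    using a AE_norm_circle
  proof eventually_elim
    case (elim \<xi>)
    then have "poly p \<xi> \<noteq> 0" using p(1) by force
    then have "h \<xi> = R \<xi>" using elim(1) by (simp add: R_def s_def poly_sum poly_monom field_simps)
    then show ?case by (simp add: gh)
  qed
  then have "(\<lambda>\<xi>. u \<xi> - R \<xi>) \<in> H2"
    by (intro H2_cong_AE[OF g] Linf_measurable Linf_diff u R)
  then have "(\<lambda>\<xi>. u \<xi> - R \<xi>) \<in> Hinf" using Linf_diff[OF u R] by (intro HinfI)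
  moreover have "R \<in> rational_disk_poles" unfolding R_def rational_disk_poles_def using p(1) by blast
  \<comment> \<open>Membership in \<open>Hinf + rational_disk_poles\<close> asks for equality of
    functions everywhere; hence the analytic summand is u - R and not g, which agrees with it only
    a.e.\<close>
  moreover have "u = (\<lambda>\<xi>. u \<xi> - R \<xi>) + R" by (simp add: fun_eq_iff)
  ultimately show ?thesis by (auto simp: set_plus_def)
qed

text \<open>This says that the Hankel operator with symbol v has finite rank: the functions b j,
  namely \<xi>^j divided by q, are fixed before f. The symbols \<open>\<psi>\<close> and
  \<open>\<eta>\<close> will take the place of v.\<close>

lemma Hinf_plus_rational_mult_H2:
  assumes u: "u \<in> Hinf + rational_disk_poles" and v: "v \<in> Linf" "AE \<xi> in circle. v \<xi> = u \<xi>"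
  shows "\<exists>(N :: nat) b. (\<forall>j<N. b j \<in> L2) \<and>
    (\<forall>f\<in>H2. \<exists>x\<in>H2. \<exists>c. AE \<xi> in circle. v \<xi> * f \<xi> = x \<xi> + (\<Sum>j<N. c j * b j \<xi>))"
proof -
  obtain w p q where w: "w \<in> Hinf" and q: "\<forall>z. poly q z = 0 \<longrightarrow> norm z < 1"
    and u: "u = w + (\<lambda>z. poly p z / poly q z)"
    using u unfolding set_plus_def rational_disk_poles_def by blast
  define b where "b j = (\<lambda>\<xi>. \<xi> ^ j / poly q \<xi>)" for j
  have b: "b j \<in> L2" for j
    using Linf_L2[OF Linf_rational[OF q, of "monom 1 j"]] by (simp add: b_def poly_monom)
  have "\<exists>x\<in>H2. \<exists>c. AE \<xi> in circle. v \<xi> * f \<xi> = x \<xi> + (\<Sum>j<degree q. c j * b j \<xi>)" if f: "f \<in> H2" for f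
  proof -
    obtain g h where g: "g \<in> H2" and h: "h \<in> H2m"
      and gh: "\<And>\<xi>. poly p \<xi> / poly q \<xi> * f \<xi> = g \<xi> + h \<xi>"
      using H2_decomposition[OF L2_mult_Linf[OF Linf_rational[OF q] H2_L2[OF f]]] by blast
    have "(\<lambda>\<xi>. poly p \<xi> * f \<xi> - poly q \<xi> * g \<xi>) \<in> H2"
      by (intro H2_diff H2_mult_Hinf f g) simp_all
    moreover have "AE \<xi> in circle. poly p \<xi> * f \<xi> - poly q \<xi> * g \<xi> = poly q \<xi> * h \<xi>"
      using AE_norm_circle
    proof eventually_elim
      case (elim \<xi>)
      then have "poly q \<xi> \<noteq> 0" using q by force
      then have "poly p \<xi> * f \<xi> = poly q \<xi> * (g \<xi> + h \<xi>)" by (simp flip: gh)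
      then show ?case by (simp add: algebra_simps)
    qed
    moreover have "(\<lambda>\<xi>. poly q \<xi> * h \<xi>) \<in> borel_measurable circle"
      by (intro L2_measurable L2_mult_Linf H2m_L2 h) simp
    ultimately have "(\<lambda>\<xi>. poly q \<xi> * h \<xi>) \<in> H2" using H2_cong_AE by blast
    then obtain a where a: "AE \<xi> in circle. poly q \<xi> * h \<xi> = (\<Sum>j<degree q. a j * \<xi> ^ j)"
      using H2m_poly_mult_H2[OF h] by blast
    show ?thesis
    proof (intro bexI exI)
      show "(\<lambda>\<xi>. w \<xi> * f \<xi> + g \<xi>) \<in> H2" by (intro H2_add H2_mult_Hinf w f g)
      show "AE \<xi> in circle. v \<xi> * f \<xi> = (w \<xi> * f \<xi> + g \<xi>) + (\<Sum>j<degree q. a j * b j \<xi>)"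
        using v(2) a AE_norm_circle
      proof eventually_elim
        case (elim \<xi>)
        then have "poly q \<xi> \<noteq> 0" using q by force
        then have "h \<xi> = (\<Sum>j<degree q. a j * \<xi> ^ j) / poly q \<xi>"
          using elim(2) by (simp add: field_simps)
        then have "h \<xi> = (\<Sum>j<degree q. a j * b j \<xi>)" by (simp add: b_def sum_divide_distrib)
        then show ?case using gh[of \<xi>] elim(1) by (simp add: u distrib_right)
      qed
    qed
  qed
  then show ?thesis using b by blast
qed

section \<open>Both directions of part (ii)\<close>

context big_tto_symbol
begin

text \<open>r is the size of a spanning set of the range: r + 1 images satisfy a nontrivial
  relation, which \<open>big_tto_sum_kernel\<close> moves into the argument.\<close>

lemma finite_rank_kernel:
  assumes "big_tto_finite_rank \<theta> \<phi>"
  shows "\<exists>r. \<forall>f :: nat \<Rightarrow> complex \<Rightarrow> complex. (\<forall>i. f i \<in> K) \<longrightarrow>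
    (\<exists>d. (\<exists>i\<le>r. d i \<noteq> 0) \<and> flip (\<phi> * (\<lambda>\<xi>. \<Sum>i\<le>r. d i * f i \<xi>)) \<in> K)"
proof -
  obtain B where B: "finite B"
    "\<And>f. f \<in> K \<Longrightarrow> \<exists>c. AE \<xi> in circle. big_tto \<theta> \<phi> f \<xi> = (\<Sum>b\<in>B. c b * b \<xi>)"
    using assms unfolding big_tto_finite_rank_def l2_finite_dim_def by auto
  show ?thesis
  proof (intro exI[of _ "card B"] allI impI)
    fix f :: "nat \<Rightarrow> complex \<Rightarrow> complex"
    assume f: "\<forall>i. f i \<in> K"
    define c where "c i = (SOME c. AE \<xi> in circle. big_tto \<theta> \<phi> (f i) \<xi> = (\<Sum>b\<in>B. c b * b \<xi>))" for i
    have c: "AE \<xi> in circle. big_tto \<theta> \<phi> (f i) \<xi> = (\<Sum>b\<in>B. c i b * b \<xi>)" for i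
      unfolding c_def by (rule someI_ex[OF B(2)]) (use f in blast)
    obtain d where d: "\<exists>i\<in>{..card B}. d i \<noteq> 0" "\<forall>b\<in>B. (\<Sum>i\<le>card B. d i * c i b) = 0"
      using exists_nontrivial_relation[OF B(1), of "{..card B}" "\<lambda>b i. c i b"] by auto
    have "AE \<xi> in circle. \<forall>i\<in>{..card B}. big_tto \<theta> \<phi> (f i) \<xi> = (\<Sum>b\<in>B. c i b * b \<xi>)"
      by (intro AE_finite_allI c) simp
    then have "AE \<xi> in circle. (\<Sum>i\<le>card B. d i * big_tto \<theta> \<phi> (f i) \<xi>) = 0"
    proof eventually_elim
      case (elim \<xi>)
      then have "(\<Sum>i\<le>card B. d i * big_tto \<theta> \<phi> (f i) \<xi>) = (\<Sum>i\<le>card B. \<Sum>b\<in>B. d i * c i b * b \<xi>)"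
        by (simp add: sum_distrib_left mult.assoc)
      also have "\<dots> = (\<Sum>b\<in>B. (\<Sum>i\<le>card B. d i * c i b) * b \<xi>)"
        by (subst sum.swap) (simp add: sum_distrib_right)
      finally show ?case using d(2) by simp
    qed
    then have "flip (\<phi> * (\<lambda>\<xi>. \<Sum>i\<le>card B. d i * f i \<xi>)) \<in> K"
      by (intro big_tto_sum_kernel) (use f in auto)
    then show "\<exists>d. (\<exists>i\<le>card B. d i \<noteq> 0) \<and> flip (\<phi> * (\<lambda>\<xi>. \<Sum>i\<le>card B. d i * f i \<xi>)) \<in> K"
      using d(1) by auto
  qed
qed

lemma big_tto_finite_rank_only_if:
  assumes "\<not> l2_finite_dim K" "big_tto_finite_rank \<theta> \<phi>"
  shows "\<phi> \<in> ae_class (cnj_set (\<theta> *o (Hinf + rational_disk_poles)))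
    \<inter> ae_class (breve \<theta> *o (Hinf + rational_disk_poles))"
proof -
  obtain r where r: "\<And>f :: nat \<Rightarrow> complex \<Rightarrow> complex. (\<And>i. f i \<in> K) \<Longrightarrow>
      \<exists>d. (\<exists>i\<le>r. d i \<noteq> 0) \<and> flip (\<phi> * (\<lambda>\<xi>. \<Sum>i\<le>r. d i * f i \<xi>)) \<in> K"
    using finite_rank_kernel[OF assms(2)] by blast
  have r': "\<exists>d. (\<exists>i\<le>r. d i \<noteq> 0) \<and> (\<lambda>\<xi>. \<phi> \<xi> * (\<Sum>i\<le>r. d i * f i \<xi>)) \<in> H2m \<and>
      (\<lambda>\<xi>. \<psi> \<xi> * (\<Sum>i\<le>r. d i * f i \<xi>)) \<in> H2" if f: "\<And>i. f i \<in> K" for f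
  proof -
    obtain d where d: "\<exists>i\<le>r. d i \<noteq> 0" "flip (\<phi> * (\<lambda>\<xi>. \<Sum>i\<le>r. d i * f i \<xi>)) \<in> K"
      using r[of f] f by blast
    have "(\<lambda>\<xi>. \<Sum>i\<le>r. d i * f i \<xi>) \<in> L2" by (intro L2_sum L2_cmult K_L2 f)
    from flip_phi_mult_K_iff[OF this] d show ?thesis by (intro exI[of _ d]) auto
  qed
  have "\<exists>q. q \<noteq> 0 \<and> (\<lambda>\<xi>. poly q \<xi> * \<psi> \<xi>) \<in> H2"
    by (rule exists_poly_mult_H2[OF assms(1) psi_Linf, of r]) (use r' in blast)
  then have psi: "\<psi> \<in> Hinf + rational_disk_poles"
    using poly_mult_H2_imp_Hinf_plus_rational[OF psi_Linf] by blast
  have "\<exists>q. q \<noteq> 0 \<and> (\<lambda>\<xi>. poly q \<xi> * \<eta> \<xi>) \<in> H2"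
  proof (rule exists_poly_mult_H2[OF assms(1) eta_Linf, of r])
    fix f :: "nat \<Rightarrow> complex \<Rightarrow> complex" assume f: "\<And>i. f i \<in> K"
    \<comment> \<open>The kernel condition is applied to the conjugates of the f i, because the
      conjugation trades \<open>\<phi>\<close> for \<open>\<eta>\<close>; as it is antilinear, the
      final witness has conjugated coefficients.\<close>
    obtain d where d: "\<exists>i\<le>r. d i \<noteq> 0" "(\<lambda>\<xi>. \<phi> \<xi> * (\<Sum>i\<le>r. d i * conj_K (f i) \<xi>)) \<in> H2m"
      using r'[of "\<lambda>i. conj_K (f i)"] conj_K_K[OF f] by blast
    have "(\<lambda>\<xi>. \<Sum>i\<le>r. d i * conj_K (f i) \<xi>) = conj_K (\<lambda>\<xi>. \<Sum>i\<le>r. cnj (d i) * f i \<xi>)"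
      by (simp add: conj_K_def sum_distrib_left mult_ac)
    then have "(\<lambda>\<xi>. \<phi> \<xi> * conj_K (\<lambda>\<xi>. \<Sum>i\<le>r. cnj (d i) * f i \<xi>) \<xi>) \<in> H2m"
      using d(2) by (simp add: fun_eq_iff)
    then have "(\<lambda>\<xi>. \<eta> \<xi> * (\<Sum>i\<le>r. cnj (d i) * f i \<xi>)) \<in> H2"
      by (subst (asm) phi_mult_conj_K_iff) (intro K_sum K_cmult f)
    then show "\<exists>d. (\<exists>i\<le>r. d i \<noteq> 0) \<and> (\<lambda>\<xi>. \<eta> \<xi> * (\<Sum>i\<le>r. d i * f i \<xi>)) \<in> H2"
      using d(1) by (intro exI[of _ "\<lambda>i. cnj (d i)"]) auto
  qed
  then have eta: "\<eta> \<in> Hinf + rational_disk_poles"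
    using poly_mult_H2_imp_Hinf_plus_rational[OF eta_Linf] by blast
  show ?thesis
    using psi eta by (auto simp: mem_ae_class_cnj_iff mem_ae_class_breve_iff)
qed

text \<open>Carries a decomposition of \<open>\<eta> * conj_K f\<close> back to
  \<open>\<phi> * f\<close>.\<close>

lemma phi_mult_eq_conj_K:
  "AE \<xi> in circle. \<phi> \<xi> * f \<xi> = cnj \<xi> * cnj (\<eta> \<xi> * conj_K f \<xi>)"
  using AE_theta AE_norm_circle
proof eventually_elim
  case (elim \<xi>)
  have "cnj \<xi> * cnj (\<eta> \<xi> * conj_K f \<xi>) = (\<theta> \<xi> * cnj (\<theta> \<xi>)) * (\<xi> * cnj \<xi>) * (\<phi> \<xi> * f \<xi>)"
    by (simp add: \<eta>_def conj_K_def mult_ac)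
  then show ?case by (simp add: mult_cnj_cancel elim)
qed

lemma AE_flip:
  assumes "AE \<xi> in circle. f \<xi> = g \<xi>"
  shows "AE \<xi> in circle. flip f \<xi> = flip g \<xi>"
  using AE_circle_cnj[OF assms] by eventually_elim (simp add: flip_def)

text \<open>By \<open>K_decomposition\<close> the value is the \<open>H2m\<close> part of flip (phi
  * f) plus \<theta> times the \<open>H2\<close> part of cnj \<theta> * flip (phi * f). The
  splittings hold only a.e. because they come from a.e. identities for \<open>\<psi>\<close> and
  \<open>\<eta>\<close>.\<close>

lemma big_tto_eq:
  assumes f: "f \<in> K"
    and 1: "X1 \<in> H2m" "AE \<xi> in circle. cnj (\<theta> \<xi>) * flip (\<phi> * f) \<xi> = g' \<xi> + X1 \<xi>" "g' \<in> H2"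
    and 2: "X2 \<in> H2" "AE \<xi> in circle. flip (\<phi> * f) \<xi> = X2 \<xi> + h \<xi>" "h \<in> H2m"
  shows "AE \<xi> in circle. big_tto \<theta> \<phi> f \<xi> = h \<xi> + \<theta> \<xi> * g' \<xi>"
proof -
  define F where "F = flip (\<phi> * f)"
  have F: "F \<in> L2" unfolding F_def by (intro L2_flip phi_mult_L2 K_L2 f)
  have tF: "(\<lambda>\<xi>. cnj (\<theta> \<xi>) * F \<xi>) \<in> L2" by (intro L2_mult_Linf Linf_cnj theta_Linf F)
  have "(\<lambda>\<xi>. F \<xi> - X2 \<xi>) \<in> H2m"
  proof (rule H2m_cong_AE[OF 2(3)])
    show "(\<lambda>\<xi>. F \<xi> - X2 \<xi>) \<in> borel_measurable circle"
      by (intro L2_measurable L2_diff F H2_L2 2)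
    show "AE \<xi> in circle. h \<xi> = F \<xi> - X2 \<xi>"
      using 2(2) by eventually_elim (simp add: F_def)
  qed
  moreover have "(\<lambda>\<xi>. cnj (\<theta> \<xi>) * F \<xi> - g' \<xi>) \<in> H2m"
  proof (rule H2m_cong_AE[OF 1(1)])
    show "(\<lambda>\<xi>. cnj (\<theta> \<xi>) * F \<xi> - g' \<xi>) \<in> borel_measurable circle"
      by (intro L2_measurable L2_diff tF H2_L2 1)
    show "AE \<xi> in circle. X1 \<xi> = cnj (\<theta> \<xi>) * F \<xi> - g' \<xi>"
      using 1(2) by eventually_elim (simp add: F_def)
  qed
  ultimately have p: "(\<lambda>\<xi>. X2 \<xi> - \<theta> \<xi> * g' \<xi>) \<in> K" "(\<lambda>\<xi>. F \<xi> - X2 \<xi> + \<theta> \<xi> * g' \<xi>) \<in> l2_orth K"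
    using K_decomposition[OF F 2(1) _ _ 1(3)] by auto
  have "(\<lambda>\<xi>. F \<xi> - (X2 \<xi> - \<theta> \<xi> * g' \<xi>)) \<in> l2_orth K" using p(2) by (simp add: algebra_simps)
  from l2_proj_K_unique[OF F p(1) this] 2(2) show ?thesis
    by eventually_elim (simp add: big_tto_def F_def)
qed

lemma big_tto_finite_rank_if:
  assumes "\<phi> \<in> ae_class (cnj_set (\<theta> *o (Hinf + rational_disk_poles)))
    \<inter> ae_class (breve \<theta> *o (Hinf + rational_disk_poles))"
  shows "big_tto_finite_rank \<theta> \<phi>"
proof -
  obtain u where u: "u \<in> Hinf + rational_disk_poles" "AE \<xi> in circle. \<psi> \<xi> = u \<xi>"
    using assms by (auto simp: mem_ae_class_breve_iff)
  obtain v where v: "v \<in> Hinf + rational_disk_poles" "AE \<xi> in circle. \<eta> \<xi> = v \<xi>"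
    using assms by (auto simp: mem_ae_class_cnj_iff)
  obtain M :: nat and a where a: "\<And>j. j < M \<Longrightarrow> a j \<in> L2"
    and psi: "\<And>f. f \<in> H2 \<Longrightarrow> \<exists>x\<in>H2. \<exists>c. AE \<xi> in circle. \<psi> \<xi> * f \<xi> = x \<xi> + (\<Sum>j<M. c j * a j \<xi>)"
    using Hinf_plus_rational_mult_H2[OF u(1) psi_Linf u(2)] by blast
  obtain N :: nat and b where b: "\<And>j. j < N \<Longrightarrow> b j \<in> L2"
    and eta: "\<And>f. f \<in> H2 \<Longrightarrow> \<exists>x\<in>H2. \<exists>c. AE \<xi> in circle. \<eta> \<xi> * f \<xi> = x \<xi> + (\<Sum>j<N. c j * b j \<xi>)"
    using Hinf_plus_rational_mult_H2[OF v(1) eta_Linf v(2)] by blast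
  \<comment> \<open>\<open>flip\<close> sends the \<open>H2\<close> part of psi * f into
    \<open>H2m\<close>; the \<open>H2\<close> part g' needed in \<open>big_tto_eq\<close> therefore
    comes only from the finitely many \<open>flip (a j)\<close>.\<close>
  have "\<exists>g h. g \<in> H2 \<and> h \<in> H2m \<and> (\<forall>\<xi>. flip (a j) \<xi> = g \<xi> + h \<xi>)" if "j < M" for j
    using H2_decomposition[OF L2_flip[OF a[OF that]]] by metis
  then obtain ga ha where A: "\<And>j. j < M \<Longrightarrow> ga j \<in> H2" "\<And>j. j < M \<Longrightarrow> ha j \<in> H2m"
    "\<And>j \<xi>. j < M \<Longrightarrow> flip (a j) \<xi> = ga j \<xi> + ha j \<xi>"
    by metis
  \<comment> \<open>What b j becomes on the way from \<open>\<eta> * conj_K f\<close> to flip (phi *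
    f): conjugation with the factor \<open>cnj \<xi>\<close>, then \<open>flip\<close>.\<close>
  define b' where "b' j = flip (\<lambda>\<xi>. cnj \<xi> * cnj (b j \<xi>))" for j
  have b': "b' j \<in> L2" if "j < N" for j
    unfolding b'_def by (intro L2_flip L2_mult_Linf[OF Linf_cnj[OF Hinf_Linf[OF Hinf_id]]] L2_cnj b that)
  have "\<exists>g h. g \<in> H2 \<and> h \<in> H2m \<and> (\<forall>\<xi>. b' j \<xi> = g \<xi> + h \<xi>)" if "j < N" for j
    using H2_decomposition[OF b'[OF that]] by metis
  then obtain gb hb where B: "\<And>j. j < N \<Longrightarrow> gb j \<in> H2" "\<And>j. j < N \<Longrightarrow> hb j \<in> H2m"
    "\<And>j \<xi>. j < N \<Longrightarrow> b' j \<xi> = gb j \<xi> + hb j \<xi>"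
    by metis
  \<comment> \<open>The spanning family read off from \<open>big_tto_eq\<close>: the
    \<open>H2m\<close> parts hb j, and \<theta> times the \<open>H2\<close> parts ga j.\<close>
  define e where "e = case_sum hb (\<lambda>j \<xi>. \<theta> \<xi> * ga j \<xi>)"
  have "l2_finite_dim (big_tto \<theta> \<phi> ` K)"
  proof (rule l2_finite_dimI)
    show "finite ({..<N} <+> {..<M})" by simp
    show "e i \<in> L2" if "i \<in> {..<N} <+> {..<M}" for i
    proof (cases i)
      case (Inl j)
      then show ?thesis using that B(2)[THEN H2m_L2] by (auto simp: e_def)
    next
      case (Inr j)
      then show ?thesis using that A(1)[THEN H2_L2] L2_mult_Linf[OF theta_Linf] by (auto simp: e_def)
    qed
    fix y assume "y \<in> big_tto \<theta> \<phi> ` K"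
    then obtain f where f: "f \<in> K" and y: "y = big_tto \<theta> \<phi> f" by blast
    obtain x1 c1 where x1: "x1 \<in> H2" and c1: "AE \<xi> in circle. \<psi> \<xi> * f \<xi> = x1 \<xi> + (\<Sum>j<M. c1 j * a j \<xi>)"
      using psi[OF K_H2[OF f]] by blast
    obtain x2 c2 where x2: "x2 \<in> H2" and c2: "AE \<xi> in circle. \<eta> \<xi> * conj_K f \<xi> = x2 \<xi> + (\<Sum>j<N. c2 j * b j \<xi>)"
      using eta[OF K_H2[OF conj_K_K[OF f]]] by blast
    define x2' where "x2' = (\<lambda>\<xi>. cnj \<xi> * cnj (x2 \<xi>))"
    have "x2' \<in> H2m"
      unfolding H2m_iff_cnj
    proof
      note [measurable] = L2_measurable[OF H2_L2[OF x2]]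
      show m: "x2' \<in> borel_measurable circle" unfolding x2'_def by measurable
      show "(\<lambda>\<xi>. cnj \<xi> * cnj (x2' \<xi>)) \<in> H2"
      proof (rule H2_cong_AE[OF x2])
        show "(\<lambda>\<xi>. cnj \<xi> * cnj (x2' \<xi>)) \<in> borel_measurable circle" using m by measurable
        show "AE \<xi> in circle. x2 \<xi> = cnj \<xi> * cnj (x2' \<xi>)"
          using AE_norm_circle by eventually_elim (simp add: x2'_def mult_cnj_cancel)
      qed
    qed
    then have X2: "(\<lambda>\<xi>. flip x2' \<xi> + (\<Sum>j<N. cnj (c2 j) * gb j \<xi>)) \<in> H2"
      by (intro H2_add H2_sum H2_cmult flip_H2m B) auto
    have X1: "(\<lambda>\<xi>. flip x1 \<xi> + (\<Sum>j<M. c1 j * ha j \<xi>)) \<in> H2m"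
      by (intro H2m_add H2m_sum H2m_cmult flip_H2 A x1) auto
    have "(\<lambda>\<xi>. cnj (\<theta> \<xi>) * flip (\<phi> * f) \<xi>) = flip (\<lambda>\<xi>. \<psi> \<xi> * f \<xi>)"
      by (simp add: flip_def \<psi>_def breve_def mult_ac)
    moreover have "AE \<xi> in circle. flip (\<lambda>\<xi>. \<psi> \<xi> * f \<xi>) \<xi> = flip (\<lambda>\<xi>. x1 \<xi> + (\<Sum>j<M. c1 j * a j \<xi>)) \<xi>"
      by (rule AE_flip[OF c1])
    moreover have "flip (\<lambda>\<xi>. x1 \<xi> + (\<Sum>j<M. c1 j * a j \<xi>)) \<xi> =
        (\<Sum>j<M. c1 j * ga j \<xi>) + (flip x1 \<xi> + (\<Sum>j<M. c1 j * ha j \<xi>))" for \<xi>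
    proof -
      have "flip (\<lambda>\<xi>. x1 \<xi> + (\<Sum>j<M. c1 j * a j \<xi>)) \<xi> = flip x1 \<xi> + (\<Sum>j<M. c1 j * flip (a j) \<xi>)"
        by (simp add: flip_def distrib_left sum_distrib_left mult_ac)
      also have "(\<Sum>j<M. c1 j * flip (a j) \<xi>) = (\<Sum>j<M. c1 j * (ga j \<xi> + ha j \<xi>))"
        by (intro sum.cong refl) (simp add: A)
      finally show ?thesis by (simp add: distrib_left sum.distrib)
    qed
    ultimately have eq1: "AE \<xi> in circle. cnj (\<theta> \<xi>) * flip (\<phi> * f) \<xi> =
        (\<Sum>j<M. c1 j * ga j \<xi>) + (flip x1 \<xi> + (\<Sum>j<M. c1 j * ha j \<xi>))"
      by (simp add: fun_eq_iff)
    have "AE \<xi> in circle. \<phi> \<xi> * f \<xi> = x2' \<xi> + (\<Sum>j<N. cnj (c2 j) * (cnj \<xi> * cnj (b j \<xi>)))"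
      using phi_mult_eq_conj_K[of f] c2
      by eventually_elim (simp add: x2'_def distrib_left sum_distrib_left mult_ac)
    then have "AE \<xi> in circle. flip (\<lambda>\<xi>. \<phi> \<xi> * f \<xi>) \<xi> =
        flip (\<lambda>\<xi>. x2' \<xi> + (\<Sum>j<N. cnj (c2 j) * (cnj \<xi> * cnj (b j \<xi>)))) \<xi>"
      by (rule AE_flip)
    moreover have "flip (\<lambda>\<xi>. x2' \<xi> + (\<Sum>j<N. cnj (c2 j) * (cnj \<xi> * cnj (b j \<xi>)))) \<xi> =
        (flip x2' \<xi> + (\<Sum>j<N. cnj (c2 j) * gb j \<xi>)) + (\<Sum>j<N. cnj (c2 j) * hb j \<xi>)" for \<xi>
    proof -
      have "flip (\<lambda>\<xi>. x2' \<xi> + (\<Sum>j<N. cnj (c2 j) * (cnj \<xi> * cnj (b j \<xi>)))) \<xi> =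
          flip x2' \<xi> + (\<Sum>j<N. cnj (c2 j) * b' j \<xi>)"
        by (simp add: flip_def b'_def distrib_left sum_distrib_left mult_ac)
      also have "(\<Sum>j<N. cnj (c2 j) * b' j \<xi>) = (\<Sum>j<N. cnj (c2 j) * (gb j \<xi> + hb j \<xi>))"
        by (intro sum.cong refl) (simp add: B)
      finally show ?thesis by (simp add: distrib_left sum.distrib)
    qed
    ultimately have eq2: "AE \<xi> in circle. flip (\<phi> * f) \<xi> =
        (flip x2' \<xi> + (\<Sum>j<N. cnj (c2 j) * gb j \<xi>)) + (\<Sum>j<N. cnj (c2 j) * hb j \<xi>)"
      by (simp add: times_fun_def)
    have "AE \<xi> in circle. y \<xi> = (\<Sum>j<N. cnj (c2 j) * hb j \<xi>) + \<theta> \<xi> * (\<Sum>j<M. c1 j * ga j \<xi>)"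
      unfolding y by (rule big_tto_eq[OF f X1 eq1 _ X2 eq2]) (auto intro!: H2_sum H2_cmult H2m_sum H2m_cmult A B)
    moreover have "(\<Sum>i\<in>{..<N} <+> {..<M}. case_sum (\<lambda>j. cnj (c2 j)) c1 i * e i \<xi>) =
        (\<Sum>j<N. cnj (c2 j) * hb j \<xi>) + \<theta> \<xi> * (\<Sum>j<M. c1 j * ga j \<xi>)" for \<xi>
      by (simp add: sum.Plus e_def sum_distrib_left mult_ac)
    ultimately show "\<exists>c. AE \<xi> in circle. y \<xi> = (\<Sum>i\<in>{..<N} <+> {..<M}. c i * e i \<xi>)"
      by (intro exI[of _ "case_sum (\<lambda>j. cnj (c2 j)) c1"]) simp
  qed
  then show ?thesis by (simp add: big_tto_finite_rank_def)
qed

end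

theorem theorem4p5:
  fixes \<theta> \<phi> :: "complex \<Rightarrow> complex"
  assumes "inner_function \<theta>" and "\<phi> \<in> Linf"
  shows
    "(\<not> ae_constant \<theta> \<longrightarrow>
       (big_tto_zero \<theta> \<phi> \<longleftrightarrow>
         \<phi> \<in> ae_class (cnj_set (\<theta> *o Hinf)) \<inter> ae_class (breve \<theta> *o Hinf))) \<and>
     (\<not> l2_finite_dim (model_space \<theta>) \<longrightarrow>
       (big_tto_finite_rank \<theta> \<phi> \<longleftrightarrow>
         \<phi> \<in> ae_class (cnj_set (\<theta> *o (Hinf + rational_disk_poles)))
           \<inter> ae_class (breve \<theta> *o (Hinf + rational_disk_poles)))) \<and>
     (\<phi> \<in> ae_class (cnj_set (\<theta> *o Hinf)) \<inter> ae_class (breve \<theta> *o Hinf) \<longrightarrow>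
       big_tto_zero \<theta> \<phi>) \<and>
     (\<phi> \<in> ae_class (cnj_set (\<theta> *o (Hinf + rational_disk_poles)))
           \<inter> ae_class (breve \<theta> *o (Hinf + rational_disk_poles)) \<longrightarrow>
       big_tto_finite_rank \<theta> \<phi>)"
proof -
  interpret big_tto_symbol \<theta> \<phi>
    by standard (use assms in auto)
  show ?thesis
    using big_tto_zero_if big_tto_zero_only_if big_tto_finite_rank_if big_tto_finite_rank_only_if
    by blast
qed

end
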